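(* Let $1\le p\le q\le+\infty$, $T>0$, $x_0,x_T\in\mathbb{R}^d$, $U=L^m_q(0,T)$, $\theta\colon\mathbb{R}^d\times\mathbb{R}^m\times[0,T]\to\mathbb{R}$, $f\colon\mathbb{R}^d\times\mathbb{R}^m\times[0,T]\to\mathbb{R}^d$, and let $(x^*,u^* )$ be a locally optimal solution of the problem $$\min\ \mathcal{I}(x,u)=\int_0^T\theta(x(t),u(t),t)\,dt\quad\text{subject to}\quad\dot x(t)=f(x(t),u(t),t),\ t\in[0,T],\ x(0)=x_0,\ x(T)=x_T,\ u\in U\qquad(\ast)$$ in $X=W^d_{1,p}(0,T)\times L^m_q(0,T)$. Suppose that: 1. $\theta$ and $f$ are continuous, differentiable in $x$ and $u$, and the functions $\nabla_x\theta$, $\nabla_u\theta$, $\nabla_xf$ and $\nabla_uf$ are continuous; 2. either $q=+\infty$, or all of the following hold: $\theta$ and $\nabla_x\theta$ satisfy the growth condition of order $(q,1)$; $\nabla_u\theta$ satisfies the growth condition of order $(q-1,q')$; $f$ and $\nabla_xf$ satisfy the growth condition of order $(q/p,p)$; and $\nabla_uf$ satisfies the growth condition of order $(q/s,s)$ with $s=qp/(q-p)$ in the case $q>p$, while $\nabla_uf$ does not depend on $u$ in the case $q=p$; 3. the linearised system $\dot h(t)=A(t)h(t)+B(t)v(t)$ with $A(t)=\nabla_xf(x^*(t),u^*(t),t)$ and $B(t)=\nabla_uf(x^*(t),u^*(t),t)$ is completely controllable using $L^q$-controls in time $T$. Then the penalty function $\Phi_\lambda(x,u)=\mathcal{I}(x,u)+\lambda|x(T)-x_T|$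 for problem $(\ast)$ is locally exact at $(x^*,u^* )$, i.e. there exists $\lambda^*(x^*,u^* )\ge0$ such that for every $\lambda\ge\lambda^*(x^*,u^* )$ the pair $(x^*,u^* )$ is a locally optimal solution (in $X$) of the problem of minimising $\Phi_\lambda(x,u)$ over all $(x,u)\in X$ with $x(0)=x_0$, $u\in U$ and $\dot x(t)=f(x(t),u(t),t)$ for a.e. $t\in[0,T]$.
   Context: Spaces: $L^m_q(0,T)$ is the product of $m$ copies of $L^q(0,T)$ with norm $\|u\|_q=(\int_0^T|u(t)|^q\,dt)^{1/q}$ (ess sup of the Euclidean norm if $q=+\infty$). $W^d_{1,p}(0,T)$ is the space of absolutely continuous $x\colon[0,T]\to\mathbb{R}^d$ with $\dot x\in L^d_p(0,T)$, norm $\|x\|_{1,p}=\|x\|_p+\|\dot x\|_p$. $X$ carries the sum norm, with respect to which local optimality is understood. $r'$ is the conjugate exponent of $r$. Growth condition: $g\colon\mathbb{R}^d\times\mathbb{R}^m\times[0,T]\to\mathbb{R}^k$ satisfies the growth condition of order $(l,s)$, $0\le l<+\infty$, $1\le s\le+\infty$, if for any $R>0$ there exist $C_R>0$ and an a.e. nonnegative $\omega_R\in L^s(0,T)$ with $|g(x,u,t)|\le C_R|u|^l+\omega_R(t)$ for a.e. $t\in[0,T]$ and all $(x,u)$ with $|x|\le R$. Complete controllability: the linear system $\dot x(t)=A(t)x(t)+B(t)u(t)$ is completely controllable using $L^q$-controls in time $T$ if for any initial state $\xi_0\in\mathbb{R}^d$ and any final state $\xi_T\in\mathbb{R}^d$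 one can find $u\in L^m_q(0,T)$ such that there exists an absolutely continuous solution $x$ on $[0,T]$ with $x(0)=\xi_0$ and $x(T)=\xi_T$. *)

theory Defs
  imports "HOL-Analysis.Analysis" "HOL-Probability.Essential_Supremum"
begin

text \<open>
  Exponents are extended nonnegative reals, with \<open>\<infinity>\<close> allowed. Elements of the function spaces on
  the interval from \<open>0\<close> to \<open>T\<close> are represented by total functions on the reals (not by equivalence
  classes); the function-space notions below depend only on their restriction to \<open>{0..T}\<close>, and those concerning
  elements of \<open>L\<^sup>q\<close> are invariant under changes on a null set.
\<close>

definition conj_exponent :: "ennreal \<Rightarrow> ennreal" where
  "conj_exponent r = (if r = \<infinity> then 1 else r / (r - 1))"

definition Lp :: "ennreal \<Rightarrow> real \<Rightarrow> (real \<Rightarrow> 'a::euclidean_space) set" where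
  "Lp q T = {u. u \<in> borel_measurable (lebesgue_on {0..T}) \<and>
     (if q = \<infinity> then esssup (lebesgue_on {0..T}) (\<lambda>t. ennreal (norm (u t))) < \<infinity>
      else integrable (lebesgue_on {0..T}) (\<lambda>t. norm (u t) powr enn2real q))}"

definition Lp_norm :: "ennreal \<Rightarrow> real \<Rightarrow> (real \<Rightarrow> 'a::euclidean_space) \<Rightarrow> real" where
  "Lp_norm q T u =
     (if q = \<infinity> then enn2real (esssup (lebesgue_on {0..T}) (\<lambda>t. ennreal (norm (u t))))
      else (LINT t|lebesgue_on {0..T}. norm (u t) powr enn2real q) powr (1 / enn2real q))"

definition abs_continuous_on_interval ::
    "real \<Rightarrow> real \<Rightarrow> (real \<Rightarrow> 'a::real_normed_vector) \<Rightarrow> bool" where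
  "abs_continuous_on_interval a b x \<longleftrightarrow>
     (\<forall>\<epsilon>>0. \<exists>\<delta>>0. \<forall>I. finite I \<longrightarrow>
        (\<forall>(s, t)\<in>I. a \<le> s \<and> s \<le> t \<and> t \<le> b) \<longrightarrow>
        disjoint_family_on (\<lambda>(s, t). {s<..<t}) I \<longrightarrow>
        (\<Sum>(s, t)\<in>I. t - s) < \<delta> \<longrightarrow>
        (\<Sum>(s, t)\<in>I. norm (x t - x s)) < \<epsilon>)"

definition time_deriv :: "real \<Rightarrow> (real \<Rightarrow> 'a::real_normed_vector) \<Rightarrow> real \<Rightarrow> 'a" where
  "time_deriv T x t = vector_derivative x (at t within {0..T})"

definition W1p :: "ennreal \<Rightarrow> real \<Rightarrow> (real \<Rightarrow> 'a::euclidean_space) set" where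
  "W1p p T = {x. abs_continuous_on_interval 0 T x \<and> time_deriv T x \<in> Lp p T}"

definition W1p_norm :: "ennreal \<Rightarrow> real \<Rightarrow> (real \<Rightarrow> 'a::euclidean_space) \<Rightarrow> real" where
  "W1p_norm p T x = Lp_norm p T x + Lp_norm p T (time_deriv T x)"

definition X_space :: "ennreal \<Rightarrow> ennreal \<Rightarrow> real \<Rightarrow>
    ((real \<Rightarrow> real^'d) \<times> (real \<Rightarrow> real^'m)) set" where
  "X_space p q T = W1p p T \<times> Lp q T"

definition X_norm :: "ennreal \<Rightarrow> ennreal \<Rightarrow> real \<Rightarrow>
    (real \<Rightarrow> real^'d) \<Rightarrow> (real \<Rightarrow> real^'m) \<Rightarrow> real" where
  "X_norm p q T x u = W1p_norm p T x + Lp_norm q T u"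

definition locally_optimal :: "ennreal \<Rightarrow> ennreal \<Rightarrow> real \<Rightarrow>
    ((real \<Rightarrow> real^'d) \<times> (real \<Rightarrow> real^'m)) set \<Rightarrow>
    ((real \<Rightarrow> real^'d) \<Rightarrow> (real \<Rightarrow> real^'m) \<Rightarrow> real) \<Rightarrow>
    (real \<Rightarrow> real^'d) \<Rightarrow> (real \<Rightarrow> real^'m) \<Rightarrow> bool" where
  "locally_optimal p q T \<Omega> J xs us \<longleftrightarrow>
     (xs, us) \<in> \<Omega> \<and>
     (\<exists>r>0. \<forall>(x, u)\<in>\<Omega>.
        X_norm p q T (\<lambda>t. x t - xs t) (\<lambda>t. u t - us t) < r \<longrightarrow> J xs us \<le> J x u)"

definition satisfies_ode :: "real \<Rightarrow> (real \<Rightarrow> 'a::real_normed_vector) \<Rightarrow> (real \<Rightarrow> 'a) \<Rightarrow> bool" where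
  "satisfies_ode T x rhs \<longleftrightarrow>
     (AE t in lebesgue_on {0..T}. (x has_vector_derivative rhs t) (at t within {0..T}))"

definition admissible :: "ennreal \<Rightarrow> ennreal \<Rightarrow> real \<Rightarrow>
    (real^'d \<Rightarrow> real^'m \<Rightarrow> real \<Rightarrow> real^'d) \<Rightarrow> (real \<Rightarrow> real^'m) set \<Rightarrow> real^'d \<Rightarrow>
    ((real \<Rightarrow> real^'d) \<times> (real \<Rightarrow> real^'m)) set" where
  "admissible p q T f U x0 =
     {(x, u). (x, u) \<in> X_space p q T \<and> x 0 = x0 \<and> u \<in> U \<and>
        satisfies_ode T x (\<lambda>t. f (x t) (u t) t)}"

definition feasible :: "ennreal \<Rightarrow> ennreal \<Rightarrow> real \<Rightarrow>
    (real^'d \<Rightarrow> real^'m \<Rightarrow> real \<Rightarrow> real^'d) \<Rightarrow> (real \<Rightarrow> real^'m) set \<Rightarrow> real^'d \<Rightarrow> real^'d \<Rightarrow>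
    ((real \<Rightarrow> real^'d) \<times> (real \<Rightarrow> real^'m)) set" where
  "feasible p q T f U x0 xT = {(x, u). (x, u) \<in> admissible p q T f U x0 \<and> x T = xT}"

definition objective :: "real \<Rightarrow> (real^'d \<Rightarrow> real^'m \<Rightarrow> real \<Rightarrow> real) \<Rightarrow>
    (real \<Rightarrow> real^'d) \<Rightarrow> (real \<Rightarrow> real^'m) \<Rightarrow> real" where
  "objective T \<theta> x u = (LINT t|lebesgue_on {0..T}. \<theta> (x t) (u t) t)"

definition penalty :: "real \<Rightarrow> (real^'d \<Rightarrow> real^'m \<Rightarrow> real \<Rightarrow> real) \<Rightarrow> real^'d \<Rightarrow> real \<Rightarrow>
    (real \<Rightarrow> real^'d) \<Rightarrow> (real \<Rightarrow> real^'m) \<Rightarrow> real" where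
  "penalty T \<theta> xT c x u = objective T \<theta> x u + c * norm (x T - xT)"

definition grad :: "('a::real_inner \<Rightarrow> real) \<Rightarrow> 'a \<Rightarrow> 'a" where
  "grad F x = (THE D. GDERIV F x :> D)"

definition grad_x :: "('a::real_inner \<Rightarrow> 'b \<Rightarrow> real \<Rightarrow> real) \<Rightarrow> 'a \<Rightarrow> 'b \<Rightarrow> real \<Rightarrow> 'a" where
  "grad_x \<theta> x u t = grad (\<lambda>y. \<theta> y u t) x"

definition grad_u :: "('a \<Rightarrow> 'b::real_inner \<Rightarrow> real \<Rightarrow> real) \<Rightarrow> 'a \<Rightarrow> 'b \<Rightarrow> real \<Rightarrow> 'b" where
  "grad_u \<theta> x u t = grad (\<lambda>v. \<theta> x v t) u"

definition jac_x :: "(real^'d \<Rightarrow> 'b \<Rightarrow> real \<Rightarrow> real^'k) \<Rightarrow> real^'d \<Rightarrow> 'b \<Rightarrow> real \<Rightarrow> real^'d^'k" where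
  "jac_x f x u t = jacobian (\<lambda>y. f y u t) (at x)"

definition jac_u :: "('a \<Rightarrow> real^'m \<Rightarrow> real \<Rightarrow> real^'k) \<Rightarrow> 'a \<Rightarrow> real^'m \<Rightarrow> real \<Rightarrow> real^'m^'k" where
  "jac_u f x u t = jacobian (\<lambda>v. f x v t) (at u)"

definition jointly_continuous :: "real \<Rightarrow>
    ('a::topological_space \<Rightarrow> 'b::topological_space \<Rightarrow> real \<Rightarrow> 'c::topological_space) \<Rightarrow> bool" where
  "jointly_continuous T g \<longleftrightarrow> continuous_on (UNIV \<times> UNIV \<times> {0..T}) (\<lambda>(x, u, t). g x u t)"

definition differentiable_in_x_u :: "real \<Rightarrow>
    ('a::real_normed_vector \<Rightarrow> 'b::real_normed_vector \<Rightarrow> real \<Rightarrow> 'c::real_normed_vector) \<Rightarrow> bool" where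
  "differentiable_in_x_u T g \<longleftrightarrow>
     (\<forall>x u. \<forall>t\<in>{0..T}. (\<lambda>y. g y u t) differentiable (at x) \<and> (\<lambda>v. g x v t) differentiable (at u))"

text \<open>
  The convention \<open>|u|\<^sup>0 = 1\<close> (also for \<open>u = 0\<close>) is made explicit, since \<open>0 powr 0 = 0\<close>. The norm of a
  matrix-valued \<open>g\<close> is the Euclidean norm of its entries.
\<close>

definition growth_condition :: "real \<Rightarrow> real \<Rightarrow> ennreal \<Rightarrow>
    (real^'d \<Rightarrow> real^'m \<Rightarrow> real \<Rightarrow> 'k::euclidean_space) \<Rightarrow> bool" where
  "growth_condition T l s g \<longleftrightarrow>
     (\<forall>R>0. \<exists>C>0. \<exists>\<omega>::real \<Rightarrow> real. \<omega> \<in> Lp s T \<and>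
        (AE t in lebesgue_on {0..T}. 0 \<le> \<omega> t) \<and>
        (AE t in lebesgue_on {0..T}. \<forall>x u. norm x \<le> R \<longrightarrow>
           norm (g x u t) \<le> C * (if l = 0 then 1 else norm u powr l) + \<omega> t))"

definition completely_controllable :: "ennreal \<Rightarrow> real \<Rightarrow>
    (real \<Rightarrow> real^'d^'d) \<Rightarrow> (real \<Rightarrow> real^'m^'d) \<Rightarrow> bool" where
  "completely_controllable q T A B \<longleftrightarrow>
     (\<forall>\<xi>0 \<xi>T. \<exists>u\<in>Lp q T. \<exists>x.
        abs_continuous_on_interval 0 T x \<and>
        satisfies_ode T x (\<lambda>t. A t *v x t + B t *v u t) \<and>
        x 0 = \<xi>0 \<and> x T = \<xi>T)"

end

theory Submission
  imports Defs
begin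

text \<open>
  Suppose the penalty is not exact: for every \<open>n\<close> there is an admissible pair \<open>(x\<^sub>n, u\<^sub>n)\<close> within \<open>2\<^sup>-\<^sup>n\<close> of
  \<open>(x\<^sup>*, u\<^sup>*)\<close> on which the penalty function with parameter at least \<open>n\<close> is smaller. The idea is to move its endpoint back to
  \<open>x\<^sub>T\<close> at a cost linear in \<open>\<xi>\<^sub>n = x\<^sub>T - x\<^sub>n(T)\<close>, contradicting the optimality of \<open>(x\<^sup>*, u\<^sup>*)\<close>.
  Complete controllability yields solutions \<open>(H(t) c, v(t) c)\<close> of the linearised system, linear in \<open>c\<close>, with \<open>H(0) = 0\<close> and
  \<open>H(T) c = c\<close>. One looks for a correction \<open>(y, v c)\<close> with \<open>y = z + H c\<close> and \<open>c = \<xi>\<^sub>n - z(T)\<close>, so that \<open>y(T) = \<xi>\<^sub>n\<close>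
  automatically and \<open>z\<close> solves a fixed point equation. Its nonlinear part has a Lipschitz constant that is small in the mean,
  because \<open>u\<^sub>n \<rightarrow> u\<^sup>*\<close> almost everywhere, dominated by a single function in \<open>L\<^sup>q\<close>, and the growth conditions then dominate the
  derivatives. Banach's theorem gives \<open>|y| + |c| \<le> K |\<xi>\<^sub>n|\<close>, hence the cost changes by at most \<open>L |\<xi>\<^sub>n|\<close>, less than the penalty
  once \<open>n > L\<close>.
\<close>

section \<open>Absolutely continuous functions\<close>

text \<open>Corrections of the control are confined to a finite-dimensional family of directions, so
  the unknowns are a continuous function and a vector. Every perturbation is then bounded by a
  multiple of one function in L^q, and smallness of the remainder reduces to dominated convergence.
  The linearisation is always the one along the optimal pair, because controllability is assumed
  only there; its discrepancy from the derivatives near the n-th pair counts as remainder, which is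
  why a correction is found only for large n. The linear part is not small, but being of Volterra
  type it contracts by 1/2 in an exponentially weighted norm, and the remainder is tuned to add 1/4.
  The radii 2^-n are summable, which gives domination and convergence almost everywhere for the
  whole sequence; mere convergence in L^q would give them only along a subsequence. For q =
  \<infinity> convergence almost everywhere does not imply convergence in norm, so uniform closeness
  of the controls is carried along separately.\<close>

abbreviation "leb T \<equiv> lebesgue_on {0..T :: real}"


section \<open>Almost everywhere differentiability of indefinite integrals\<close>

lemma integral_diff_left_endpoint:
  fixes g :: "real \<Rightarrow> 'a::euclidean_space"
  assumes "g integrable_on {a..b}" "s \<in> {a..b}" "t \<in> {a..b}" "s \<le> t"
  shows "integral {a..t} g - integral {a..s} g = integral {s..t} g"
proof -
  have "g integrable_on {a..t}"
    using assms by (intro integrable_on_subinterval[OF assms(1)]) auto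
  then have "integral {a..s} g + integral {s..t} g = integral {a..t} g"
    using assms by (intro Henstock_Kurzweil_Integration.integral_combine) auto
  then show ?thesis by (simp add: algebra_simps)
qed

text \<open>The tag of a segment is one of its two endpoints. Whichever end it is, the Henstock
  summand of the segment has the same norm as the linearisation error of \<open>F\<close> at the tag
  \<open>t\<close>.\<close>

lemma increment_diff_sup_inf:
  fixes F :: "real \<Rightarrow> 'a::real_normed_vector"
  shows "norm ((max t s - min t s) *\<^sub>R c - (F (max t s) - F (min t s))) = norm (F s - F t - (s - t) *\<^sub>R c)"
proof (cases "s \<le> t")
  case True
  have "(t - s) *\<^sub>R c - (F t - F s) = F s - F t - (s - t) *\<^sub>R c"
    by (simp add: algebra_simps)
  with True show ?thesis by (simp only: max_absorb1 min_absorb2)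
next
  case False
  have "(s - t) *\<^sub>R c - (F s - F t) = - (F s - F t - (s - t) *\<^sub>R c)"
    by (simp add: algebra_simps)
  with False show ?thesis by (simp only: max_absorb2 min_absorb1 linear norm_minus_cancel not_le less_imp_le)
qed

text \<open>The exceptional set is covered in the sense of Vitali by intervals on which the increment violates the estimate;
  Henstock's lemma bounds the total length of finitely many disjoint ones.\<close>

lemma negligible_bad_increments:
  fixes g :: "real \<Rightarrow> 'a::euclidean_space"
  assumes g: "g integrable_on {a..b}" and \<eta>: "\<eta> > 0"
  defines "F \<equiv> \<lambda>t. integral {a..t} g"
  shows "negligible {t\<in>{a..b}. \<forall>d>0. \<exists>s\<in>{a..b}. s \<noteq> t \<and> \<bar>s - t\<bar> < d \<and>
           \<eta> * \<bar>s - t\<bar> \<le> norm (F s - F t - (s - t) *\<^sub>R g t)}" (is "negligible ?E")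
  unfolding negligible_outer_le
proof (intro allI impI)
  fix e :: real assume "e > 0"
  have "e * \<eta> > 0" using \<open>e > 0\<close> \<eta> by simp
  \<comment> \<open>The tolerance is \<open>e * \<eta>\<close> because each selected segment
    contributes at least \<eta> times its length to the Henstock sum; dividing by \<eta> bounds the
    total length by \<open>e\<close>.\<close>
  obtain \<gamma> where "gauge \<gamma>" and H: "\<And>p. \<lbrakk>p tagged_partial_division_of (cbox a b); \<gamma> fine p\<rbrakk> \<Longrightarrow>
             sum (\<lambda>(x,k). norm(measure lborel k *\<^sub>R g x - integral k g)) p < e * \<eta>"
    using Henstock_lemma[of g a b, OF _ \<open>e * \<eta> > 0\<close>] g by auto
  define seg where "seg = (\<lambda>(t::real, s::real). {min t s..max t s})"
  \<comment> \<open>An index pairs a bad point \<open>t\<close>, which becomes the tag, with a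
    witness \<open>s\<close> of the violation so near that the segment between them is fine for the
    gauge.\<close>
  define K where "K = {(t, s). t \<in> {a..b} \<and> s \<in> {a..b} \<and> s \<noteq> t \<and> seg (t, s) \<subseteq> \<gamma> t \<and>
           \<eta> * \<bar>s - t\<bar> \<le> norm (F s - F t - (s - t) *\<^sub>R g t)}"
  \<comment> \<open>Closed intervals are the closed balls of the line, so the covering theorem for
    balls applies, with midpoints as centres.\<close>
  have seg_cball: "seg i = cball ((fst i + snd i) / 2) (\<bar>snd i - fst i\<bar> / 2)" for i
  proof (cases i)
    case (Pair t s)
    show ?thesis
      by (cases "t \<le> s") (simp_all add: Pair seg_def cball_eq_atLeastAtMost min_def max_def add_divide_distrib[symmetric] diff_divide_distrib[symmetric])
  qed
  obtain C where C: "countable C" "C \<subseteq> K"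
    "pairwise (\<lambda>i j. disjnt (seg i) (seg j)) C" "negligible (?E - (\<Union>i\<in>C. seg i))"
  proof (rule Vitali_covering_theorem_cballs[of K "\<lambda>i. \<bar>snd i - fst i\<bar> / 2" ?E "\<lambda>i. (fst i + snd i) / 2",
          folded seg_cball])
    show "0 < \<bar>snd i - fst i\<bar> / 2" if "i \<in> K" for i
      using that by (auto simp: K_def)
    fix t d :: real assume t: "t \<in> ?E" and "0 < d"
    have "open (\<gamma> t)" "t \<in> \<gamma> t" using \<open>gauge \<gamma>\<close> by (auto simp: gauge_def)
    then obtain r where r: "r > 0" "ball t r \<subseteq> \<gamma> t" by (meson openE)
    obtain s where s: "s \<in> {a..b}" "s \<noteq> t" "\<bar>s - t\<bar> < min r d"
        "\<eta> * \<bar>s - t\<bar> \<le> norm (F s - F t - (s - t) *\<^sub>R g t)"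
      using t r(1) \<open>0 < d\<close> by (auto dest!: spec[of _ "min r d"])
    have "seg (t, s) \<subseteq> ball t r"
    proof
      fix x assume "x \<in> seg (t, s)"
      then have "\<bar>x - t\<bar> \<le> \<bar>s - t\<bar>" by (cases "t \<le> s") (simp_all add: seg_def)
      with s(3) show "x \<in> ball t r" by (simp add: dist_real_def abs_minus_commute)
    qed
    then have "(t, s) \<in> K" using r s t by (auto simp: K_def)
    moreover have "t \<in> seg (t, s)" by (auto simp: seg_def)
    ultimately show "\<exists>i. i \<in> K \<and> t \<in> seg i \<and> \<bar>snd i - fst i\<bar> / 2 < d"
      using s(3) by (intro exI[of _ "(t, s)"]) auto
  qed blast
  have meas: "seg i \<in> lmeasurable" for i
    by (simp add: seg_cball)
  have bound: "measure lebesgue (\<Union>i\<in>C'. seg i) \<le> e" if C': "C' \<subseteq> C" "finite C'" for C'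
  proof -
    \<comment> \<open>Distinct selected segments are disjoint and nonempty, so passing from indices
      to tagged intervals identifies none of them and the Henstock sum can be reindexed.\<close>
    have inj: "inj_on (\<lambda>i. (fst i, seg i)) C'"
    proof (rule inj_onI, rule ccontr)
      fix i j assume "i \<in> C'" "j \<in> C'" "(fst i, seg i) = (fst j, seg j)" "i \<noteq> j"
      then have "disjnt (seg i) (seg j)" "seg i = seg j" using pairwiseD[OF C(3), of i j] C'(1) by auto
      moreover have "fst i \<in> seg i" by (cases i) (auto simp: seg_def)
      ultimately show False by (auto simp: disjnt_def)
    qed
    have "(\<lambda>i. (fst i, seg i)) ` C' tagged_partial_division_of (cbox a b)"
      unfolding tagged_partial_division_of_def
    proof (intro conjI allI impI)
      show "finite ((\<lambda>i. (fst i, seg i)) ` C')" using C'(2) by simp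
    next
      fix x k assume "(x, k) \<in> (\<lambda>i. (fst i, seg i)) ` C'"
      then obtain i where i: "i \<in> C'" "x = fst i" "k = seg i" by auto
      then have "i \<in> K" using C' C by auto
      then show "x \<in> k" "k \<subseteq> cbox a b" "\<exists>a b. k = cbox a b"
        using i(2,3) by (auto simp: K_def seg_def)
    next
      fix x1 k1 x2 k2
      assume "(x1, k1) \<in> (\<lambda>i. (fst i, seg i)) ` C' \<and> (x2, k2) \<in> (\<lambda>i. (fst i, seg i)) ` C' \<and> (x1, k1) \<noteq> (x2, k2)"
      then obtain i j where ij: "i \<in> C'" "j \<in> C'" "k1 = seg i" "k2 = seg j" "i \<noteq> j" by auto
      then have "disjnt k1 k2" using pairwiseD[OF C(3), of i j] C'(1) by auto
      then show "interior k1 \<inter> interior k2 = {}"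
        using interior_subset[of k1] interior_subset[of k2] by (auto simp: disjnt_def)
    qed
    moreover have "\<gamma> fine (\<lambda>i. (fst i, seg i)) ` C'"
    proof (rule fineI)
      fix x k assume "(x, k) \<in> (\<lambda>i. (fst i, seg i)) ` C'"
      then obtain i where i: "i \<in> C'" "x = fst i" "k = seg i" by auto
      then have "i \<in> K" using C' C by auto
      then show "k \<subseteq> \<gamma> x" using i(2,3) by (auto simp: K_def)
    qed
    ultimately have "(\<Sum>(x,k)\<in>(\<lambda>i. (fst i, seg i)) ` C'. norm (measure lborel k *\<^sub>R g x - integral k g)) < e * \<eta>"
      by (rule H)
    then have *: "(\<Sum>i\<in>C'. norm (measure lborel (seg i) *\<^sub>R g (fst i) - integral (seg i) g)) < e * \<eta>"
      by (simp add: sum.reindex[OF inj] o_def)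
    have "\<eta> * measure lebesgue (seg i) \<le> norm (measure lborel (seg i) *\<^sub>R g (fst i) - integral (seg i) g)" if i: "i \<in> C'" for i
    proof -
      obtain t s where ts: "i = (t, s)" by (cases i)
      have iK: "(t, s) \<in> K" using C(2) C'(1) i ts by auto
      then have "integral (seg i) g = F (max t s) - F (min t s)"
        unfolding F_def ts seg_def by (subst integral_diff_left_endpoint[OF g]) (auto simp: K_def)
      moreover have "measure lborel (seg i) = max t s - min t s"
        by (simp add: ts seg_def)
      ultimately have "norm (measure lborel (seg i) *\<^sub>R g (fst i) - integral (seg i) g) = norm (F s - F t - (s - t) *\<^sub>R g t)"
        by (simp only: ts fst_conv increment_diff_sup_inf)
      moreover have "measure lebesgue (seg i) = \<bar>s - t\<bar>"
        by (auto simp: ts seg_def min_def max_def)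
      ultimately show ?thesis using iK by (simp add: K_def)
    qed
    then have "\<eta> * (\<Sum>i\<in>C'. measure lebesgue (seg i)) \<le> (\<Sum>i\<in>C'. norm (measure lborel (seg i) *\<^sub>R g (fst i) - integral (seg i) g))"
      by (simp add: sum_distrib_left sum_mono)
    with * have "\<eta> * (\<Sum>i\<in>C'. measure lebesgue (seg i)) < \<eta> * e" by (simp add: mult.commute)
    then have "(\<Sum>i\<in>C'. measure lebesgue (seg i)) < e" using \<eta> by (simp add: mult_less_cancel_left_pos)
    moreover have "measure lebesgue (\<Union>i\<in>C'. seg i) \<le> (\<Sum>i\<in>C'. measure lebesgue (seg i))"
      by (rule measure_UNION_le[OF C'(2)]) (use meas in auto)
    ultimately show ?thesis by simp
  qed
  \<comment> \<open>The bound \<open>e\<close> is the same for all finite subfamilies, hence holds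
    for the countable union; what the covering misses is negligible.\<close>
  have U: "(\<Union>i\<in>C. seg i) \<in> lmeasurable" "measure lebesgue (\<Union>i\<in>C. seg i) \<le> e"
    using fmeasurable_UN_bound[OF C(1) meas bound] measure_UN_bound[OF C(1) meas bound] by auto
  let ?N = "?E - (\<Union>i\<in>C. seg i)"
  show "\<exists>T. ?E \<subseteq> T \<and> T \<in> lmeasurable \<and> measure lebesgue T \<le> e"
  proof (intro exI conjI)
    show "?E \<subseteq> (\<Union>i\<in>C. seg i) \<union> ?N" by auto
    show "(\<Union>i\<in>C. seg i) \<union> ?N \<in> lmeasurable"
      by (rule fmeasurable.Un[OF U(1) negligible_imp_measurable[OF C(4)]])
    have "measure lebesgue ((\<Union>i\<in>C. seg i) \<union> ?N) \<le> measure lebesgue (\<Union>i\<in>C. seg i) + measure lebesgue ?N"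
      by (rule measure_Un_le[OF fmeasurableD[OF U(1)] fmeasurableD[OF negligible_imp_measurable[OF C(4)]]])
    then show "measure lebesgue ((\<Union>i\<in>C. seg i) \<union> ?N) \<le> e"
      using U(2) negligible_imp_measure0[OF C(4)] by linarith
  qed
qed

text \<open>If \<open>g t\<close> is not the derivative at \<open>t\<close>, then for some tolerance
  1/(k+1) the linearisation error violates it arbitrarily near \<open>t\<close>. Countably many
  tolerances suffice, so the exceptional set is a countable union of null sets.\<close>

lemma AE_has_vector_derivative_indefinite_integral:
  fixes g :: "real \<Rightarrow> 'a::euclidean_space"
  assumes g: "g integrable_on {a..b}"
  shows "AE t in lebesgue_on {a..b}. ((\<lambda>t. integral {a..t} g) has_vector_derivative g t) (at t within {a..b})"
proof -
  define F where "F = (\<lambda>t. integral {a..t} g)"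
  define E where "E = (\<lambda>k::nat. {t\<in>{a..b}. \<forall>d>0. \<exists>s\<in>{a..b}. s \<noteq> t \<and> \<bar>s - t\<bar> < d \<and>
           inverse (real (Suc k)) * \<bar>s - t\<bar> \<le> norm (F s - F t - (s - t) *\<^sub>R g t)})"
  have "negligible (E k)" for k
    unfolding E_def F_def by (rule negligible_bad_increments[OF g]) simp
  then have "negligible (\<Union>k. E k)" by blast
  then have "(\<Union>k. E k) \<in> null_sets lebesgue" by (simp add: negligible_iff_null_sets)
  then have "AE t in lebesgue. t \<notin> (\<Union>k. E k)" by (rule AE_not_in)
  then have "AE t in lebesgue_on {a..b}. t \<notin> (\<Union>k. E k)"
    by (subst AE_restrict_space_iff) auto
  then show ?thesis
  proof (rule AE_mp, intro AE_I2 impI)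
    fix t assume "t \<in> space (lebesgue_on {a..b})" and tE: "t \<notin> (\<Union>k. E k)"
    then have t: "t \<in> {a..b}" by simp
    have "(F has_derivative (\<lambda>h. h *\<^sub>R g t)) (at t within {a..b})"
      unfolding has_derivative_within_alt
    proof (intro conjI allI impI)
      show "bounded_linear (\<lambda>h. h *\<^sub>R g t)" by (rule bounded_linear_scaleR_left)
      fix e :: real assume "e > 0"
      then obtain k where k: "inverse (real (Suc k)) < e" using reals_Archimedean by blast
      have "t \<notin> E k" using tE by simp
      then have "\<exists>d>0. \<forall>s\<in>{a..b}. s \<noteq> t \<longrightarrow> \<bar>s - t\<bar> < d \<longrightarrow>
           norm (F s - F t - (s - t) *\<^sub>R g t) < inverse (real (Suc k)) * \<bar>s - t\<bar>"
        using t by (simp add: E_def not_le del: of_nat_Suc) meson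
      then obtain d where "d > 0" and d: "\<And>s. s \<in> {a..b} \<Longrightarrow> s \<noteq> t \<Longrightarrow> \<bar>s - t\<bar> < d \<Longrightarrow>
           norm (F s - F t - (s - t) *\<^sub>R g t) < inverse (real (Suc k)) * \<bar>s - t\<bar>"
        by blast
      have "norm (F s - F t - (s - t) *\<^sub>R g t) \<le> e * norm (s - t)" if "s \<in> {a..b}" "norm (s - t) < d" for s
      proof (cases "s = t")
        case False
        then have "norm (F s - F t - (s - t) *\<^sub>R g t) < inverse (real (Suc k)) * \<bar>s - t\<bar>"
          using d that by simp
        also have "\<dots> \<le> e * \<bar>s - t\<bar>" using k by (intro mult_right_mono) auto
        finally show ?thesis by simp
      qed simp
      with \<open>d > 0\<close> show "\<exists>d>0. \<forall>y\<in>{a..b}. norm (y - t) < d \<longrightarrow> norm (F y - F t - (y - t) *\<^sub>R g t) \<le> e * norm (y - t)"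
        by blast
    qed
    then show "((\<lambda>t. integral {a..t} g) has_vector_derivative g t) (at t within {a..b})"
      by (simp add: has_vector_derivative_def F_def)
  qed
qed


section \<open>The fundamental theorem of calculus for absolutely continuous functions\<close>

definition ac_modulus :: "real \<Rightarrow> real \<Rightarrow> (real \<Rightarrow> 'a::real_normed_vector) \<Rightarrow> real \<Rightarrow> real \<Rightarrow> bool" where
  "ac_modulus a b x \<epsilon> \<delta> \<longleftrightarrow> (\<forall>I. finite I \<longrightarrow> (\<forall>(s, t)\<in>I. a \<le> s \<and> s \<le> t \<and> t \<le> b) \<longrightarrow>
     disjoint_family_on (\<lambda>(s, t). {s<..<t}) I \<longrightarrow> (\<Sum>(s, t)\<in>I. t - s) < \<delta> \<longrightarrow>
     (\<Sum>(s, t)\<in>I. norm (x t - x s)) < \<epsilon>)"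

lemma abs_continuous_on_interval_iff_modulus:
  "abs_continuous_on_interval a b x \<longleftrightarrow> (\<forall>\<epsilon>>0. \<exists>\<delta>>0. ac_modulus a b x \<epsilon> \<delta>)"
  unfolding abs_continuous_on_interval_def ac_modulus_def ..

lemma ac_modulusI:
  assumes "\<And>I. \<lbrakk>finite I; \<forall>(s, t)\<in>I. a \<le> s \<and> s \<le> t \<and> t \<le> b; disjoint_family_on (\<lambda>(s, t). {s<..<t}) I;
      (\<Sum>(s, t)\<in>I. t - s) < \<delta>\<rbrakk> \<Longrightarrow> (\<Sum>(s, t)\<in>I. norm (x t - x s)) < \<epsilon>"
  shows "ac_modulus a b x \<epsilon> \<delta>"
  unfolding ac_modulus_def using assms by blast

lemma ac_modulusD:
  assumes "ac_modulus a b x \<epsilon> \<delta>" "finite I" "\<forall>(s, t)\<in>I. a \<le> s \<and> s \<le> t \<and> t \<le> b"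
    "disjoint_family_on (\<lambda>(s, t). {s<..<t}) I" "(\<Sum>(s, t)\<in>I. t - s) < \<delta>"
  shows "(\<Sum>(s, t)\<in>I. norm (x t - x s)) < \<epsilon>"
  using assms unfolding ac_modulus_def by blast

text \<open>Truncation: the norm of \<open>g\<close> is at most n plus its excess over n. For large
  n the excess has small integral over the whole interval, and the constant n contributes at most n
  times the total length of the family.\<close>

lemma abs_continuous_on_interval_indefinite_integral:
  fixes g :: "real \<Rightarrow> 'a::euclidean_space"
  assumes g: "integrable (lebesgue_on {a..b}) g"
  shows "abs_continuous_on_interval a b (\<lambda>t. integral {a..t} g)"
  unfolding abs_continuous_on_interval_iff_modulus
proof (intro allI impI)
  fix \<epsilon> :: real assume "\<epsilon> > 0"
  let ?M = "lebesgue_on {a..b}"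
  let ?m = "\<lambda>n t. max (norm (g t) - real n) 0"
  have [measurable]: "g \<in> borel_measurable ?M" using g by auto
  have intm: "integrable ?M (?m n)" for n
    by (rule Bochner_Integration.integrable_bound[OF integrable_norm[OF g]]) auto
  have "(\<lambda>n. LINT t|?M. ?m n t) \<longlonglongrightarrow> (LINT t|?M. 0)"
  proof (rule integral_dominated_convergence[OF _ _ integrable_norm[OF g]])
    show "AE t in ?M. (\<lambda>n. ?m n t) \<longlonglongrightarrow> 0"
    proof (rule AE_I2)
      fix t
      obtain N where "norm (g t) \<le> real N" using real_arch_simple by blast
      then have "eventually (\<lambda>n. ?m n t = 0) sequentially"
        by (intro eventually_sequentiallyI[of N]) (auto simp: max_def)
      then show "(\<lambda>n. ?m n t) \<longlonglongrightarrow> 0" by (rule tendsto_eventually)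
    qed
  qed auto
  then have "(\<lambda>n. LINT t|?M. ?m n t) \<longlonglongrightarrow> 0" by simp
  then have "eventually (\<lambda>n. (LINT t|?M. ?m n t) < \<epsilon> / 2) sequentially"
    using \<open>\<epsilon> > 0\<close> by (intro order_tendstoD(2)) auto
  then obtain n where n: "(LINT t|?M. ?m n t) < \<epsilon> / 2"
    by (auto simp: eventually_sequentially)
  \<comment> \<open>This makes n times \<delta> at most \<epsilon>/2; the summand 1 keeps the
    denominator positive when n = 0.\<close>
  define \<delta> where "\<delta> = \<epsilon> / (2 * (real n + 1))"
  have "\<delta> > 0" using \<open>\<epsilon> > 0\<close> by (simp add: \<delta>_def)
  show "\<exists>\<delta>>0. ac_modulus a b (\<lambda>t. integral {a..t} g) \<epsilon> \<delta>"
  proof (intro exI[of _ \<delta>] conjI ac_modulusI)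
    show "\<delta> > 0" by fact
    fix I :: "(real \<times> real) set"
    assume I: "finite I" "\<forall>(s, t)\<in>I. a \<le> s \<and> s \<le> t \<and> t \<le> b"
      "disjoint_family_on (\<lambda>(s, t). {s<..<t}) I" "(\<Sum>(s, t)\<in>I. t - s) < \<delta>"
    let ?J = "\<lambda>i. {fst i<..<snd i}"
    have sub: "?J i \<subseteq> {a..b}" if "i \<in> I" for i using I(2) that by fastforce
    have meas: "?J i \<in> sets ?M" if "i \<in> I" for i
      using sub[OF that] by (auto simp: sets_restrict_space_iff)
    have int: "integrable ?M (\<lambda>t. indicator (?J i) t * ?m n t)" if "i \<in> I" for i
      using integrable_mult_indicator[OF meas[OF that] intm[of n]] by simp
    have incr: "norm (integral {a..snd i} g - integral {a..fst i} g)
        \<le> (LINT t|?M. indicator (?J i) t * ?m n t) + real n * (snd i - fst i)" if i: "i \<in> I" for i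
    proof -
      let ?S = "{fst i..snd i}"
      have st: "a \<le> fst i" "fst i \<le> snd i" "snd i \<le> b" using I(2) i by auto
      have gS: "integrable (lebesgue_on ?S) g"
        using g by (rule integrable_subinterval) (use st in auto)
      have mS: "integrable (lebesgue_on ?S) (?m n)"
        using intm by (rule integrable_subinterval) (use st in auto)
      have gab: "g integrable_on {a..b}" using integrable_on_lebesgue_on[OF g] by simp
      have "integral {a..snd i} g - integral {a..fst i} g = integral ?S g"
        using st by (intro integral_diff_left_endpoint[OF gab]) auto
      also have "\<dots> = (LINT t|lebesgue_on ?S. g t)"
        using gS by (simp add: lebesgue_integral_eq_integral)
      finally have "norm (integral {a..snd i} g - integral {a..fst i} g) \<le> (LINT t|lebesgue_on ?S. norm (g t))"
        by (simp add: integral_norm_bound)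
      also have "\<dots> \<le> (LINT t|lebesgue_on ?S. ?m n t + real n)"
        using gS mS by (intro integral_mono) auto
      also have "\<dots> = (LINT t|lebesgue_on ?S. ?m n t) + real n * (snd i - fst i)"
        using mS st by (simp add: measure_restrict_space)
      also have "(LINT t|lebesgue_on ?S. ?m n t) = integral ?S (?m n)"
        using mS by (simp add: lebesgue_integral_eq_integral)
      \<comment> \<open>Open intervals are used from here on because members of the family may share
        endpoints; only their interiors are disjoint.\<close>
      also have "\<dots> = integral (?J i) (?m n)"
        by (rule integral_open_interval_real)
      also have "\<dots> = integral {a..b} (\<lambda>t. indicator (?J i) t * ?m n t)"
      proof -
        have "(\<lambda>t. indicator (?J i) t * ?m n t) = (\<lambda>t. if t \<in> ?J i then ?m n t else 0)" by (auto simp: indicator_def)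
        then show ?thesis using sub[OF i]
          by (simp only: Henstock_Kurzweil_Integration.integral_restrict_Int Int_absorb2)
      qed
      also have "\<dots> = (LINT t|?M. indicator (?J i) t * ?m n t)"
        using int[OF i] by (simp add: lebesgue_integral_eq_integral)
      finally show ?thesis .
    qed
    have "(\<Sum>(s, t)\<in>I. norm (integral {a..t} g - integral {a..s} g)) =
        (\<Sum>i\<in>I. norm (integral {a..snd i} g - integral {a..fst i} g))"
      by (simp add: case_prod_unfold)
    also have "\<dots> \<le> (\<Sum>i\<in>I. (LINT t|?M. indicator (?J i) t * ?m n t) + real n * (snd i - fst i))"
      by (rule sum_mono[OF incr])
    also have "\<dots> = (LINT t|?M. (\<Sum>i\<in>I. indicator (?J i) t * ?m n t)) + real n * (\<Sum>(s, t)\<in>I. t - s)"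
      using int by (simp add: Bochner_Integration.integral_sum sum.distrib sum_distrib_left case_prod_unfold)
    \<comment> \<open>The indicators of disjoint intervals add up to at most 1, so the excess is
      counted only once, however many intervals the family has.\<close>
    also have "(LINT t|?M. (\<Sum>i\<in>I. indicator (?J i) t * ?m n t)) \<le> (LINT t|?M. ?m n t)"
    proof (rule integral_mono)
      show "integrable ?M (\<lambda>t. \<Sum>i\<in>I. indicator (?J i) t * ?m n t)"
        using int by auto
      fix t
      have "(\<Sum>i\<in>I. indicator (?J i) t) = (indicator (\<Union>i\<in>I. ?J i) t :: real)"
        using I(3) by (intro indicator_UN_disjoint[symmetric] I(1)) (simp add: disjoint_family_on_def case_prod_unfold)
      also have "\<dots> \<le> 1" by (auto simp: indicator_def)
      finally have "(\<Sum>i\<in>I. indicator (?J i) t) * ?m n t \<le> 1 * ?m n t"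
        by (intro mult_right_mono) auto
      then show "(\<Sum>i\<in>I. indicator (?J i) t * ?m n t) \<le> ?m n t"
        by (simp add: sum_distrib_right)
    qed (rule intm)
    also have "real n * (\<Sum>(s, t)\<in>I. t - s) \<le> real n * \<delta>"
      using I(4) by (intro mult_left_mono) auto
    also have "real n * \<delta> \<le> \<epsilon> / 2"
      using \<open>\<epsilon> > 0\<close> by (simp add: \<delta>_def field_simps)
    finally show "(\<Sum>(s, t)\<in>I. norm (integral {a..t} g - integral {a..s} g)) < \<epsilon>"
      using n by linarith
  qed
qed

text \<open>At tags where the derivative exists, a fine interval has an increment close to
  derivative times length. The other tags form a null set; there the gauge confines the intervals to
  an open set of measure below \<delta>, and absolute continuity makes their increments small in
  total.\<close>

lemma has_integral_of_abs_continuous: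
  fixes x g :: "real \<Rightarrow> 'a::euclidean_space"
  assumes x: "abs_continuous_on_interval a b x" and "a \<le> b"
    and d: "AE t in lebesgue_on {a..b}. (x has_vector_derivative g t) (at t within {a..b})"
  shows "(g has_integral x b - x a) {a..b}"
proof -
  define N where "N = {t\<in>{a..b}. \<not> (x has_vector_derivative g t) (at t within {a..b})}"
  have "AE t in lebesgue. t \<in> {a..b} \<longrightarrow> (x has_vector_derivative g t) (at t within {a..b})"
    using d by (simp add: AE_restrict_space_iff)
  then have "AE t in lebesgue. t \<notin> N"
  proof eventually_elim
    case (elim t)
    then show ?case unfolding N_def by blast
  qed
  then obtain Z where Z: "\<And>t. t \<in> space lebesgue - Z \<Longrightarrow> t \<notin> N" "Z \<in> null_sets lebesgue"
    by (rule AE_E3) blast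
  then have "N \<subseteq> Z" by auto
  then have N: "negligible N"
    by (rule negligible_subset[OF iffD2[OF negligible_iff_null_sets Z(2)]])
  \<comment> \<open>Setting the integrand to 0 on the null set leaves the bare increment of
    \<open>x\<close> as the error at such tags.\<close>
  define g' where "g' t = (if t \<in> N then 0 else g t)" for t
  have "(g' has_integral x b - x a) (cbox a b)"
    unfolding has_integral
  proof (intro allI impI)
    fix e :: real assume "e > 0"
    obtain \<delta> where "\<delta> > 0" and \<delta>: "ac_modulus a b x (e / 2) \<delta>"
      using x[unfolded abs_continuous_on_interval_iff_modulus, THEN spec, of "e / 2"] \<open>e > 0\<close> by auto
    \<comment> \<open>The errors at regular tags add up to \<epsilon> times the length of the
      interval, which has to stay below e/2; the summand 1 covers the case a = b.\<close>
    define \<epsilon> where "\<epsilon> = e / (2 * (b - a + 1))"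
    have "\<epsilon> > 0" using \<open>e > 0\<close> \<open>a \<le> b\<close> by (simp add: \<epsilon>_def)
    have "\<epsilon> * (b - a) \<le> e / 2"
      using \<open>e > 0\<close> \<open>a \<le> b\<close> by (simp add: \<epsilon>_def field_simps)
    obtain Q where Q: "open Q" "N \<subseteq> Q" "Q - N \<in> lmeasurable" "emeasure lebesgue (Q - N) < ennreal \<delta>"
      by (rule sets_lebesgue_outer_open[OF negligible_imp_sets[OF N] \<open>\<delta> > 0\<close>])
    have NQ: "N \<in> lmeasurable" "measure lebesgue N = 0"
      using N by (auto simp: negligible_imp_measurable negligible_imp_measure0)
    have QN: "Q = (Q - N) \<union> N" using Q(2) by auto
    have Qm: "Q \<in> lmeasurable" using fmeasurable.Un[OF Q(3) NQ(1)] QN by simp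
    have "measure lebesgue (Q - N) < \<delta>"
      using Q(3,4) \<open>\<delta> > 0\<close> by (simp add: emeasure_eq_measure2 ennreal_less_iff)
    moreover have "measure lebesgue Q \<le> measure lebesgue (Q - N) + measure lebesgue N"
      using measure_Un_le[OF fmeasurableD[OF Q(3)] fmeasurableD[OF NQ(1)]] QN by simp
    ultimately have mQ: "measure lebesgue Q < \<delta>" using NQ(2) by simp
    \<comment> \<open>One radius serves both kinds of tags: it keeps the ball inside
      \<open>Q\<close> for exceptional ones and within the range of the derivative estimate for the
      others.\<close>
    have "\<exists>r>0. (t \<in> N \<longrightarrow> ball t r \<subseteq> Q) \<and> (t \<in> {a..b} - N \<longrightarrow>
        (\<forall>s\<in>{a..b}. \<bar>s - t\<bar> < r \<longrightarrow> norm (x s - x t - (s - t) *\<^sub>R g t) \<le> \<epsilon> * \<bar>s - t\<bar>))" for t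
    proof -
      consider "t \<in> N" | "t \<in> {a..b} - N" | "t \<notin> {a..b}" "t \<notin> N" by blast
      then show ?thesis
      proof cases
        case 1
        then obtain r where "r > 0" "ball t r \<subseteq> Q" using Q(1,2) by (meson openE subsetD)
        with 1 show ?thesis by blast
      next
        case 2
        then have "(x has_derivative (\<lambda>h. h *\<^sub>R g t)) (at t within {a..b})"
          by (auto simp: N_def has_vector_derivative_def)
        then obtain r where "r > 0" "\<forall>s\<in>{a..b}. norm (s - t) < r \<longrightarrow> norm (x s - x t - (s - t) *\<^sub>R g t) \<le> \<epsilon> * norm (s - t)"
          unfolding has_derivative_within_alt using \<open>\<epsilon> > 0\<close> by blast
        with 2 show ?thesis by (intro exI[of _ r]) auto
      next
        case 3
        then show ?thesis by (intro exI[of _ 1]) auto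
      qed
    qed
    then obtain r where r: "\<And>t. r t > 0" "\<And>t. t \<in> N \<Longrightarrow> ball t (r t) \<subseteq> Q"
      "\<And>t s. t \<in> {a..b} - N \<Longrightarrow> s \<in> {a..b} \<Longrightarrow> \<bar>s - t\<bar> < r t \<Longrightarrow> norm (x s - x t - (s - t) *\<^sub>R g t) \<le> \<epsilon> * \<bar>s - t\<bar>"
      by metis
    show "\<exists>\<gamma>. gauge \<gamma> \<and> (\<forall>\<D>. \<D> tagged_division_of cbox a b \<and> \<gamma> fine \<D> \<longrightarrow>
        norm ((\<Sum>(t, K)\<in>\<D>. measure lborel K *\<^sub>R g' t) - (x b - x a)) < e)"
    proof (intro exI[of _ "\<lambda>t. ball t (r t)"] conjI allI impI)
      show "gauge (\<lambda>t. ball t (r t))" using r(1) by (auto simp: gauge_def)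
      fix \<D> assume D: "\<D> tagged_division_of cbox a b \<and> (\<lambda>t. ball t (r t)) fine \<D>"
      then have td: "\<D> tagged_division_of {a..b}" by simp
      note fin = tagged_division_of_finite[OF td]
      have KI: "\<exists>u v. K = {u..v} \<and> u \<le> t \<and> t \<le> v \<and> a \<le> u \<and> v \<le> b \<and> Sup K = v \<and> Inf K = u \<and> measure lborel K = v - u
         \<and> {u..v} \<subseteq> ball t (r t)"
        if tK: "(t, K) \<in> \<D>" for t K
      proof -
        obtain u v where uv: "K = {u..v}" using tagged_division_ofD(4)[OF td tK] by auto
        have tin: "t \<in> K" using tagged_division_ofD(2)[OF td tK] .
        have "K \<subseteq> {a..b}" using tagged_division_ofD(3)[OF td tK] .
        then have "a \<le> u" "v \<le> b" using uv tin by auto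
        moreover have "K \<subseteq> ball t (r t)" using D tK by (auto dest: fineD)
        ultimately show ?thesis using uv tin by (intro exI[of _ u] exI[of _ v]) (auto simp: )
      qed
      have "(\<Sum>(t, K)\<in>\<D>. x (Sup K) - x (Inf K)) = x b - x a"
        by (rule additive_tagged_division_1[OF \<open>a \<le> b\<close> td])
      then have "(\<Sum>(t, K)\<in>\<D>. measure lborel K *\<^sub>R g' t) - (x b - x a) =
          (\<Sum>(t, K)\<in>\<D>. measure lborel K *\<^sub>R g' t - (x (Sup K) - x (Inf K)))"
        by (simp add: sum_subtractf case_prod_unfold)
      also have "norm \<dots> \<le> (\<Sum>(t, K)\<in>\<D>. norm (measure lborel K *\<^sub>R g' t - (x (Sup K) - x (Inf K))))"
        by (simp add: case_prod_unfold norm_sum)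
      also have "\<dots> \<le> (\<Sum>(t, K)\<in>\<D>. \<epsilon> * measure lborel K + (if t \<in> N then norm (x (Sup K) - x (Inf K)) else 0))"
      proof (rule sum_mono, clarify)
        fix t K assume tK: "(t, K) \<in> \<D>"
        then obtain u v where uv: "K = {u..v}" "u \<le> t" "t \<le> v" "a \<le> u" "v \<le> b" "Sup K = v" "Inf K = u"
          "measure lborel K = v - u" "{u..v} \<subseteq> ball t (r t)" using KI by metis
        show "norm (measure lborel K *\<^sub>R g' t - (x (Sup K) - x (Inf K)))
          \<le> \<epsilon> * measure lborel K + (if t \<in> N then norm (x (Sup K) - x (Inf K)) else 0)"
        proof (cases "t \<in> N")
          case True
          have "norm (x u - x v) = norm (x v - x u)" by (rule norm_minus_commute)
          then show ?thesis using True \<open>\<epsilon> > 0\<close> uv by (simp add: g'_def uv(6-8))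
        next
          case False
          \<comment> \<open>The tag lies between \<open>u\<close> and \<open>v\<close>, so the two
            errors measured from the tag add up to \<epsilon> times the full length v - u.\<close>
          have "u \<in> ball t (r t)" "v \<in> ball t (r t)" using subsetD[OF uv(9), of u] subsetD[OF uv(9), of v] uv(2,3) by simp_all
          then have "norm (x u - x t - (u - t) *\<^sub>R g t) \<le> \<epsilon> * \<bar>u - t\<bar>" "norm (x v - x t - (v - t) *\<^sub>R g t) \<le> \<epsilon> * \<bar>v - t\<bar>"
            using False uv(2-5) by (intro r(3); simp add: dist_real_def)+
          moreover have "(v - u) *\<^sub>R g t - (x v - x u) = (x u - x t - (u - t) *\<^sub>R g t) - (x v - x t - (v - t) *\<^sub>R g t)"
            by (simp add: algebra_simps)
          ultimately have "norm ((v - u) *\<^sub>R g t - (x v - x u)) \<le> \<epsilon> * \<bar>u - t\<bar> + \<epsilon> * \<bar>v - t\<bar>"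
            by (simp only:) (rule order_trans[OF norm_triangle_ineq4 add_mono])
          also have "\<dots> = \<epsilon> * (v - u)" using uv(2,3) by (simp add: algebra_simps)
          finally show ?thesis using False by (simp add: g'_def uv(6-8))
        qed
      qed
      also have "\<dots> = \<epsilon> * (\<Sum>(t, K)\<in>\<D>. measure lborel K) + (\<Sum>(t, K)\<in>\<D>. if t \<in> N then norm (x (Sup K) - x (Inf K)) else 0)"
        by (simp add: sum.distrib case_prod_unfold sum_distrib_left)
      also have "(\<Sum>(t, K)\<in>\<D>. measure lborel K) = b - a"
        using additive_content_tagged_division[of \<D> a b] td \<open>a \<le> b\<close> by simp
      also have "(\<Sum>(t, K)\<in>\<D>. if t \<in> N then norm (x (Sup K) - x (Inf K)) else 0) < e / 2"
      proof -
        \<comment> \<open>Degenerate intervals have zero increment and are dropped. The others have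
          nonempty interior, so disjointness of the interiors makes the map to pairs of endpoints
          injective.\<close>
        define P where "P = {p\<in>\<D>. fst p \<in> N \<and> Inf (snd p) < Sup (snd p)}"
        let ?\<iota> = "\<lambda>p::real \<times> real set. (Inf (snd p), Sup (snd p))"
        have finP: "finite P" using fin by (simp add: P_def)
        have ivl: "snd p = {Inf (snd p)..Sup (snd p)} \<and> a \<le> Inf (snd p) \<and> Inf (snd p) \<le> Sup (snd p) \<and> Sup (snd p) \<le> b
            \<and> snd p \<subseteq> Q" if p: "p \<in> P" for p
        proof -
          obtain t K where tK: "p = (t, K)" by (cases p)
          then have "(t, K) \<in> \<D>" "t \<in> N" using p by (auto simp: P_def)
          then show ?thesis using KI[of t K] r(2)[of t] tK by fastforce
        qed
        have disj: "{Inf (snd p)<..<Sup (snd p)} \<inter> {Inf (snd p')<..<Sup (snd p')} = {}" if pp: "p \<in> P" "p' \<in> P" "p \<noteq> p'" for p p'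
        proof -
          have "interior (snd p) \<inter> interior (snd p') = {}"
            using tagged_division_ofD(5)[OF td, of "fst p" "snd p" "fst p'" "snd p'"] pp by (auto simp: P_def prod_eq_iff)
          moreover have "interior (snd p) = {Inf (snd p)<..<Sup (snd p)}" "interior (snd p') = {Inf (snd p')<..<Sup (snd p')}"
            using ivl[OF pp(1)] ivl[OF pp(2)] interior_atLeastAtMost_real by metis+
          ultimately show ?thesis by simp
        qed
        have inj: "inj_on ?\<iota> P"
        proof (rule inj_onI, rule ccontr)
          fix p p' assume pp: "p \<in> P" "p' \<in> P" "?\<iota> p = ?\<iota> p'" "p \<noteq> p'"
          then have "{Inf (snd p)<..<Sup (snd p)} = {}" using disj[OF pp(1,2,4)] by simp
          moreover have "Inf (snd p) < Sup (snd p)" using pp(1) by (simp add: P_def)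
          ultimately show False by simp
        qed
        have "(\<Sum>p\<in>P. Sup (snd p) - Inf (snd p)) = (\<Sum>p\<in>P. measure lebesgue {Inf (snd p)<..<Sup (snd p)})"
        proof (rule sum.cong[OF refl])
          fix p assume "p \<in> P"
          then have "Inf (snd p) \<le> Sup (snd p)" using ivl by blast
          then show "Sup (snd p) - Inf (snd p) = measure lebesgue {Inf (snd p)<..<Sup (snd p)}" by simp
        qed
        also have "\<dots> = measure lebesgue (\<Union>p\<in>P. {Inf (snd p)<..<Sup (snd p)})"
        proof (rule measure_finite_Union[symmetric, OF finP])
          show "disjoint_family_on (\<lambda>p. {Inf (snd p)<..<Sup (snd p)}) P"
            unfolding disjoint_family_on_def using disj by blast
          show "emeasure lebesgue {Inf (snd p)<..<Sup (snd p)} \<noteq> \<infinity>" if "p \<in> P" for p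
            using emeasure_bounded_finite[of "{Inf (snd p)<..<Sup (snd p)}"] by simp
        qed auto
        also have "\<dots> \<le> measure lebesgue Q"
        proof (rule measure_mono_fmeasurable[OF _ _ Qm])
          show "(\<Union>p\<in>P. {Inf (snd p)<..<Sup (snd p)}) \<subseteq> Q"
          proof clarify
            fix s p assume p: "p \<in> P" "s \<in> {Inf (snd p)<..<Sup (snd p)}"
            then have "s \<in> {Inf (snd p)..Sup (snd p)}" by simp
            then show "s \<in> Q" using ivl[OF p(1)] by blast
          qed
          show "(\<Union>p\<in>P. {Inf (snd p)<..<Sup (snd p)}) \<in> sets lebesgue"
            by (intro sets.finite_UN finP) simp
        qed
        finally have len: "(\<Sum>p\<in>P. Sup (snd p) - Inf (snd p)) < \<delta>" using mQ by simp
        have "(\<Sum>(s, t)\<in>?\<iota> ` P. norm (x t - x s)) < e / 2"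
        proof (rule ac_modulusD[OF \<delta>])
          show "finite (?\<iota> ` P)" using finP by simp
          show "\<forall>(s, t)\<in>?\<iota> ` P. a \<le> s \<and> s \<le> t \<and> t \<le> b" using ivl by blast
          show "disjoint_family_on (\<lambda>(s, t). {s<..<t}) (?\<iota> ` P)"
            unfolding disjoint_family_on_def
          proof (intro ballI impI)
            fix i j assume "i \<in> ?\<iota> ` P" "j \<in> ?\<iota> ` P" "i \<noteq> j"
            then obtain p p' where "p \<in> P" "p' \<in> P" "i = ?\<iota> p" "j = ?\<iota> p'" "p \<noteq> p'" by auto
            then show "(case i of (s, t) \<Rightarrow> {s<..<t}) \<inter> (case j of (s, t) \<Rightarrow> {s<..<t}) = {}"
              using disj[of p p'] by simp
          qed
          show "(\<Sum>(s, t)\<in>?\<iota> ` P. t - s) < \<delta>" using len by (simp add: sum.reindex[OF inj])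
        qed
        then have "(\<Sum>p\<in>P. norm (x (Sup (snd p)) - x (Inf (snd p)))) < e / 2" by (simp add: sum.reindex[OF inj])
        moreover have "(\<Sum>(t, K)\<in>\<D>. if t \<in> N then norm (x (Sup K) - x (Inf K)) else 0) =
            (\<Sum>p\<in>P. norm (x (Sup (snd p)) - x (Inf (snd p))))"
          unfolding case_prod_unfold
        proof (rule sum.mono_neutral_cong_right[OF fin])
          show "P \<subseteq> \<D>" by (auto simp: P_def)
          show "\<forall>p\<in>\<D> - P. (if fst p \<in> N then norm (x (Sup (snd p)) - x (Inf (snd p))) else 0) = 0"
          proof
            fix p assume p: "p \<in> \<D> - P"
            show "(if fst p \<in> N then norm (x (Sup (snd p)) - x (Inf (snd p))) else 0) = 0"
            proof (cases "fst p \<in> N")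
              case True
              obtain u v where "u \<le> fst p" "fst p \<le> v" "Sup (snd p) = v" "Inf (snd p) = u"
                using KI[of "fst p" "snd p"] p by auto
              with p True have "Sup (snd p) = Inf (snd p)" by (auto simp: P_def)
              then show ?thesis by simp
            qed simp
          qed
        qed (auto simp: P_def)
        ultimately show ?thesis by simp
      qed
      finally show "norm ((\<Sum>(t, K)\<in>\<D>. measure lborel K *\<^sub>R g' t) - (x b - x a)) < e"
        using \<open>\<epsilon> * (b - a) \<le> e / 2\<close> by linarith
    qed
  qed
  then have "(g' has_integral x b - x a) {a..b}" by simp
  then show ?thesis by (rule has_integral_spike[OF N, rotated]) (simp add: g'_def)
qed




section \<open>Absolutely continuous solutions and integral equations\<close>

lemma abs_continuous_on_interval_subset:
  assumes "abs_continuous_on_interval a b x" "a \<le> c" "d \<le> b"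
  shows "abs_continuous_on_interval c d x"
  unfolding abs_continuous_on_interval_iff_modulus
proof (intro allI impI)
  fix \<epsilon> :: real assume "\<epsilon> > 0"
  then obtain \<delta> where "\<delta> > 0" and \<delta>: "ac_modulus a b x \<epsilon> \<delta>"
    using assms(1)[unfolded abs_continuous_on_interval_iff_modulus, THEN spec, of \<epsilon>] by auto
  show "\<exists>\<delta>>0. ac_modulus c d x \<epsilon> \<delta>"
  proof (intro exI[of _ \<delta>] conjI ac_modulusI)
    fix I :: "(real \<times> real) set"
    assume I: "finite I" "\<forall>(s, t)\<in>I. c \<le> s \<and> s \<le> t \<and> t \<le> d"
      "disjoint_family_on (\<lambda>(s, t). {s<..<t}) I" "(\<Sum>(s, t)\<in>I. t - s) < \<delta>"
    have "\<forall>(s, t)\<in>I. a \<le> s \<and> s \<le> t \<and> t \<le> b" using I(2) assms(2,3) by fastforce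
    then show "(\<Sum>(s, t)\<in>I. norm (x t - x s)) < \<epsilon>" by (rule ac_modulusD[OF \<delta> I(1) _ I(3,4)])
  qed fact
qed

text \<open>Meant for adding a constant to \<open>x\<close> and for composing it with a function
  that is Lipschitz on the range of \<open>x\<close>.\<close>

lemma abs_continuous_on_interval_transform:
  assumes x: "abs_continuous_on_interval a b x"
    and C: "C > 0" "\<And>s t. \<lbrakk>a \<le> s; s \<le> t; t \<le> b\<rbrakk> \<Longrightarrow> norm (y t - y s) \<le> C * norm (x t - x s)"
  shows "abs_continuous_on_interval a b y"
  unfolding abs_continuous_on_interval_iff_modulus
proof (intro allI impI)
  fix \<epsilon> :: real assume "\<epsilon> > 0"
  then have "\<epsilon> / C > 0" using C(1) by simp
  then obtain \<delta> where "\<delta> > 0" and \<delta>: "ac_modulus a b x (\<epsilon> / C) \<delta>"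
    using x[unfolded abs_continuous_on_interval_iff_modulus, THEN spec, of "\<epsilon> / C"] by auto
  show "\<exists>\<delta>>0. ac_modulus a b y \<epsilon> \<delta>"
  proof (intro exI[of _ \<delta>] conjI ac_modulusI)
    fix I :: "(real \<times> real) set"
    assume I: "finite I" "\<forall>(s, t)\<in>I. a \<le> s \<and> s \<le> t \<and> t \<le> b"
      "disjoint_family_on (\<lambda>(s, t). {s<..<t}) I" "(\<Sum>(s, t)\<in>I. t - s) < \<delta>"
    then have "(\<Sum>(s, t)\<in>I. norm (x t - x s)) < \<epsilon> / C" by (rule ac_modulusD[OF \<delta>])
    then have "C * (\<Sum>(s, t)\<in>I. norm (x t - x s)) < \<epsilon>" using C(1) by (simp add: field_simps)
    moreover have "(\<Sum>(s, t)\<in>I. norm (y t - y s)) \<le> (\<Sum>(s, t)\<in>I. C * norm (x t - x s))"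
      by (rule sum_mono) (use I(2) C(2) in auto)
    then have "(\<Sum>(s, t)\<in>I. norm (y t - y s)) \<le> C * (\<Sum>(s, t)\<in>I. norm (x t - x s))"
      by (simp add: sum_distrib_left case_prod_unfold)
    ultimately show "(\<Sum>(s, t)\<in>I. norm (y t - y s)) < \<epsilon>" by linarith
  qed fact
qed

lemma abs_continuous_on_interval_imp_continuous_on:
  assumes "abs_continuous_on_interval a b x"
  shows "continuous_on {a..b} x"
  unfolding continuous_on_iff
proof (intro ballI allI impI)
  fix t \<epsilon> :: real assume t: "t \<in> {a..b}" and "\<epsilon> > 0"
  then obtain \<delta> where "\<delta> > 0" and \<delta>: "ac_modulus a b x \<epsilon> \<delta>"
    using assms[unfolded abs_continuous_on_interval_iff_modulus, THEN spec, of \<epsilon>] by auto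
  have *: "norm (x v - x u) < \<epsilon>" if "a \<le> u" "u \<le> v" "v \<le> b" "v - u < \<delta>" for u v
    using ac_modulusD[OF \<delta>, of "{(u, v)}"] that by (simp add: disjoint_family_on_def)
  show "\<exists>d>0. \<forall>s\<in>{a..b}. dist s t < d \<longrightarrow> dist (x s) (x t) < \<epsilon>"
  proof (intro exI[of _ \<delta>] conjI ballI impI)
    fix s assume "s \<in> {a..b}" "dist s t < \<delta>"
    then show "dist (x s) (x t) < \<epsilon>"
      using *[of s t] *[of t s] t
      by (cases "s \<le> t") (auto simp: dist_norm norm_minus_commute)
  qed fact
qed

lemma satisfies_ode_imp_has_integral:
  fixes x :: "real \<Rightarrow> 'a::euclidean_space"
  assumes x: "abs_continuous_on_interval 0 T x" and ode: "satisfies_ode T x g" and t: "t \<in> {0..T}"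
  shows "(g has_integral x t - x 0) {0..t}"
proof (rule has_integral_of_abs_continuous)
  show "abs_continuous_on_interval 0 t x"
    using t by (intro abs_continuous_on_interval_subset[OF x]) auto
  have "AE s in lebesgue. s \<in> {0..T} \<longrightarrow> (x has_vector_derivative g s) (at s within {0..T})"
    using ode by (simp add: satisfies_ode_def AE_restrict_space_iff)
  then have "AE s in lebesgue. s \<in> {0..t} \<longrightarrow> (x has_vector_derivative g s) (at s within {0..t})"
  proof eventually_elim
    case (elim s)
    with t show ?case by (auto intro: has_vector_derivative_within_subset)
  qed
  then show "AE s in lebesgue_on {0..t}. (x has_vector_derivative g s) (at s within {0..t})"
    by (simp add: AE_restrict_space_iff)
qed (use t in auto)

text \<open>Converse to \<open>satisfies_ode_imp_has_integral\<close>. Together they allow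
  trajectories to be sought as continuous solutions of an integral equation.\<close>

lemma satisfies_ode_of_indefinite_integral:
  fixes x :: "real \<Rightarrow> 'a::euclidean_space"
  assumes g: "integrable (leb T) g"
    and x: "\<And>t. t \<in> {0..T} \<Longrightarrow> x t = c + integral {0..t} g"
  shows "abs_continuous_on_interval 0 T x" "satisfies_ode T x g"
proof -
  show "abs_continuous_on_interval 0 T x"
    by (rule abs_continuous_on_interval_transform[OF abs_continuous_on_interval_indefinite_integral[OF g], of 1])
      (auto simp: x)
  have "g integrable_on {0..T}" using integrable_on_lebesgue_on[OF g] by simp
  then have "AE t in leb T. ((\<lambda>t. integral {0..t} g) has_vector_derivative g t) (at t within {0..T})"
    by (rule AE_has_vector_derivative_indefinite_integral)
  then show "satisfies_ode T x g"
    unfolding satisfies_ode_def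
  proof (rule AE_mp, intro AE_I2 impI)
    fix t assume "t \<in> space (leb T)"
      and d: "((\<lambda>t. integral {0..t} g) has_vector_derivative g t) (at t within {0..T})"
    then have t: "t \<in> {0..T}" by simp
    have "((\<lambda>t. c + integral {0..t} g) has_vector_derivative g t) (at t within {0..T})"
      using has_vector_derivative_add[OF has_vector_derivative_const d, of c] by simp
    then show "(x has_vector_derivative g t) (at t within {0..T})"
      by (rule has_vector_derivative_transform[OF t, rotated]) (rule x)
  qed
qed

lemma satisfies_ode_AE_time_deriv:
  fixes x :: "real \<Rightarrow> 'a::euclidean_space"
  assumes "satisfies_ode T x g" and "T > 0"
  shows "AE t in leb T. time_deriv T x t = g t"
  using assms(1) unfolding satisfies_ode_def
proof (rule AE_mp, intro AE_I2 impI)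
  fix t assume "t \<in> space (leb T)" and d: "(x has_vector_derivative g t) (at t within {0..T})"
  then show "time_deriv T x t = g t"
    unfolding time_deriv_def using vector_derivative_within_cbox[of 0 T t x "g t"] \<open>T > 0\<close> by simp
qed

lemma integrable_initial_interval:
  fixes g :: "real \<Rightarrow> 'a::euclidean_space"
  assumes "integrable (leb T) g" "t \<le> T"
  shows "integrable (lebesgue_on {0..t}) g" "g integrable_on {0..t}"
proof -
  show "integrable (lebesgue_on {0..t}) g"
    using assms by (intro Equivalence_Lebesgue_Henstock_Integration.integrable_subinterval[OF assms(1)]) auto
  then show "g integrable_on {0..t}" by (rule integrable_on_lebesgue_on) simp
qed

lemma norm_integral_initial_le:
  fixes g :: "real \<Rightarrow> 'a::euclidean_space"
  assumes g: "integrable (leb T) g" and h: "integrable (leb T) h"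
    and t: "t \<le> T" and le: "\<And>s. s \<in> {0..T} \<Longrightarrow> norm (g s) \<le> h s"
  shows "norm (integral {0..t} g) \<le> integral {0..t} h"
  using t le by (intro integral_norm_bound_integral integrable_initial_interval[OF g t] integrable_initial_interval[OF h t]) auto

lemma integral_initial_le_LINT:
  fixes h :: "real \<Rightarrow> real"
  assumes h: "integrable (leb T) h" and t: "t \<le> T" and pos: "\<And>s. s \<in> {0..T} \<Longrightarrow> 0 \<le> h s"
  shows "integral {0..t} h \<le> (LINT s|leb T. h s)"
proof -
  have "integral {0..t} h \<le> integral {0..T} h"
    using t pos by (intro integral_subset_le integrable_initial_interval[OF h]) auto
  then show ?thesis using h by (simp add: lebesgue_integral_eq_integral)
qed

lemma integrable_mult_continuous:
  fixes z :: "real \<Rightarrow> real"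
  assumes "integrable (leb T) \<alpha>" "continuous_on {0..T} z"
  shows "integrable (leb T) (\<lambda>t. \<alpha> t * z t)"
proof -
  obtain b where b: "\<forall>t\<in>{0..T}. norm (z t) \<le> b"
    using compact_imp_bounded[OF compact_continuous_image[OF assms(2) compact_Icc]] by (auto simp: bounded_iff)
  show ?thesis
  proof (rule Bochner_Integration.integrable_bound[of _ "\<lambda>t. b * norm (\<alpha> t)"])
    show "integrable (leb T) (\<lambda>t. b * norm (\<alpha> t))" using assms(1) by auto
    show "(\<lambda>t. \<alpha> t * z t) \<in> borel_measurable (leb T)"
      using assms(1) continuous_imp_measurable_on_sets_lebesgue[OF assms(2)] by auto
    show "AE t in leb T. norm (\<alpha> t * z t) \<le> norm (b * norm (\<alpha> t))"
    proof (rule AE_I2)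
      fix t assume "t \<in> space (leb T)"
      then have "norm (z t) \<le> b" using b by simp
      then have "norm (\<alpha> t) * norm (z t) \<le> norm (\<alpha> t) * b" by (intro mult_left_mono) auto
      also have "\<dots> \<le> norm (b * norm (\<alpha> t))" by (metis abs_ge_self mult.commute real_norm_def)
      finally show "norm (\<alpha> t * z t) \<le> norm (b * norm (\<alpha> t))" by (simp add: abs_mult)
    qed
  qed
qed

section \<open>Correction of the endpoint\<close>

text \<open>The weight \<open>exp (2 \<integral> \<alpha>)\<close> turns the Volterra operator with kernel \<open>\<alpha>\<close> into a contraction.\<close>

lemma integral_exponential_weight_le:
  fixes \<alpha> :: "real \<Rightarrow> real"
  assumes \<alpha>: "integrable (leb T) \<alpha>" and pos: "\<And>t. t \<in> {0..T} \<Longrightarrow> 0 \<le> \<alpha> t" and t: "t \<in> {0..T}"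
  defines "a \<equiv> \<lambda>t. integral {0..t} \<alpha>"
  shows "integral {0..t} (\<lambda>s. \<alpha> s * exp (2 * a s)) \<le> exp (2 * a t) / 2"
proof -
  have a: "abs_continuous_on_interval 0 T a" "satisfies_ode T a \<alpha>"
    using satisfies_ode_of_indefinite_integral[OF \<alpha>, of a 0] by (auto simp: a_def)
  have mono: "a r \<le> a s" if "0 \<le> r" "r \<le> s" "s \<le> T" for r s
    unfolding a_def using that pos
    by (intro integral_subset_le integrable_initial_interval[OF \<alpha>]) auto
  have a0: "a 0 = 0" by (simp add: a_def)
  have "abs_continuous_on_interval 0 T (\<lambda>s. exp (2 * a s))"
  proof (rule abs_continuous_on_interval_transform[OF a(1), of "2 * exp (2 * a T)"])
    fix r s assume rs: "0 \<le> r" "r \<le> s" "s \<le> T"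
    have le: "a r \<le> a s" "a s \<le> a T" using mono rs by auto
    \<comment> \<open>The tangent inequality 1 + x <= exp x, multiplied by the larger exponential,
      bounds the increment; monotonicity of \<open>a\<close> then yields a uniform Lipschitz
      constant.\<close>
    have "exp (2 * a s) - exp (2 * a r) \<le> exp (2 * a s) * (2 * a s - 2 * a r)"
    proof -
      have "1 + (2 * a r - 2 * a s) \<le> exp (2 * a r - 2 * a s)" by (rule exp_ge_add_one_self)
      then have "exp (2 * a s) * (1 + (2 * a r - 2 * a s)) \<le> exp (2 * a s) * exp (2 * a r - 2 * a s)"
        by (intro mult_left_mono) auto
      also have "\<dots> = exp (2 * a r)" by (simp flip: exp_add)
      finally show ?thesis by (simp add: algebra_simps)
    qed
    also have "\<dots> \<le> exp (2 * a T) * (2 * a s - 2 * a r)"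
      using le by (intro mult_right_mono) auto
    finally show "norm (exp (2 * a s) - exp (2 * a r)) \<le> 2 * exp (2 * a T) * norm (a s - a r)"
      using le(1) by (simp add: algebra_simps)
  qed simp
  moreover have "satisfies_ode T (\<lambda>s. exp (2 * a s)) (\<lambda>s. 2 * (\<alpha> s * exp (2 * a s)))"
    using a(2) unfolding satisfies_ode_def
  proof eventually_elim
    case (elim s)
    then have "(a has_real_derivative \<alpha> s) (at s within {0..T})"
      by (simp add: has_real_derivative_iff_has_vector_derivative)
    then have "((\<lambda>s. exp (2 * a s)) has_real_derivative 2 * (\<alpha> s * exp (2 * a s))) (at s within {0..T})"
      by (auto intro!: derivative_eq_intros)
    then show ?case by (simp add: has_real_derivative_iff_has_vector_derivative)
  qed
  \<comment> \<open>Integrating the derivative of the weight: the factor 2 of the exponent becomes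
    the factor 1/2 of the claim, which is the contraction constant of the linear part.\<close>
  ultimately have "((\<lambda>s. 2 * (\<alpha> s * exp (2 * a s))) has_integral exp (2 * a t) - exp (2 * a 0)) {0..t}"
    by (rule satisfies_ode_imp_has_integral) (rule t)
  then have "2 * integral {0..t} (\<lambda>s. \<alpha> s * exp (2 * a s)) = exp (2 * a t) - 1"
    using a0 by (simp add: has_integral_iff)
  then show ?thesis by simp
qed

text \<open>\<open>F\<close> is the nonlinear increment, \<open>A y + L c\<close> its linearisation, and \<open>H\<close> the response of the linearised system. The fixed
  point iteration acts on \<open>z = y - H c\<close> with \<open>c = \<xi> - z(T)\<close>, divided by the exponential weight.\<close>

lemma endpoint_correction:
  fixes F :: "'a::euclidean_space \<Rightarrow> 'a \<Rightarrow> real \<Rightarrow> 'a" and A H L :: "real \<Rightarrow> 'a \<Rightarrow> 'a"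
  assumes "T > 0"
    and \<alpha>: "integrable (leb T) \<alpha>" and \<alpha>_pos: "\<And>t. t \<in> {0..T} \<Longrightarrow> 0 \<le> \<alpha> t"
    and A: "\<And>t. linear (A t)" "\<And>t y. t \<in> {0..T} \<Longrightarrow> norm (A t y) \<le> \<alpha> t * norm y"
    and A_int: "\<And>y. continuous_on {0..T} y \<Longrightarrow> integrable (leb T) (\<lambda>t. A t (y t))"
    and L: "\<And>t. linear (L t)" "\<And>c. integrable (leb T) (\<lambda>t. L t c)"
    and H: "\<And>t. linear (H t)" "\<And>t c. t \<in> {0..T} \<Longrightarrow> norm (H t c) \<le> h * norm c"
      "\<And>c. continuous_on {0..T} (\<lambda>t. H t c)" "\<And>c. H T c = c"
      "\<And>t c. t \<in> {0..T} \<Longrightarrow> H t c = integral {0..t} (\<lambda>s. A s (H s c) + L s c)"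
    and F_int: "\<And>y c. \<lbrakk>continuous_on {0..T} y; \<And>t. t \<in> {0..T} \<Longrightarrow> norm (y t) \<le> \<rho>; norm c \<le> \<rho>\<rbrakk>
        \<Longrightarrow> integrable (leb T) (\<lambda>t. F (y t) c t)"
    and F0: "\<And>t. t \<in> {0..T} \<Longrightarrow> F 0 0 t = 0"
    and small: "\<And>y y' c c' m. \<lbrakk>continuous_on {0..T} y; continuous_on {0..T} y';
          \<And>t. t \<in> {0..T} \<Longrightarrow> norm (y t) \<le> \<rho>; \<And>t. t \<in> {0..T} \<Longrightarrow> norm (y' t) \<le> \<rho>;
          norm c \<le> \<rho>; norm c' \<le> \<rho>; \<And>t. t \<in> {0..T} \<Longrightarrow> norm (y t - y' t) \<le> m; norm (c - c') \<le> m\<rbrakk>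
        \<Longrightarrow> (LINT t|leb T. norm (F (y t) c t - F (y' t) c' t - A t (y t - y' t) - L t (c - c'))) \<le> \<eta> * m"
    and "0 \<le> h" "0 \<le> \<eta>"
    and \<eta>: "\<eta> * (exp (2 * integral {0..T} \<alpha>) * (1 + h)) \<le> 1 / 4"
    and \<rho>: "(1 + h) * (1 + exp (2 * integral {0..T} \<alpha>)) * norm \<xi> \<le> \<rho>"
  obtains y c where "continuous_on {0..T} y" "y T = \<xi>"
    "norm c \<le> (1 + h) * (1 + exp (2 * integral {0..T} \<alpha>)) * norm \<xi>"
    "\<And>t. t \<in> {0..T} \<Longrightarrow> norm (y t) \<le> (1 + h) * (1 + exp (2 * integral {0..T} \<alpha>)) * norm \<xi>"
    "\<And>t. t \<in> {0..T} \<Longrightarrow> y t = integral {0..t} (\<lambda>s. F (y s) c s)"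
proof -
  let ?I = "\<lambda>f. LINT t|leb T. f t"
  define a where "a t = integral {0..t} \<alpha>" for t
  define E where "E = exp (2 * a T)"
  define e where "e t = exp (2 * a t)" for t
  define K where "K = (1 + h) * (1 + E)"
  have T: "0 \<in> {0..T}" "T \<in> {0..T}" using \<open>T > 0\<close> by auto
  have a_cont: "continuous_on {0..T} a"
    unfolding a_def
    by (rule abs_continuous_on_interval_imp_continuous_on[OF abs_continuous_on_interval_indefinite_integral[OF \<alpha>]])
  have a_mono: "a r \<le> a s" if "0 \<le> r" "r \<le> s" "s \<le> T" for r s
    unfolding a_def using that \<alpha>_pos
    by (intro integral_subset_le integrable_initial_interval[OF \<alpha>]) auto
  have e1: "1 \<le> e t" "e t \<le> E" if "t \<in> {0..T}" for t
    using a_mono[of 0 t] a_mono[of t T] that by (auto simp: e_def E_def a_def)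
  have E1: "1 \<le> E" using e1[OF T(2)] by linarith
  have e_pos: "e t > 0" for t by (simp add: e_def)
  have e_cont: "continuous_on {0..T} e" unfolding e_def by (intro continuous_intros a_cont)
  \<comment> \<open>The unknown \<open>w\<close> is a bounded continuous function on the line; its
    supremum norm is the weighted norm of \<open>z\<close>.\<close>
  define z where "z w t = e t *\<^sub>R apply_bcontfun w t" for w :: "real \<Rightarrow>\<^sub>C 'a" and t
  define c where "c w = \<xi> - z w T" for w
  define y where "y w t = z w t + H t (c w)" for w t
  \<comment> \<open>Subtracting the integral equation of the response \<open>H\<close> from the one
    wanted for \<open>y\<close> leaves this integrand for \<open>z\<close>.\<close>
  define N where "N w s = F (y w s) (c w) s - A s (H s (c w)) - L s (c w)" for w s
  have z_cont: "continuous_on {0..T} (z w)" for w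
    unfolding z_def by (intro continuous_intros e_cont) auto
  have y_cont: "continuous_on {0..T} (y w)" for w
    unfolding y_def by (intro continuous_intros z_cont H(3))
  have z_le: "norm (z w t) \<le> E * norm w" if "t \<in> {0..T}" for w t
    unfolding z_def using e1[OF that] e_pos[of t] norm_bounded[of w t] by (auto intro!: mult_mono)
  \<comment> \<open>Taking the norm of \<xi> as radius is what makes all bounds on \<open>y\<close>
    and \<open>c\<close> linear in \<xi>.\<close>
  define B where "B = cball (0::real \<Rightarrow>\<^sub>C 'a) (norm \<xi>)"
  have B: "norm w \<le> norm \<xi>" if "w \<in> B" for w using that by (simp add: B_def)
  have c_le: "norm (c w) \<le> (1 + E) * norm \<xi>" if "w \<in> B" for w
  proof -
    have "norm (c w) \<le> norm \<xi> + norm (z w T)" unfolding c_def by (rule norm_triangle_ineq4)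
    also have "norm (z w T) \<le> E * norm \<xi>"
      using z_le[OF T(2), of w] B[OF that] E1 mult_left_mono[of "norm w" "norm \<xi>" E] by linarith
    finally show ?thesis by (simp add: algebra_simps)
  qed
  have cK: "norm (c w) \<le> K * norm \<xi>" if "w \<in> B" for w
  proof -
    have "(1 + E) * norm \<xi> \<le> K * norm \<xi>"
      unfolding K_def using \<open>0 \<le> h\<close> E1 by (intro mult_right_mono) (auto simp: algebra_simps)
    with c_le[OF that] show ?thesis by linarith
  qed
  have yK: "norm (y w t) \<le> K * norm \<xi>" if "w \<in> B" "t \<in> {0..T}" for w t
  proof -
    have "norm (y w t) \<le> norm (z w t) + norm (H t (c w))" unfolding y_def by (rule norm_triangle_ineq)
    also have "norm (z w t) \<le> E * norm \<xi>"
      using z_le[OF that(2), of w] B[OF that(1)] E1 mult_left_mono[of "norm w" "norm \<xi>" E] by linarith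
    also have "norm (H t (c w)) \<le> h * ((1 + E) * norm \<xi>)"
      using H(2)[OF that(2), of "c w"] mult_left_mono[OF c_le[OF that(1)] \<open>0 \<le> h\<close>] by linarith
    also have "E * norm \<xi> + h * ((1 + E) * norm \<xi>) \<le> K * norm \<xi>"
      by (simp add: K_def algebra_simps)
    finally show ?thesis by simp
  qed
  have K\<rho>: "K * norm \<xi> \<le> \<rho>" using \<rho> by (simp add: K_def E_def a_def)
  have y\<rho>: "norm (y w t) \<le> \<rho>" if "w \<in> B" "t \<in> {0..T}" for w t using yK[OF that] K\<rho> by linarith
  have c\<rho>: "norm (c w) \<le> \<rho>" if "w \<in> B" for w using cK[OF that] K\<rho> by linarith
  have F_int': "integrable (leb T) (\<lambda>s. F (y w s) (c w) s)" if "w \<in> B" for w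
    by (rule F_int[OF y_cont]) (use y\<rho> c\<rho> that in auto)
  have N_int: "integrable (leb T) (N w)" if "w \<in> B" for w
    unfolding N_def using F_int'[OF that] A_int[OF H(3)] L(2)
    by (intro Bochner_Integration.integrable_diff)
  define \<Psi> where "\<Psi> w t = (1 / e t) *\<^sub>R integral {0..t} (N w)" for w t
  \<comment> \<open>Functions on [0,T] are extended by their end values, so that they belong to the
    complete space of bounded continuous functions on the line.\<close>
  define cl where "cl t = max 0 (min T t)" for t :: real
  have cl: "cl t \<in> {0..T}" for t using \<open>T > 0\<close> by (auto simp: cl_def)
  have cl_id: "cl t = t" if "t \<in> {0..T}" for t using that by (auto simp: cl_def)
  have cl_cont: "continuous_on UNIV cl" unfolding cl_def by (intro continuous_intros)
  have \<Psi>_cont: "continuous_on {0..T} (\<Psi> w)" if "w \<in> B" for w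
    unfolding \<Psi>_def
  proof (intro continuous_intros e_cont ballI)
    show "continuous_on {0..T} (\<lambda>t. integral {0..t} (N w))"
      by (rule abs_continuous_on_interval_imp_continuous_on[OF abs_continuous_on_interval_indefinite_integral[OF N_int[OF that]]])
    show "e t \<noteq> 0" for t using e_pos[of t] by simp
  qed
  have \<Psi>_bcont: "(\<lambda>t. \<Psi> w (cl t)) \<in> bcontfun" if "w \<in> B" for w
    unfolding bcontfun_def
  proof (intro CollectI conjI)
    show "continuous_on UNIV (\<lambda>t. \<Psi> w (cl t))"
      by (rule continuous_on_compose2[OF \<Psi>_cont[OF that] cl_cont]) (use cl in auto)
    have "bounded (\<Psi> w ` {0..T})"
      by (intro compact_imp_bounded compact_continuous_image \<Psi>_cont that) simp
    then show "bounded (range (\<lambda>t. \<Psi> w (cl t)))"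
      by (rule bounded_subset) (use cl in auto)
  qed
  define \<Phi> where "\<Phi> w = Bcontfun (\<lambda>t. \<Psi> w (cl t))" for w
  have \<Phi>: "apply_bcontfun (\<Phi> w) t = \<Psi> w (cl t)" if "w \<in> B" for w t
    unfolding \<Phi>_def by (simp add: Bcontfun_inverse[OF \<Psi>_bcont[OF that]])
  \<comment> \<open>The constant 3/4 consists of 1/2 from the linear part, by the weight, and 1/4
    from the remainder, by the bound on \<eta>.\<close>
  have key: "norm (\<Psi> w t - \<Psi> w' t) \<le> 3 / 4 * norm (w - w')" if w: "w \<in> B" "w' \<in> B" and t: "t \<in> {0..T}" for w w' t
  proof -
    define \<delta> where "\<delta> = norm (w - w')"
    have \<delta>: "\<delta> \<ge> 0" by (simp add: \<delta>_def)
    define R where "R s = F (y w s) (c w) s - F (y w' s) (c w') s - A s (y w s - y w' s) - L s (c w - c w')" for s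
    have zz: "norm (z w s - z w' s) \<le> e s * \<delta>" for s
    proof -
      have "z w s - z w' s = e s *\<^sub>R apply_bcontfun (w - w') s" by (simp add: z_def scaleR_diff_right)
      then show ?thesis using norm_bounded[of "w - w'" s] e_pos[of s] by (simp add: \<delta>_def)
    qed
    have yy: "y w s - y w' s = (z w s - z w' s) + H s (c w - c w')" for s
      by (simp add: y_def linear_diff[OF H(1)])
    \<comment> \<open>The terms A H (c - c') and L (c - c') occur both in the difference of the
      integrands and in \<open>R\<close>, so A (z - z') is the only linear term left over.\<close>
    have NR: "N w s - N w' s = A s (z w s - z w' s) + R s" for s
      by (simp add: N_def R_def yy linear_add[OF A(1)] linear_diff[OF A(1)] linear_diff[OF H(1)] linear_diff[OF L(1)] algebra_simps)
    \<comment> \<open>A common bound for the differences of \<open>y\<close> and of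
      \<open>c\<close>: the factor E removes the weight, and 1 + h accounts for adding the response
      \<open>H\<close>.\<close>
    define m where "m = E * (1 + h) * \<delta>"
    have cc: "norm (c w - c w') \<le> E * \<delta>"
    proof -
      have "norm (c w - c w') = norm (z w T - z w' T)" by (simp add: c_def norm_minus_commute)
      also have "\<dots> \<le> e T * \<delta>" by (rule zz)
      also have "\<dots> \<le> E * \<delta>" using e1[OF T(2)] \<delta> by (intro mult_right_mono) auto
      finally show ?thesis .
    qed
    have Em: "E * \<delta> \<le> m"
      unfolding m_def using E1 \<delta> \<open>0 \<le> h\<close> by (intro mult_right_mono) (auto simp: algebra_simps)
    have yym: "norm (y w s - y w' s) \<le> m" if s: "s \<in> {0..T}" for s
    proof -
      have "norm (y w s - y w' s) \<le> norm (z w s - z w' s) + norm (H s (c w - c w'))"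
        unfolding yy by (rule norm_triangle_ineq)
      also have "norm (z w s - z w' s) \<le> E * \<delta>"
        using zz[of s] mult_right_mono[OF e1(2)[OF s] \<delta>] by linarith
      also have "norm (H s (c w - c w')) \<le> h * (E * \<delta>)"
        using H(2)[OF s, of "c w - c w'"] mult_left_mono[OF cc \<open>0 \<le> h\<close>] by linarith
      finally show ?thesis by (simp add: m_def algebra_simps)
    qed
    have R_int: "integrable (leb T) R"
      unfolding R_def using F_int'[OF w(1)] F_int'[OF w(2)] A_int[OF continuous_on_diff[OF y_cont y_cont]] L(2)
      by (intro Bochner_Integration.integrable_diff)
    have Az_int: "integrable (leb T) (\<lambda>s. A s (z w s - z w' s))"
      by (intro A_int continuous_on_diff z_cont)
    have w_int: "integrable (leb T) (\<lambda>s. \<alpha> s * e s)"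
      by (rule integrable_mult_continuous[OF \<alpha> e_cont])
    have "norm (integral {0..t} (\<lambda>s. A s (z w s - z w' s))) \<le> integral {0..t} (\<lambda>s. (\<alpha> s * e s) * \<delta>)"
    proof (rule norm_integral_initial_le[OF Az_int])
      show "integrable (leb T) (\<lambda>s. (\<alpha> s * e s) * \<delta>)" using w_int by simp
      fix s assume s: "s \<in> {0..T}"
      have "norm (A s (z w s - z w' s)) \<le> \<alpha> s * norm (z w s - z w' s)" by (rule A(2)[OF s])
      also have "\<dots> \<le> \<alpha> s * (e s * \<delta>)" by (intro mult_left_mono zz \<alpha>_pos s)
      finally show "norm (A s (z w s - z w' s)) \<le> (\<alpha> s * e s) * \<delta>" by (simp add: mult.assoc)
    qed (use t in auto)
    also have "\<dots> = integral {0..t} (\<lambda>s. \<alpha> s * e s) * \<delta>" by simp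
    also have "\<dots> \<le> e t / 2 * \<delta>"
      using integral_exponential_weight_le[OF \<alpha> \<alpha>_pos t] \<delta> by (intro mult_right_mono) (auto simp: e_def a_def)
    finally have 1: "norm (integral {0..t} (\<lambda>s. A s (z w s - z w' s))) \<le> e t / 2 * \<delta>" .
    have "norm (integral {0..t} R) \<le> integral {0..t} (\<lambda>s. norm (R s))"
      using t by (intro norm_integral_initial_le[OF R_int]) (use R_int in auto)
    also have "\<dots> \<le> ?I (\<lambda>s. norm (R s))"
      using t R_int by (intro integral_initial_le_LINT) auto
    also have "\<dots> \<le> \<eta> * m"
      unfolding R_def
      by (rule small[OF y_cont y_cont]) (use y\<rho> c\<rho> w yym cc Em in \<open>auto intro: order_trans\<close>)
    also have "\<dots> = (\<eta> * (E * (1 + h))) * \<delta>" by (simp add: m_def)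
    also have "\<dots> \<le> 1 / 4 * \<delta>"
      using \<eta> \<delta> by (intro mult_right_mono) (auto simp: E_def a_def)
    \<comment> \<open>The remainder is estimated over the whole interval; since the weight is at
      least 1, the bound still fits under its value at \<open>t\<close>.\<close>
    also have "\<dots> \<le> e t / 4 * \<delta>"
      using e1(1)[OF t] \<delta> by (intro mult_right_mono) auto
    finally have 2: "norm (integral {0..t} R) \<le> e t / 4 * \<delta>" .
    have "integral {0..t} (N w) - integral {0..t} (N w') = integral {0..t} (\<lambda>s. N w s - N w' s)"
      using t by (intro Henstock_Kurzweil_Integration.integral_diff[symmetric] integrable_initial_interval(2)[OF N_int] w) auto
    also have "\<dots> = integral {0..t} (\<lambda>s. A s (z w s - z w' s)) + integral {0..t} R"
      unfolding NR using t
      by (intro Henstock_Kurzweil_Integration.integral_add integrable_initial_interval(2)[OF Az_int] integrable_initial_interval(2)[OF R_int]) auto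
    finally have eq: "integral {0..t} (N w) - integral {0..t} (N w') = integral {0..t} (\<lambda>s. A s (z w s - z w' s)) + integral {0..t} R" .
    have "norm (integral {0..t} (N w) - integral {0..t} (N w')) \<le> e t * (3 / 4 * \<delta>)"
      unfolding eq using norm_triangle_ineq[of "integral {0..t} (\<lambda>s. A s (z w s - z w' s))" "integral {0..t} R"] 1 2
      by (simp add: algebra_simps)
    then have "(1 / e t) * norm (integral {0..t} (N w) - integral {0..t} (N w')) \<le> (1 / e t) * (e t * (3 / 4 * \<delta>))"
      using e_pos[of t] by (intro mult_left_mono) auto
    also have "\<dots> = 3 / 4 * \<delta>" using e_pos[of t] by simp
    finally have "(1 / e t) * norm (integral {0..t} (N w) - integral {0..t} (N w')) \<le> 3 / 4 * \<delta>" .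
    moreover have "norm (\<Psi> w t - \<Psi> w' t) = (1 / e t) * norm (integral {0..t} (N w) - integral {0..t} (N w'))"
      using e_pos[of t] by (simp add: \<Psi>_def flip: scaleR_diff_right)
    ultimately show ?thesis by (simp add: \<delta>_def)
  qed
  \<comment> \<open>At w = 0 only the response to \<xi> remains. The factor 1/4 is exactly what the
    contraction by 3/4 leaves over for the ball to be mapped into itself.\<close>
  have \<Psi>0: "norm (\<Psi> 0 t) \<le> 1 / 4 * norm \<xi>" if t: "t \<in> {0..T}" for t
  proof -
    have 0: "0 \<in> B" by (simp add: B_def)
    have c0: "c 0 = \<xi>" by (simp add: c_def z_def)
    have y0: "y 0 = (\<lambda>s. H s \<xi>)" by (auto simp: y_def z_def c0)
    define m where "m = (1 + h) * norm \<xi>"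
    have "norm (integral {0..t} (N 0)) \<le> integral {0..t} (\<lambda>s. norm (N 0 s))"
      using t by (intro norm_integral_initial_le[OF N_int[OF 0]]) (use N_int[OF 0] in auto)
    also have "\<dots> \<le> ?I (\<lambda>s. norm (N 0 s))"
      using t N_int[OF 0] by (intro integral_initial_le_LINT) auto
    \<comment> \<open>Subtracting F 0 0 = 0 turns the integrand into a difference to which
      \<open>small\<close> applies, with zero as the second pair.\<close>
    also have "\<dots> = ?I (\<lambda>s. norm (F (y 0 s) (c 0) s - F 0 0 s - A s (y 0 s - 0) - L s (c 0 - 0)))"
      by (rule Bochner_Integration.integral_cong[OF refl]) (simp add: N_def y0 c0 F0)
    also have "\<dots> \<le> \<eta> * m"
    proof (rule small[OF y_cont])
      show "norm (y 0 s - 0) \<le> m" if "s \<in> {0..T}" for s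
        using H(2)[OF that, of \<xi>] norm_ge_zero[of \<xi>] by (simp add: y0 m_def algebra_simps del: norm_ge_zero)
      have "0 \<le> h * norm \<xi>" using \<open>0 \<le> h\<close> by simp
      then show "norm (c 0 - 0) \<le> m" by (simp add: c0 m_def algebra_simps)
      have "0 \<le> \<rho>" using c\<rho>[OF 0] norm_ge_zero order_trans by blast
      then show "norm (0::'a) \<le> \<rho>" "norm (0::'a) \<le> \<rho>" by auto
    qed (use y\<rho>[OF 0] c\<rho>[OF 0] in auto)
    also have "\<dots> \<le> (\<eta> * (E * (1 + h))) * norm \<xi>"
    proof -
      have "(1 + h) * 1 \<le> (1 + h) * E" using E1 \<open>0 \<le> h\<close> by (intro mult_left_mono) auto
      then have "\<eta> * (1 + h) \<le> \<eta> * (E * (1 + h))" using \<open>0 \<le> \<eta>\<close> by (intro mult_left_mono) (auto simp: mult.commute)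
      then show ?thesis unfolding m_def by (metis mult.assoc mult_right_mono norm_ge_zero)
    qed
    also have "\<dots> \<le> 1 / 4 * norm \<xi>"
      using \<eta> by (intro mult_right_mono) (auto simp: E_def a_def)
    finally have "norm (integral {0..t} (N 0)) \<le> 1 / 4 * norm \<xi>" .
    moreover have "1 / e t \<le> 1" using e1(1)[OF t] e_pos[of t] by simp
    ultimately have "1 / e t * norm (integral {0..t} (N 0)) \<le> 1 * (1 / 4 * norm \<xi>)"
      by (intro mult_mono) auto
    then show ?thesis using e_pos[of t] by (simp add: \<Psi>_def)
  qed
  have lip: "dist (\<Phi> w) (\<Phi> w') \<le> 3 / 4 * dist w w'" if "w \<in> B" "w' \<in> B" for w w'
    by (rule dist_bound) (use key[OF that cl] in \<open>simp add: \<Phi> that dist_norm\<close>)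
  have self: "\<Phi> ` B \<subseteq> B"
  proof
    fix v assume "v \<in> \<Phi> ` B"
    then obtain w where w: "w \<in> B" "v = \<Phi> w" by auto
    have 0: "0 \<in> B" by (simp add: B_def)
    have "norm v \<le> norm \<xi>"
    proof (rule norm_bound)
      fix t
      have "norm (\<Psi> w (cl t)) \<le> norm (\<Psi> w (cl t) - \<Psi> 0 (cl t)) + norm (\<Psi> 0 (cl t))"
        by (metis diff_add_cancel norm_triangle_ineq)
      also have "\<dots> \<le> 3 / 4 * norm (w - 0) + 1 / 4 * norm \<xi>"
        by (intro add_mono key[OF w(1) 0 cl] \<Psi>0[OF cl])
      also have "\<dots> \<le> norm \<xi>" using B[OF w(1)] by simp
      finally show "norm (apply_bcontfun v t) \<le> norm \<xi>" by (simp add: w \<Phi>)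
    qed
    then show "v \<in> B" by (simp add: B_def)
  qed
  have "\<exists>!w\<in>B. \<Phi> w = w"
  proof (rule Banach_fix[of B "3 / 4"])
    show "complete B" unfolding B_def by (simp add: complete_eq_closed)
    show "B \<noteq> {}" by (auto simp: B_def)
  qed (use lip self in auto)
  then obtain w where w: "w \<in> B" "\<Phi> w = w" by auto
  have z_eq: "z w t = integral {0..t} (N w)" if t: "t \<in> {0..T}" for t
  proof -
    have "apply_bcontfun w t = \<Psi> w t" using \<Phi>[OF w(1), of t] w(2) cl_id[OF t] by simp
    then show ?thesis using e_pos[of t] by (simp add: z_def \<Psi>_def)
  qed
  \<comment> \<open>Adding the integral equation of \<open>H\<close> back to that of
    \<open>z\<close> restores the nonlinear equation for \<open>y\<close>.\<close>
  have y_eq: "y w t = integral {0..t} (\<lambda>s. F (y w s) (c w) s)" if t: "t \<in> {0..T}" for t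
  proof -
    have HL: "integrable (leb T) (\<lambda>s. A s (H s (c w)) + L s (c w))"
      using A_int[OF H(3)] L(2) by (intro Bochner_Integration.integrable_add)
    have "y w t = integral {0..t} (N w) + integral {0..t} (\<lambda>s. A s (H s (c w)) + L s (c w))"
      using z_eq[OF t] H(5)[OF t, of "c w"] by (simp add: y_def)
    also have "\<dots> = integral {0..t} (\<lambda>s. N w s + (A s (H s (c w)) + L s (c w)))"
      using t by (intro Henstock_Kurzweil_Integration.integral_add[symmetric]
        integrable_initial_interval(2)[OF N_int[OF w(1)]] integrable_initial_interval(2)[OF HL]) auto
    finally show ?thesis by (simp add: N_def)
  qed
  have "y w T = \<xi>" by (simp add: y_def c_def H(4))
  with y_cont cK[OF w(1)] yK[OF w(1)] y_eq show thesis
    by (intro that[of "y w" "c w"]) (auto simp: K_def E_def a_def)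
qed



section \<open>Lebesgue spaces on an interval\<close>

lemma Lp_measurable: "u \<in> Lp q T \<Longrightarrow> u \<in> borel_measurable (leb T)"
  by (simp add: Lp_def)

lemma Lp_finite_iff:
  "q \<noteq> \<infinity> \<Longrightarrow> u \<in> Lp q T \<longleftrightarrow> u \<in> borel_measurable (leb T) \<and>
     integrable (leb T) (\<lambda>t. norm (u t) powr enn2real q)"
  by (simp add: Lp_def)

lemma Lp_infinity_iff:
  "u \<in> Lp \<infinity> T \<longleftrightarrow> u \<in> borel_measurable (leb T) \<and>
     (\<exists>C. AE t in leb T. norm (u t) \<le> C)" (is "?L \<longleftrightarrow> ?m \<and> ?R")
proof -
  let ?M = "leb T" and ?e = "esssup (leb T) (\<lambda>t. ennreal (norm (u t)))"
  have "?e < \<infinity> \<longleftrightarrow> ?R" if m: ?m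
  proof
    assume fin: "?e < \<infinity>"
    have "AE t in ?M. ennreal (norm (u t)) \<le> ?e" by (rule esssup_AE)
    then have "AE t in ?M. norm (u t) \<le> enn2real ?e"
    proof eventually_elim
      case (elim t)
      then show ?case using fin by (metis enn2real_ennreal enn2real_mono norm_ge_zero infinity_ennreal_def)
    qed
    then show ?R by blast
  next
    assume ?R
    then obtain C where C: "AE t in ?M. norm (u t) \<le> C" by blast
    then have "AE t in ?M. ennreal (norm (u t)) \<le> ennreal C"
      by eventually_elim (rule ennreal_leI)
    then have "?e \<le> ennreal C" using m by (intro esssup_I) auto
    then show "?e < \<infinity>" by (metis ennreal_less_top infinity_ennreal_def le_less_trans)
  qed
  then show ?thesis by (auto simp: Lp_def)
qed

lemma Lp_infinityI:
  assumes "q = \<infinity>" "u \<in> borel_measurable (leb T)"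
    and "AE t in leb T. norm (u t) \<le> C"
  shows "u \<in> Lp q T"
  unfolding \<open>q = \<infinity>\<close> Lp_infinity_iff using assms(2,3) by blast

lemma Lp_infinityE:
  assumes "q = \<infinity>" "u \<in> Lp q T"
  obtains C where "AE t in leb T. norm (u t) \<le> C"
  using assms(2) unfolding \<open>q = \<infinity>\<close> Lp_infinity_iff by blast

lemma exponent_ge_1:
  fixes q :: ennreal
  assumes "1 \<le> q" "q \<noteq> \<infinity>"
  shows "1 \<le> enn2real q"
  using assms by (metis enn2real_1 enn2real_mono infinity_ennreal_def top.not_eq_extremum)

lemma Lp_dominated:
  fixes \<Phi> :: "real \<Rightarrow> real"
  assumes \<Phi>: "\<Phi> \<in> Lp q T" and v: "v \<in> borel_measurable (leb T)"
    and le: "AE t in leb T. norm (v t) \<le> \<Phi> t"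
  shows "v \<in> Lp q T"
proof (cases "q = \<infinity>")
  case True
  then obtain C where "AE t in leb T. norm (\<Phi> t) \<le> C"
    by (rule Lp_infinityE[OF _ \<Phi>])
  from le this have "AE t in leb T. norm (v t) \<le> C"
  proof eventually_elim
    case (elim t)
    then show ?case by simp
  qed
  then show ?thesis by (rule Lp_infinityI[OF True v])
next
  case False
  show ?thesis unfolding Lp_finite_iff[OF False]
  proof (rule conjI[OF v], rule Bochner_Integration.integrable_bound)
    show "integrable (leb T) (\<lambda>t. norm (\<Phi> t) powr enn2real q)"
      using \<Phi> by (simp only: Lp_finite_iff[OF False])
    show "(\<lambda>t. norm (v t) powr enn2real q) \<in> borel_measurable (leb T)"
      using v by measurable
    show "AE t in leb T. norm (norm (v t) powr enn2real q) \<le> norm (norm (\<Phi> t) powr enn2real q)"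
      using le by eventually_elim (auto intro!: powr_mono2)
  qed
qed

lemma Lp_norm_fun: "u \<in> Lp q T \<Longrightarrow> (\<lambda>t. norm (u t)) \<in> Lp q T"
  by (auto simp: Lp_def)

lemma Lp_scale:
  fixes \<Phi> :: "real \<Rightarrow> real"
  assumes "\<Phi> \<in> Lp q T"
  shows "(\<lambda>t. c * \<Phi> t) \<in> Lp q T"
proof (cases "q = \<infinity>")
  case True
  then obtain C where C: "AE t in leb T. norm (\<Phi> t) \<le> C"
    by (rule Lp_infinityE[OF _ assms])
  have m: "(\<lambda>t. c * \<Phi> t) \<in> borel_measurable (leb T)"
    using Lp_measurable[OF assms] by measurable
  from C have "AE t in leb T. norm (c * \<Phi> t) \<le> \<bar>c\<bar> * C"
    by eventually_elim (auto simp: abs_mult intro!: mult_left_mono)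
  then show ?thesis by (rule Lp_infinityI[OF True m])
next
  case False
  then show ?thesis using assms by (auto simp: Lp_finite_iff abs_mult powr_mult)
qed

lemma Lp_add:
  fixes \<Phi> \<Psi> :: "real \<Rightarrow> real"
  assumes \<Phi>: "\<Phi> \<in> Lp q T" and \<Psi>: "\<Psi> \<in> Lp q T"
  shows "(\<lambda>t. \<Phi> t + \<Psi> t) \<in> Lp q T"
proof (cases "q = \<infinity>")
  case True
  obtain C where C: "AE t in leb T. norm (\<Phi> t) \<le> C" by (rule Lp_infinityE[OF True \<Phi>])
  obtain D where D: "AE t in leb T. norm (\<Psi> t) \<le> D" by (rule Lp_infinityE[OF True \<Psi>])
  from C D have "AE t in leb T. norm (\<Phi> t + \<Psi> t) \<le> C + D"
  proof eventually_elim
    case (elim t)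
    then show ?case by simp
  qed
  moreover have "(\<lambda>t. \<Phi> t + \<Psi> t) \<in> borel_measurable (leb T)"
    using Lp_measurable[OF \<Phi>] Lp_measurable[OF \<Psi>] by measurable
  ultimately show ?thesis using Lp_infinityI[OF True] by blast
next
  case False
  let ?q = "enn2real q"
  have [measurable]: "\<Phi> \<in> borel_measurable (leb T)" "\<Psi> \<in> borel_measurable (leb T)"
    using \<Phi> \<Psi> by (auto dest: Lp_measurable)
  show ?thesis unfolding Lp_finite_iff[OF False]
  proof (rule conjI, measurable, rule Bochner_Integration.integrable_bound)
    show "integrable (leb T) (\<lambda>t. 2 powr ?q * (norm (\<Phi> t) powr ?q + norm (\<Psi> t) powr ?q))"
      using \<Phi> \<Psi> by (simp add: Lp_finite_iff[OF False])
    show "AE t in leb T. norm (norm (\<Phi> t + \<Psi> t) powr ?q)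
        \<le> norm (2 powr ?q * (norm (\<Phi> t) powr ?q + norm (\<Psi> t) powr ?q))"
    proof (rule AE_I2)
      fix t
      \<comment> \<open>Comparison with the maximum of the two values replaces convexity of the
        power.\<close>
      define m where "m = max \<bar>\<Phi> t\<bar> \<bar>\<Psi> t\<bar>"
      have "norm (\<Phi> t + \<Psi> t) powr ?q \<le> (2 * m) powr ?q"
        by (intro powr_mono2) (auto simp: m_def)
      also have "\<dots> = 2 powr ?q * m powr ?q" by (simp add: powr_mult m_def)
      also have "m powr ?q \<le> norm (\<Phi> t) powr ?q + norm (\<Psi> t) powr ?q" by (auto simp: m_def max_def)
      finally show "norm (norm (\<Phi> t + \<Psi> t) powr ?q)
        \<le> norm (2 powr ?q * (norm (\<Phi> t) powr ?q + norm (\<Psi> t) powr ?q))"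
        by (simp add: mult_left_mono)
    qed
  qed measurable
qed

lemma Lp_const: "(\<lambda>t. c :: real) \<in> Lp q T"
proof (cases "q = \<infinity>")
  case True
  then show ?thesis by (rule Lp_infinityI[where C="\<bar>c\<bar>"]) auto
next
  case False
  then show ?thesis by (simp add: Lp_finite_iff finite_measure.integrable_const finite_measure_lebesgue_on)
qed

text \<open>For finite q >= 1 the pointwise bound |u| <= 1 + |u|^q suffices, because constants are
  integrable on a bounded interval.\<close>

lemma Lp_imp_integrable:
  fixes u :: "real \<Rightarrow> 'a::euclidean_space"
  assumes "1 \<le> q" and u: "u \<in> Lp q T"
  shows "integrable (leb T) u"
proof (cases "q = \<infinity>")
  case True
  then obtain C where C: "AE t in leb T. norm (u t) \<le> C" by (rule Lp_infinityE[OF _ u])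
  show ?thesis
  proof (rule Bochner_Integration.integrable_bound)
    show "integrable (leb T) (\<lambda>t. C)"
      by (simp add: finite_measure.integrable_const finite_measure_lebesgue_on)
    show "AE t in leb T. norm (u t) \<le> norm C" using C by eventually_elim auto
  qed (use u in \<open>rule Lp_measurable\<close>)
next
  case False
  let ?q = "enn2real q"
  show ?thesis
  proof (rule Bochner_Integration.integrable_bound)
    show "integrable (leb T) (\<lambda>t. 1 + norm (u t) powr ?q)"
      using u by (auto simp: Lp_finite_iff[OF False] finite_measure.integrable_const finite_measure_lebesgue_on)
    show "AE t in leb T. norm (u t) \<le> norm (1 + norm (u t) powr ?q)"
    proof (rule AE_I2)
      fix t
      show "norm (u t) \<le> norm (1 + norm (u t) powr ?q)"
      proof (cases "norm (u t) \<le> 1")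
        case True
        then show ?thesis by (simp add: add_increasing2)
      next
        case False
        then have "norm (u t) powr 1 \<le> norm (u t) powr ?q"
          using exponent_ge_1[OF \<open>1 \<le> q\<close> \<open>q \<noteq> \<infinity>\<close>] by (intro powr_mono) auto
        then show ?thesis by simp
      qed
    qed
  qed (use u in \<open>rule Lp_measurable\<close>)
qed

section \<open>Norm estimates and convergence in Lebesgue spaces\<close>

lemma Lp_norm_infinity_bound:
  assumes "u \<in> Lp \<infinity> T" "Lp_norm \<infinity> T u \<le> \<epsilon>"
  shows "AE t in leb T. norm (u t) \<le> \<epsilon>"
proof -
  let ?e = "esssup (leb T) (\<lambda>t. ennreal (norm (u t)))"
  have fin: "?e < \<infinity>" and le: "enn2real ?e \<le> \<epsilon>" using assms by (auto simp: Lp_def Lp_norm_def)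
  have "AE t in leb T. ennreal (norm (u t)) \<le> ?e" by (rule esssup_AE)
  then show ?thesis
  proof eventually_elim
    case (elim t)
    then have "norm (u t) \<le> enn2real ?e" using fin
      by (metis enn2real_ennreal enn2real_mono norm_ge_zero infinity_ennreal_def)
    with le show ?case by linarith
  qed
qed

lemma Lp_norm_less_imp_integral_less:
  assumes "1 \<le> q" "q \<noteq> \<infinity>" "Lp_norm q T u < \<epsilon>" "0 < \<epsilon>"
  shows "(LINT t|leb T. norm (u t) powr enn2real q) < \<epsilon> powr enn2real q"
proof (rule ccontr)
  let ?q = "enn2real q" and ?I = "LINT t|leb T. norm (u t) powr enn2real q"
  have q: "1 \<le> ?q" using exponent_ge_1 assms by auto
  assume "\<not> ?I < \<epsilon> powr ?q"
  then have "(\<epsilon> powr ?q) powr (1 / ?q) \<le> ?I powr (1 / ?q)" using q by (intro powr_mono2) auto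
  then have "\<epsilon> \<le> ?I powr (1 / ?q)" using q assms(4) by (simp add: powr_powr)
  with assms(2,3) show False by (simp add: Lp_norm_def)
qed

text \<open>The factor 1 + T serves all exponents at once: it is at least T^(1/q) for finite q >= 1
  and at least 1 for q = \<infinity>.\<close>

lemma Lp_norm_le_of_bound:
  fixes u :: "real \<Rightarrow> 'a::euclidean_space"
  assumes "1 \<le> q" "0 < T" and m: "u \<in> borel_measurable (leb T)"
    and le: "AE t in leb T. norm (u t) \<le> \<epsilon>" and "0 \<le> \<epsilon>"
  shows "Lp_norm q T u \<le> (1 + T) * \<epsilon>"
proof (cases "q = \<infinity>")
  case True
  have "esssup (leb T) (\<lambda>t. ennreal (norm (u t))) \<le> ennreal \<epsilon>"
    using m le by (intro esssup_I) (auto elim!: eventually_mono intro: ennreal_leI)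
  then have "Lp_norm q T u \<le> \<epsilon>" using True \<open>0 \<le> \<epsilon>\<close>
    by (simp add: Lp_norm_def) (metis enn2real_ennreal enn2real_mono ennreal_less_top)
  also have "\<epsilon> \<le> (1 + T) * \<epsilon>" using \<open>0 < T\<close> \<open>0 \<le> \<epsilon>\<close> by (simp add: algebra_simps)
  finally show ?thesis .
next
  case False
  let ?q = "enn2real q"
  have q: "1 \<le> ?q" using exponent_ge_1 assms False by auto
  have u: "u \<in> Lp q T"
    by (rule Lp_dominated[OF Lp_const m le])
  have "(LINT t|leb T. norm (u t) powr ?q) \<le> (LINT t|leb T. \<epsilon> powr ?q)"
  proof (rule integral_mono_AE)
    show "integrable (leb T) (\<lambda>t. norm (u t) powr ?q)" using u by (simp add: Lp_finite_iff[OF False])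
    show "integrable (leb T) (\<lambda>t. \<epsilon> powr ?q)"
      by (simp add: finite_measure.integrable_const finite_measure_lebesgue_on)
    show "AE t in leb T. norm (u t) powr ?q \<le> \<epsilon> powr ?q"
      using le by eventually_elim (use q in \<open>auto intro!: powr_mono2\<close>)
  qed
  also have "\<dots> = T * \<epsilon> powr ?q" using \<open>0 < T\<close> by (simp add: measure_restrict_space)
  also have "\<dots> \<le> (1 + T) powr ?q * \<epsilon> powr ?q"
  proof (rule mult_right_mono)
    have "(1 + T) powr 1 \<le> (1 + T) powr ?q" using q \<open>0 < T\<close> by (intro powr_mono) auto
    then show "T \<le> (1 + T) powr ?q" using \<open>0 < T\<close> by simp
  qed simp
  also have "\<dots> = ((1 + T) * \<epsilon>) powr ?q" using \<open>0 < T\<close> \<open>0 \<le> \<epsilon>\<close> by (simp add: powr_mult)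
  finally have "(LINT t|leb T. norm (u t) powr ?q) powr (1 / ?q) \<le> (((1 + T) * \<epsilon>) powr ?q) powr (1 / ?q)"
    using q by (intro powr_mono2 integral_nonneg_AE) auto
  also have "\<dots> = (1 + T) * \<epsilon>" using q \<open>0 < T\<close> \<open>0 \<le> \<epsilon>\<close> by (simp add: powr_powr)
  finally show ?thesis using False by (simp add: Lp_norm_def)
qed

text \<open>For finite p the inequality s <= \<epsilon> + \<epsilon>^(1-p) s^p takes the place of
  Hoelder's. It is trivial for s <= \<epsilon> and follows from monotonicity of s^(1-p) otherwise;
  integration gives T \<epsilon> + \<epsilon>.\<close>

lemma integral_norm_le_of_Lp_norm:
  fixes u :: "real \<Rightarrow> 'a::euclidean_space"
  assumes "1 \<le> p" "0 < T" and u: "u \<in> Lp p T" and less: "Lp_norm p T u < \<epsilon>" and "0 < \<epsilon>"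
  shows "(LINT t|leb T. norm (u t)) \<le> (1 + T) * \<epsilon>"
proof (cases "p = \<infinity>")
  case True
  have "AE t in leb T. norm (u t) \<le> \<epsilon>"
    using Lp_norm_infinity_bound[of u T \<epsilon>] u less True by simp
  then have "(LINT t|leb T. norm (u t)) \<le> (LINT t|leb T. \<epsilon>)"
    using Lp_imp_integrable[OF assms(1) u]
    by (intro integral_mono_AE) (auto simp: finite_measure.integrable_const finite_measure_lebesgue_on)
  also have "\<dots> = T * \<epsilon>" using \<open>0 < T\<close> by (simp add: measure_restrict_space)
  finally show ?thesis using \<open>0 < \<epsilon>\<close> by (simp add: algebra_simps)
next
  case False
  let ?q = "enn2real p"
  have q: "1 \<le> ?q" using exponent_ge_1 assms False by auto
  have int: "integrable (leb T) (\<lambda>t. norm (u t) powr ?q)" using u by (simp add: Lp_finite_iff[OF False])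
  have "(LINT t|leb T. norm (u t)) \<le> (LINT t|leb T. \<epsilon> + \<epsilon> powr (1 - ?q) * norm (u t) powr ?q)"
  proof (rule integral_mono)
    show "integrable (leb T) (\<lambda>t. norm (u t))" using Lp_imp_integrable[OF assms(1) u] by simp
    show "integrable (leb T) (\<lambda>t. \<epsilon> + \<epsilon> powr (1 - ?q) * norm (u t) powr ?q)"
      using int by (simp add: finite_measure.integrable_const finite_measure_lebesgue_on)
    fix t
    show "norm (u t) \<le> \<epsilon> + \<epsilon> powr (1 - ?q) * norm (u t) powr ?q"
    proof (cases "norm (u t) \<le> \<epsilon>")
      case True
      then show ?thesis by (simp add: add_increasing2)
    next
      case le: False
      then have pos: "norm (u t) > 0" using \<open>0 < \<epsilon>\<close> by linarith
      have "norm (u t) = norm (u t) powr (1 - ?q) * norm (u t) powr ?q"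
        using pos by (simp add: powr_add[symmetric])
      also have "\<dots> \<le> \<epsilon> powr (1 - ?q) * norm (u t) powr ?q"
        using le \<open>0 < \<epsilon>\<close> q by (intro mult_right_mono powr_mono2') auto
      finally show ?thesis using \<open>0 < \<epsilon>\<close> by linarith
    qed
  qed
  also have "\<dots> = T * \<epsilon> + \<epsilon> powr (1 - ?q) * (LINT t|leb T. norm (u t) powr ?q)"
    using int \<open>0 < T\<close> by (simp add: measure_restrict_space finite_measure.integrable_const finite_measure_lebesgue_on)
  also have "\<dots> \<le> T * \<epsilon> + \<epsilon> powr (1 - ?q) * \<epsilon> powr ?q"
    using Lp_norm_less_imp_integral_less[OF assms(1) False less \<open>0 < \<epsilon>\<close>]
    by (intro add_left_mono mult_left_mono) auto
  also have "\<epsilon> powr (1 - ?q) * \<epsilon> powr ?q = \<epsilon>" using \<open>0 < \<epsilon>\<close> by (simp add: powr_add[symmetric])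
  finally show ?thesis by (simp add: algebra_simps)
qed

text \<open>The \<open>q\<close>-th powers of a rapidly convergent sequence are summable; the sum supplies the dominating function.\<close>

lemma Lp_rapid_convergence_dominated:
  fixes d :: "nat \<Rightarrow> real \<Rightarrow> 'a::euclidean_space"
  assumes "1 \<le> q" and d: "\<And>n. d n \<in> Lp q T" and less: "\<And>n. Lp_norm q T (d n) < (1 / 2) ^ n"
  obtains W :: "real \<Rightarrow> real" where "W \<in> Lp q T"
    "AE t in leb T. (\<forall>n. norm (d n t) \<le> W t) \<and> (\<lambda>n. d n t) \<longlonglongrightarrow> 0"
proof (cases "q = \<infinity>")
  case True
  have "AE t in leb T. norm (d n t) \<le> (1 / 2) ^ n" for n
    using Lp_norm_infinity_bound[of "d n" T "(1 / 2) ^ n"] d[of n] less[of n] True by simp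
  then have "AE t in leb T. \<forall>n. norm (d n t) \<le> (1 / 2) ^ n" by (simp add: AE_all_countable)
  then have "AE t in leb T. (\<forall>n. norm (d n t) \<le> 1) \<and> (\<lambda>n. d n t) \<longlonglongrightarrow> 0"
  proof eventually_elim
    case (elim t)
    have "(\<lambda>n. (1 / 2 :: real) ^ n) \<longlonglongrightarrow> 0" by (intro LIMSEQ_power_zero) simp
    then have "(\<lambda>n. d n t) \<longlonglongrightarrow> 0"
      by (rule Lim_null_comparison[rotated]) (use elim in auto)
    moreover have "(1 / 2 :: real) ^ n \<le> 1" for n by (rule power_le_one) auto
    ultimately show ?case using elim order_trans by blast
  qed
  then show thesis by (intro that[of "\<lambda>t. 1"] Lp_const)
next
  case False
  let ?q = "enn2real q" and ?M = "leb T"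
  have q: "1 \<le> ?q" using exponent_ge_1 assms False by auto
  have m[measurable]: "d n \<in> borel_measurable ?M" for n using d[of n] by (rule Lp_measurable)
  have int: "integrable ?M (\<lambda>t. norm (d n t) powr ?q)" for n using d[of n] by (simp add: Lp_finite_iff[OF False])
  define S where "S t = (\<Sum>n. ennreal (norm (d n t) powr ?q))" for t
  have S_m[measurable]: "S \<in> borel_measurable ?M" unfolding S_def by measurable
  have "(\<integral>\<^sup>+t. S t \<partial>?M) = (\<Sum>n. (\<integral>\<^sup>+t. ennreal (norm (d n t) powr ?q) \<partial>?M))"
    unfolding S_def by (intro nn_integral_suminf) measurable
  also have "\<dots> \<le> (\<Sum>n. ennreal ((1 / 2) ^ n))"
  proof (intro suminf_le allI)
    fix n
    have "(LINT t|?M. norm (d n t) powr ?q) \<le> ((1 / 2) ^ n) powr ?q"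
      using Lp_norm_less_imp_integral_less[OF assms(1) False less[of n]] by simp
    \<comment> \<open>Raising a number of [0,1] to a power q >= 1 does not increase it, so the
      integrals are dominated by a geometric series.\<close>
    also have "\<dots> \<le> ((1 / 2) ^ n) powr 1"
      using q by (intro powr_mono') (auto simp: power_le_one)
    finally have "(LINT t|?M. norm (d n t) powr ?q) \<le> (1 / 2) ^ n" by simp
    then show "(\<integral>\<^sup>+t. ennreal (norm (d n t) powr ?q) \<partial>?M) \<le> ennreal ((1 / 2) ^ n)"
      by (subst nn_integral_eq_integral[OF int]) (auto intro: ennreal_leI)
  qed auto
  also have "\<dots> = ennreal (\<Sum>n. (1 / 2) ^ n)"
    by (intro suminf_ennreal2 summable_geometric) auto
  also have "\<dots> < \<infinity>" by simp
  finally have fin: "(\<integral>\<^sup>+t. S t \<partial>?M) < \<infinity>" .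
  then have S_fin: "AE t in ?M. S t \<noteq> \<infinity>" by (intro nn_integral_PInf_AE) auto
  \<comment> \<open>Each term of the series is at most its sum \<open>S\<close>, so the q-th root of
    \<open>S\<close> dominates every member of the sequence, and integrability of \<open>S\<close>
    puts this root into L^q.\<close>
  define W where "W t = enn2real (S t) powr (1 / ?q)" for t
  have "W \<in> Lp q T"
    unfolding Lp_finite_iff[OF False]
  proof
    show "W \<in> borel_measurable ?M" unfolding W_def by measurable
    have "integrable ?M (\<lambda>t. enn2real (S t))"
    proof (rule integrableI_nonneg)
      have "(\<integral>\<^sup>+t. ennreal (enn2real (S t)) \<partial>?M) = (\<integral>\<^sup>+t. S t \<partial>?M)"
        using S_fin by (intro nn_integral_cong_AE) (auto elim!: eventually_mono simp: less_top)
      with fin show "(\<integral>\<^sup>+t. ennreal (enn2real (S t)) \<partial>?M) < \<infinity>" by simp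
    qed auto
    then show "integrable ?M (\<lambda>t. norm (W t) powr ?q)"
      using q by (simp add: W_def powr_powr)
  qed
  moreover have "AE t in ?M. (\<forall>n. norm (d n t) \<le> W t) \<and> (\<lambda>n. d n t) \<longlonglongrightarrow> 0"
    using S_fin
  proof eventually_elim
    case (elim t)
    then have "(\<Sum>n. ennreal (norm (d n t) powr ?q)) \<noteq> top" by (simp add: S_def)
    then have summ: "summable (\<lambda>n. norm (d n t) powr ?q)"
      by (intro summable_suminf_not_top) auto
    have root: "(norm (d n t) powr ?q) powr (1 / ?q) = norm (d n t)" for n
      using q by (simp add: powr_powr)
    have "S t = ennreal (\<Sum>n. norm (d n t) powr ?q)"
      unfolding S_def by (rule suminf_ennreal2[OF _ summ]) simp
    then have St: "enn2real (S t) = (\<Sum>n. norm (d n t) powr ?q)"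
      by (simp add: suminf_nonneg summ)
    have "norm (d n t) \<le> W t" for n
    proof -
      have "norm (d n t) powr ?q \<le> enn2real (S t)"
        unfolding St using sum_le_suminf[OF summ, of "{n}"] by simp
      then have "(norm (d n t) powr ?q) powr (1 / ?q) \<le> W t"
        unfolding W_def using q by (intro powr_mono2) auto
      then show ?thesis by (simp only: root)
    qed
    moreover have "(\<lambda>n. (norm (d n t) powr ?q) powr (1 / ?q)) \<longlonglongrightarrow> 0 powr (1 / ?q)"
      using q by (intro tendsto_powr2 summable_LIMSEQ_zero[OF summ]) auto
    then have "(\<lambda>n. norm (d n t)) \<longlonglongrightarrow> 0" by (simp only: root) simp
    ultimately show ?case by (simp add: tendsto_norm_zero_iff)
  qed
  ultimately show thesis by (rule that)
qed

text \<open>For finite q this is dominated convergence of the q-th powers. Convergence almost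
  everywhere gives no control of the essential supremum, hence the separate hypothesis for q =
  \<infinity>.\<close>

lemma Lp_norm_tendsto_zero:
  fixes g :: "nat \<Rightarrow> real \<Rightarrow> 'a::euclidean_space" and \<Phi> :: "real \<Rightarrow> real"
  assumes "1 \<le> q" "0 < T" and m: "\<And>n. g n \<in> borel_measurable (leb T)"
    and \<Phi>: "\<Phi> \<in> Lp q T" "\<And>n. AE t in leb T. norm (g n t) \<le> \<Phi> t"
    and lim: "q \<noteq> \<infinity> \<Longrightarrow> AE t in leb T. (\<lambda>n. g n t) \<longlonglongrightarrow> 0"
    and unif: "\<And>r. \<lbrakk>q = \<infinity>; 0 < r\<rbrakk> \<Longrightarrow> \<exists>N. \<forall>n\<ge>N. AE t in leb T. norm (g n t) \<le> r"
  shows "(\<lambda>n. Lp_norm q T (g n)) \<longlonglongrightarrow> 0"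
proof (cases "q = \<infinity>")
  case True
  show ?thesis
  proof (rule LIMSEQ_I)
    fix r :: real assume "0 < r"
    define r' where "r' = r / 2 / (1 + T)"
    have "1 + T \<noteq> 0" using \<open>0 < T\<close> by linarith
    then have "(1 + T) * r' = r / 2"
      unfolding r'_def by (metis nonzero_mult_div_cancel_left times_divide_eq_right)
    moreover have "0 < r'" using \<open>0 < r\<close> \<open>0 < T\<close> by (simp add: r'_def)
    ultimately have r': "0 < r'" "(1 + T) * r' = r / 2" by auto
    from unif[OF True r'(1)] obtain N where N: "\<And>n. N \<le> n \<Longrightarrow> AE t in leb T. norm (g n t) \<le> r'" by blast
    have "norm (Lp_norm q T (g n) - 0) < r" if n: "N \<le> n" for n
    proof -
      have "Lp_norm q T (g n) \<le> (1 + T) * r'"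
        by (rule Lp_norm_le_of_bound[OF assms(1,2) m N[OF n] less_imp_le[OF r'(1)]])
      moreover have "0 \<le> Lp_norm q T (g n)" by (simp add: Lp_norm_def)
      ultimately show ?thesis using r'(2) \<open>0 < r\<close> by simp
    qed
    then show "\<exists>N. \<forall>n\<ge>N. norm (Lp_norm q T (g n) - 0) < r" by blast
  qed
next
  case False
  let ?q = "enn2real q"
  have q: "1 \<le> ?q" using exponent_ge_1 assms False by auto
  have [measurable]: "g n \<in> borel_measurable (leb T)" for n by (rule m)
  have "(\<lambda>n. LINT t|leb T. norm (g n t) powr ?q) \<longlonglongrightarrow> (LINT t|leb T. 0)"
  proof (rule integral_dominated_convergence)
    show "integrable (leb T) (\<lambda>t. norm (\<Phi> t) powr ?q)" using \<Phi>(1) by (simp add: Lp_finite_iff[OF False])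
    show "AE t in leb T. (\<lambda>n. norm (g n t) powr ?q) \<longlonglongrightarrow> 0"
      using lim[OF False]
    proof eventually_elim
      case (elim t)
      then have "(\<lambda>n. norm (g n t) powr ?q) \<longlonglongrightarrow> 0 powr ?q"
        using q by (intro tendsto_powr2 tendsto_norm_zero) auto
      then show ?case by simp
    qed
    show "AE t in leb T. norm (norm (g n t) powr ?q) \<le> norm (\<Phi> t) powr ?q" for n
      using \<Phi>(2)[of n] by eventually_elim (use q in \<open>auto intro!: powr_mono2\<close>)
  qed auto
  then have "(\<lambda>n. (LINT t|leb T. norm (g n t) powr ?q) powr (1 / ?q)) \<longlonglongrightarrow> 0 powr (1 / ?q)"
    using q by (intro tendsto_powr2) (auto intro!: always_eventually integral_nonneg_AE)
  then show ?thesis using False by (simp add: Lp_norm_def)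
qed



section \<open>Mean value estimates and growth conditions\<close>

text \<open>Continuity is known only for times in [0,T]. Composing with the retraction of the line
  onto this interval gives a function continuous on the whole product, hence Borel
  measurable.\<close>

lemma jointly_continuous_measurable:
  fixes g :: "'a::euclidean_space \<Rightarrow> 'b::euclidean_space \<Rightarrow> real \<Rightarrow> 'c::euclidean_space"
  assumes g: "jointly_continuous T g" and "0 < T"
    and X: "X \<in> borel_measurable (leb T)" and U: "U \<in> borel_measurable (leb T)"
  shows "(\<lambda>t. g (X t) (U t) t) \<in> borel_measurable (leb T)"
proof -
  let ?M = "leb T"
  define cl where "cl t = max 0 (min T t)" for t :: real
  define h where "h = (\<lambda>(x, u, t). g x u (cl t))"
  have cl: "continuous_on A cl" for A unfolding cl_def by (intro continuous_intros)
  have "continuous_on UNIV (\<lambda>z. (\<lambda>(x, u, t). g x u t) (fst z, fst (snd z), cl (snd (snd z))))"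
    using \<open>0 < T\<close>
    by (intro continuous_on_compose2[OF g[unfolded jointly_continuous_def]] continuous_intros continuous_on_compose2[OF cl])
      (auto simp: cl_def)
  then have "continuous_on UNIV h" by (simp add: h_def case_prod_unfold)
  then have h: "h \<in> borel_measurable borel" by (rule borel_measurable_continuous_onI)
  have "(\<lambda>t::real. t) \<in> borel_measurable ?M"
    by (rule continuous_imp_measurable_on_sets_lebesgue) (auto intro: continuous_intros)
  then have "(\<lambda>t. (X t, U t, t)) \<in> borel_measurable ?M" using X U by (intro borel_measurable_Pair)
  then have *: "(\<lambda>t. h (X t, U t, t)) \<in> borel_measurable ?M" by (rule measurable_compose[OF _ h])
  have eq: "h (X t, U t, t) = g (X t) (U t) t" if "t \<in> space ?M" for t
    using that by (simp add: h_def cl_def)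
  show ?thesis by (rule measurable_cong[THEN iffD1, OF eq *])
qed

lemma jointly_continuous_bounded:
  fixes g :: "'a::euclidean_space \<Rightarrow> 'b::euclidean_space \<Rightarrow> real \<Rightarrow> 'c::euclidean_space"
  assumes g: "jointly_continuous T g"
  obtains C where "0 \<le> C"
    "\<And>x u t. \<lbrakk>norm x \<le> R; norm u \<le> W; t \<in> {0..T}\<rbrakk> \<Longrightarrow> norm (g x u t) \<le> C"
proof -
  let ?K = "cball (0::'a) R \<times> cball (0::'b) W \<times> {0..T}"
  have "compact ((\<lambda>(x, u, t). g x u t) ` ?K)"
    by (rule compact_continuous_image[OF continuous_on_subset[OF g[unfolded jointly_continuous_def]]])
      (auto intro!: compact_Times)
  then have "bounded ((\<lambda>(x, u, t). g x u t) ` ?K)" by (rule compact_imp_bounded)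
  then obtain C where C: "\<forall>z\<in>(\<lambda>(x, u, t). g x u t) ` ?K. norm z \<le> C"
    unfolding bounded_iff by (rule exE)
  show thesis
  proof (rule that[of "max 0 C"])
    fix x :: 'a and u :: 'b and t assume "norm x \<le> R" "norm u \<le> W" "t \<in> {0..T}"
    then have "(x, u, t) \<in> ?K" by simp
    then have "g x u t \<in> (\<lambda>(x, u, t). g x u t) ` ?K" by (rule rev_image_eqI) simp
    then have "norm (g x u t) \<le> C" by (rule bspec[OF C])
    then show "norm (g x u t) \<le> max 0 C" by linarith
  qed simp
qed

lemma jointly_continuous_uniform:
  fixes g :: "'a::euclidean_space \<Rightarrow> 'b::euclidean_space \<Rightarrow> real \<Rightarrow> 'c::euclidean_space"
  assumes g: "jointly_continuous T g" and "0 < \<epsilon>"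
  obtains \<delta> where "0 < \<delta>"
    "\<And>x x' u u' t. \<lbrakk>norm x \<le> R; norm x' \<le> R; norm u \<le> W; norm u' \<le> W; norm (x - x') < \<delta>; norm (u - u') < \<delta>; t \<in> {0..T}\<rbrakk>
       \<Longrightarrow> norm (g x u t - g x' u' t) < \<epsilon>"
proof -
  let ?K = "cball (0::'a) R \<times> cball (0::'b) W \<times> {0..T}"
  have "uniformly_continuous_on ?K (\<lambda>(x, u, t). g x u t)"
    by (rule compact_uniformly_continuous[OF continuous_on_subset[OF g[unfolded jointly_continuous_def]]])
      (auto intro!: compact_Times)
  then obtain \<delta> where \<delta>: "0 < \<delta>" "\<forall>z\<in>?K. \<forall>z'\<in>?K. dist z' z < \<delta> \<longrightarrow> dist ((\<lambda>(x, u, t). g x u t) z') ((\<lambda>(x, u, t). g x u t) z) < \<epsilon>"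
    using \<open>0 < \<epsilon>\<close> unfolding uniformly_continuous_on_def by meson
  \<comment> \<open>The product metric is at most the sum of the component distances, so half of
    \<delta> is allotted to each of the two components.\<close>
  show thesis
  proof (rule that[of "\<delta> / 2"])
    fix x x' :: 'a and u u' :: 'b and t
    assume a: "norm x \<le> R" "norm x' \<le> R" "norm u \<le> W" "norm u' \<le> W"
      "norm (x - x') < \<delta> / 2" "norm (u - u') < \<delta> / 2" "t \<in> {0..T}"
    have "dist (x, u, t) (x', u', t) = sqrt ((dist x x')\<^sup>2 + (dist u u')\<^sup>2)"
      by (simp add: dist_prod_def)
    also have "\<dots> \<le> dist x x' + dist u u'" by (rule sqrt_sum_squares_le_sum) auto
    also have "\<dots> < \<delta>" using a by (simp add: dist_norm)
    finally have "dist (x, u, t) (x', u', t) < \<delta>" .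
    moreover have "(x, u, t) \<in> ?K" "(x', u', t) \<in> ?K" using a by auto
    ultimately have "dist ((\<lambda>(x, u, t). g x u t) (x, u, t)) ((\<lambda>(x, u, t). g x u t) (x', u', t)) < \<epsilon>"
      using \<delta>(2) by blast
    then show "norm (g x u t - g x' u' t) < \<epsilon>" by (simp add: dist_norm)
  qed (use \<delta>(1) in simp)
qed

lemma jointly_continuous_tendsto:
  assumes g: "jointly_continuous T g" and "t \<in> {0..T}" "X \<longlonglongrightarrow> x" "U \<longlonglongrightarrow> u"
  shows "(\<lambda>n. g (X n) (U n) t) \<longlonglongrightarrow> g x u t"
proof -
  have "(\<lambda>n. (\<lambda>(x, u, t). g x u t) (X n, U n, t)) \<longlonglongrightarrow> (\<lambda>(x, u, t). g x u t) (x, u, t)"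
    by (rule continuous_on_tendsto_compose[OF g[unfolded jointly_continuous_def]])
      (use assms in \<open>auto intro!: tendsto_Pair\<close>)
  then show ?thesis by simp
qed

section \<open>Gradients, Jacobians and mean value estimates\<close>

lemma norm_matrix_vector_mult_le:
  fixes M :: "real^'n^'m"
  shows "norm (M *v x) \<le> norm M * norm x"
proof -
  have "norm (M *v x) = L2_set (\<lambda>i. \<bar>M $ i \<bullet> x\<bar>) UNIV"
    by (simp add: norm_vec_def matrix_vector_mult_def inner_vec_def)
  also have "\<dots> \<le> L2_set (\<lambda>i. norm (M $ i) * norm x) UNIV"
    by (intro L2_set_mono Cauchy_Schwarz_ineq2) auto
  also have "\<dots> = norm M * norm x"
    by (simp add: norm_vec_def[of M] L2_set_left_distrib)
  finally show ?thesis .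
qed

text \<open>As \<open>grad\<close> is a definite description, both existence and uniqueness are at
  stake. The gradient is the Riesz representative of the derivative, written as its adjoint applied
  to 1.\<close>

lemma GDERIV_grad:
  fixes F :: "'a::euclidean_space \<Rightarrow> real"
  assumes "F differentiable (at x)"
  shows "GDERIV F x :> grad F x"
proof -
  obtain D where D: "(F has_derivative D) (at x)" using assms unfolding differentiable_def by blast
  then have lin: "linear D" by (rule has_derivative_linear)
  have "GDERIV F x :> adjoint D 1"
    using D by (simp add: gderiv_def adjoint_works[OF lin])
  moreover have "d = adjoint D 1" if "GDERIV F x :> d" for d
  proof -
    have "(\<lambda>h. h \<bullet> d) = D" using that D unfolding gderiv_def by (rule has_derivative_unique)
    then have "h \<bullet> d = h \<bullet> adjoint D 1" for h by (simp add: adjoint_works[OF lin] fun_eq_iff)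
    then show ?thesis by (intro vector_eq_rdot[THEN iffD1]) (simp add: inner_commute)
  qed
  ultimately show ?thesis unfolding grad_def by (rule theI)
qed

lemma jac_has_derivative:
  fixes f :: "real^'d \<Rightarrow> real^'m \<Rightarrow> real \<Rightarrow> real^'k"
  assumes "differentiable_in_x_u T f" "t \<in> {0..T}"
  shows "((\<lambda>y. f y u t) has_derivative (\<lambda>h. jac_x f x u t *v h)) (at x)"
    "((\<lambda>v. f x v t) has_derivative (\<lambda>h. jac_u f x u t *v h)) (at u)"
  using assms unfolding differentiable_in_x_u_def jac_x_def jac_u_def by (simp_all flip: jacobian_works)

lemma grad_has_derivative:
  fixes f :: "'a::euclidean_space \<Rightarrow> 'b::euclidean_space \<Rightarrow> real \<Rightarrow> real"
  assumes "differentiable_in_x_u T f" "t \<in> {0..T}"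
  shows "((\<lambda>y. f y u t) has_derivative (\<lambda>h. h \<bullet> grad_x f x u t)) (at x)"
    "((\<lambda>v. f x v t) has_derivative (\<lambda>h. h \<bullet> grad_u f x u t)) (at u)"
proof -
  have d: "(\<lambda>y. f y u t) differentiable (at x)" "(\<lambda>v. f x v t) differentiable (at u)"
    using assms unfolding differentiable_in_x_u_def by auto
  show "((\<lambda>y. f y u t) has_derivative (\<lambda>h. h \<bullet> grad_x f x u t)) (at x)"
    using GDERIV_grad[OF d(1)] by (simp only: gderiv_def grad_x_def)
  show "((\<lambda>v. f x v t) has_derivative (\<lambda>h. h \<bullet> grad_u f x u t)) (at u)"
    using GDERIV_grad[OF d(2)] by (simp only: gderiv_def grad_u_def)
qed

text \<open>Only partial derivatives are available, so the path from (x, u) to (x', u') runs through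
  the corner (x', u), changing first the state and then the control. A product of convex sets
  contains this path.\<close>

lemma partial_mean_value:
  fixes g :: "'a::euclidean_space \<Rightarrow> 'b::euclidean_space \<Rightarrow> 'c::real_normed_vector"
  assumes "convex P" "convex Q"
    and "\<And>x u. \<lbrakk>x \<in> P; u \<in> Q\<rbrakk> \<Longrightarrow> ((\<lambda>y. g y u) has_derivative gx x u) (at x)"
    and "\<And>x u. \<lbrakk>x \<in> P; u \<in> Q\<rbrakk> \<Longrightarrow> ((\<lambda>v. g x v) has_derivative gu x u) (at u)"
    and "\<And>x u h. \<lbrakk>x \<in> P; u \<in> Q\<rbrakk> \<Longrightarrow> norm (gx x u h) \<le> \<alpha> * norm h"
    and "\<And>x u h. \<lbrakk>x \<in> P; u \<in> Q\<rbrakk> \<Longrightarrow> norm (gu x u h) \<le> \<beta> * norm h"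
    and "x \<in> P" "x' \<in> P" "u \<in> Q" "u' \<in> Q"
  shows "norm (g x u - g x' u') \<le> \<alpha> * norm (x - x') + \<beta> * norm (u - u')"
proof -
  have "norm (g x u - g x' u) \<le> \<alpha> * norm (x - x')"
  proof (rule differentiable_bound[OF assms(1), of "\<lambda>x. g x u" "\<lambda>x. gx x u"])
    fix y assume "y \<in> P"
    then show "((\<lambda>x. g x u) has_derivative gx y u) (at y within P)"
      by (rule has_derivative_at_withinI[OF assms(3)[OF _ assms(9)]])
    show "onorm (gx y u) \<le> \<alpha>"
      by (rule onorm_le) (rule assms(5)[OF \<open>y \<in> P\<close> assms(9)])
  qed (rule assms(7) assms(8))+
  moreover have "norm (g x' u - g x' u') \<le> \<beta> * norm (u - u')"
  proof (rule differentiable_bound[OF assms(2), of "\<lambda>u. g x' u" "\<lambda>u. gu x' u"])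
    fix v assume "v \<in> Q"
    then show "((\<lambda>u. g x' u) has_derivative gu x' v) (at v within Q)"
      by (rule has_derivative_at_withinI[OF assms(4)[OF assms(8)]])
    show "onorm (gu x' v) \<le> \<beta>"
      by (rule onorm_le) (rule assms(6)[OF assms(8) \<open>v \<in> Q\<close>])
  qed (rule assms(9) assms(10))+
  ultimately show ?thesis
    using norm_triangle_ineq[of "g x u - g x' u" "g x' u - g x' u'"] by simp
qed

text \<open>The mean value estimate is applied to \<open>f\<close> minus the linear maps, so its
  Lipschitz constants measure only the deviation of the Jacobians from \<open>A\<close> and
  \<open>B\<close>.\<close>

lemma mean_value_jac:
  fixes f :: "real^'d \<Rightarrow> real^'m \<Rightarrow> real \<Rightarrow> real^'k" and A :: "real^'d^'k" and B :: "real^'m^'k"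
  assumes "differentiable_in_x_u T f" "t \<in> {0..T}" "convex P" "convex Q"
    and "\<And>x u. \<lbrakk>x \<in> P; u \<in> Q\<rbrakk> \<Longrightarrow> norm (jac_x f x u t - A) \<le> \<alpha>"
    and "\<And>x u. \<lbrakk>x \<in> P; u \<in> Q\<rbrakk> \<Longrightarrow> norm (jac_u f x u t - B) \<le> \<beta>"
    and "x \<in> P" "x' \<in> P" "u \<in> Q" "u' \<in> Q"
  shows "norm (f x u t - f x' u' t - A *v (x - x') - B *v (u - u')) \<le> \<alpha> * norm (x - x') + \<beta> * norm (u - u')"
proof -
  define g where "g x u = f x u t - A *v x - B *v u" for x u
  have "norm (g x u - g x' u') \<le> \<alpha> * norm (x - x') + \<beta> * norm (u - u')"
  proof (rule partial_mean_value[OF assms(3,4)])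
    fix x u h assume xu: "x \<in> P" "u \<in> Q"
    show "((\<lambda>y. g y u) has_derivative (\<lambda>h. (jac_x f x u t - A) *v h)) (at x)"
      unfolding g_def
      by (auto intro!: derivative_eq_intros jac_has_derivative[OF assms(1,2)] bounded_linear.has_derivative[OF matrix_vector_mul_bounded_linear]
          simp: matrix_vector_mult_diff_rdistrib)
    show "((\<lambda>v. g x v) has_derivative (\<lambda>h. (jac_u f x u t - B) *v h)) (at u)"
      unfolding g_def
      by (auto intro!: derivative_eq_intros jac_has_derivative[OF assms(1,2)] bounded_linear.has_derivative[OF matrix_vector_mul_bounded_linear]
          simp: matrix_vector_mult_diff_rdistrib)
    have "norm ((jac_x f x u t - A) *v h) \<le> norm (jac_x f x u t - A) * norm h" for h
      by (rule norm_matrix_vector_mult_le)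
    also have "norm (jac_x f x u t - A) * norm h \<le> \<alpha> * norm h" for h :: "real^'d"
      using assms(5)[OF xu] by (intro mult_right_mono) auto
    finally show "norm ((jac_x f x u t - A) *v h) \<le> \<alpha> * norm h" for h .
    have "norm ((jac_u f x u t - B) *v h) \<le> norm (jac_u f x u t - B) * norm h" for h
      by (rule norm_matrix_vector_mult_le)
    also have "norm (jac_u f x u t - B) * norm h \<le> \<beta> * norm h" for h :: "real^'m"
      using assms(6)[OF xu] by (intro mult_right_mono) auto
    finally show "norm ((jac_u f x u t - B) *v h) \<le> \<beta> * norm h" for h .
  qed (use assms in auto)
  then show ?thesis by (simp add: g_def matrix_vector_mult_diff_distrib algebra_simps)
qed

lemma mean_value_grad:
  fixes f :: "'a::euclidean_space \<Rightarrow> 'b::euclidean_space \<Rightarrow> real \<Rightarrow> real"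
  assumes "differentiable_in_x_u T f" "t \<in> {0..T}" "convex P" "convex Q"
    and "\<And>x u. \<lbrakk>x \<in> P; u \<in> Q\<rbrakk> \<Longrightarrow> norm (grad_x f x u t) \<le> \<alpha>"
    and "\<And>x u. \<lbrakk>x \<in> P; u \<in> Q\<rbrakk> \<Longrightarrow> norm (grad_u f x u t) \<le> \<beta>"
    and "x \<in> P" "x' \<in> P" "u \<in> Q" "u' \<in> Q"
  shows "\<bar>f x u t - f x' u' t\<bar> \<le> \<alpha> * norm (x - x') + \<beta> * norm (u - u')"
proof -
  have "norm (f x u t - f x' u' t) \<le> \<alpha> * norm (x - x') + \<beta> * norm (u - u')"
  proof (rule partial_mean_value[OF assms(3,4) grad_has_derivative(1)[OF assms(1,2)] grad_has_derivative(2)[OF assms(1,2)]])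
    fix x u h assume xu: "x \<in> P" "u \<in> Q"
    have "norm (h \<bullet> grad_x f x u t) \<le> norm h * norm (grad_x f x u t)" by (simp add: Cauchy_Schwarz_ineq2)
    also have "\<dots> \<le> norm h * \<alpha>" using assms(5)[OF xu] by (intro mult_left_mono) auto
    finally show "norm (h \<bullet> grad_x f x u t) \<le> \<alpha> * norm h" by (simp add: mult.commute)
  next
    fix x u h assume xu: "x \<in> P" "u \<in> Q"
    have "norm (h \<bullet> grad_u f x u t) \<le> norm h * norm (grad_u f x u t)" by (simp add: Cauchy_Schwarz_ineq2)
    also have "\<dots> \<le> norm h * \<beta>" using assms(6)[OF xu] by (intro mult_left_mono) auto
    finally show "norm (h \<bullet> grad_u f x u t) \<le> \<beta> * norm h" by (simp add: mult.commute)
  qed (use assms in auto)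
  then show ?thesis by simp
qed



section \<open>Dominating functions from growth conditions\<close>

text \<open>The weight \<open>V\<close> is \<open>1\<close>, or the size of a control direction multiplied by a derivative with respect to the control.\<close>

definition majorized :: "ennreal \<Rightarrow> real \<Rightarrow> real \<Rightarrow> (real \<Rightarrow> real) \<Rightarrow> (real \<Rightarrow> real) \<Rightarrow>
    ('a::real_normed_vector \<Rightarrow> 'b::real_normed_vector \<Rightarrow> real \<Rightarrow> 'c::real_normed_vector) \<Rightarrow> bool" where
  "majorized r T R W V g \<longleftrightarrow> (\<exists>\<Phi>\<in>Lp r T. AE t in leb T.
     \<forall>x u. norm x \<le> R \<longrightarrow> norm u \<le> W t \<longrightarrow> norm (g x u t) * V t \<le> \<Phi> t)"

lemma AE_lebesgue_on_I: "(\<And>t. t \<in> S \<Longrightarrow> P t) \<Longrightarrow> AE t in lebesgue_on S. P t"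
  by (rule AE_I2) simp

lemma majorized_of_bounded:
  assumes V: "V \<in> Lp r T" "\<And>t. 0 \<le> V t"
    and C: "AE t in leb T. \<forall>x u. norm x \<le> R \<longrightarrow> norm u \<le> W t \<longrightarrow> norm (g x u t) \<le> C"
  shows "majorized r T R W V g"
  unfolding majorized_def
proof
  show "(\<lambda>t. C * V t) \<in> Lp r T" by (rule Lp_scale[OF V(1)])
  show "AE t in leb T. \<forall>x u. norm x \<le> R \<longrightarrow> norm u \<le> W t \<longrightarrow> norm (g x u t) * V t \<le> C * V t"
    using C by eventually_elim (auto intro: mult_right_mono V(2))
qed

text \<open>The arguments stay in a compact set for almost every time, so continuity does the work
  of a growth condition.\<close>

lemma majorized_of_essentially_bounded_control:
  fixes g :: "'a::euclidean_space \<Rightarrow> 'b::euclidean_space \<Rightarrow> real \<Rightarrow> 'c::euclidean_space"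
  assumes g: "jointly_continuous T g" and W: "W \<in> Lp \<infinity> T" and V: "V \<in> Lp r T" "\<And>t. 0 \<le> V t"
  shows "majorized r T R W V g"
proof -
  obtain D where D: "AE t in leb T. norm (W t) \<le> D" by (rule Lp_infinityE[OF refl W])
  obtain C where C: "\<And>x u t. \<lbrakk>norm x \<le> R; norm u \<le> D; t \<in> {0..T}\<rbrakk> \<Longrightarrow> norm (g x u t) \<le> C"
    by (rule jointly_continuous_bounded[OF g, of R D]) blast
  have "AE t in leb T. t \<in> {0..T}" by (rule AE_lebesgue_on_I)
  with D have "AE t in leb T. \<forall>x u. norm x \<le> R \<longrightarrow> norm u \<le> W t \<longrightarrow> norm (g x u t) \<le> C"
  proof eventually_elim
    case (elim t)
    show ?case
    proof (intro allI impI)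
      fix x :: 'a and u :: 'b assume "norm x \<le> R" "norm u \<le> W t"
      then show "norm (g x u t) \<le> C" using elim by (intro C) auto
    qed
  qed
  then show ?thesis by (rule majorized_of_bounded[OF V])
qed

lemma Lp_infinity_subset:
  assumes "V \<in> Lp \<infinity> T"
  shows "(\<lambda>t. V t :: real) \<in> Lp r T"
proof -
  obtain D where D: "AE t in leb T. norm (V t) \<le> D" by (rule Lp_infinityE[OF refl assms])
  show ?thesis by (rule Lp_dominated[OF Lp_const Lp_measurable[OF assms] D])
qed

lemma Lp_powr:
  fixes W :: "real \<Rightarrow> real"
  assumes W: "W \<in> Lp q T" and "q \<noteq> \<infinity>" "r \<noteq> \<infinity>" "enn2real q = k * enn2real r"
  shows "(\<lambda>t. \<bar>W t\<bar> powr k) \<in> Lp r T"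
proof -
  have [measurable]: "W \<in> borel_measurable (leb T)" by (rule Lp_measurable[OF W])
  have "integrable (leb T) (\<lambda>t. norm (W t) powr enn2real q)"
    using W by (simp only: Lp_finite_iff[OF assms(2)])
  then have "integrable (leb T) (\<lambda>t. norm (\<bar>W t\<bar> powr k) powr enn2real r)"
    by (simp add: powr_powr assms(4))
  moreover have "(\<lambda>t. \<bar>W t\<bar> powr k) \<in> borel_measurable (leb T)" by measurable
  ultimately show ?thesis unfolding Lp_finite_iff[OF assms(3)] by blast
qed

text \<open>The relation q = l r is what puts the l-th power of the control bound \<open>W\<close>
  into L^r.\<close>

lemma majorized_of_growth:
  fixes g :: "real^'d \<Rightarrow> real^'m \<Rightarrow> real \<Rightarrow> 'c::euclidean_space"
  assumes g: "growth_condition T l r g" and "q \<noteq> \<infinity>" "r \<noteq> \<infinity>" "0 < l" "enn2real q = l * enn2real r"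
    and W: "W \<in> Lp q T" and "0 < R"
  shows "majorized r T R W (\<lambda>t. 1) g"
proof -
  obtain C \<omega> where "C > 0" and \<omega>: "\<omega> \<in> Lp r T"
    "AE t in leb T. \<forall>x u. norm x \<le> R \<longrightarrow> norm (g x u t) \<le> C * (if l = 0 then 1 else norm u powr l) + \<omega> t"
    using g[unfolded growth_condition_def, THEN spec, THEN mp, OF \<open>0 < R\<close>] by blast
  show ?thesis unfolding majorized_def
  proof
    show "(\<lambda>t. C * \<bar>W t\<bar> powr l + \<omega> t) \<in> Lp r T"
      by (intro Lp_add Lp_scale \<omega>(1) Lp_powr[OF W assms(2,3,5)])
    show "AE t in leb T. \<forall>x u. norm x \<le> R \<longrightarrow> norm u \<le> W t \<longrightarrow> norm (g x u t) * 1 \<le> C * \<bar>W t\<bar> powr l + \<omega> t"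
      using \<omega>(2)
    proof eventually_elim
      case (elim t)
      show ?case
      proof (intro allI impI)
        fix x :: "real^'d" and u :: "real^'m" assume xu: "norm x \<le> R" "norm u \<le> W t"
        have "norm u powr l \<le> \<bar>W t\<bar> powr l" using xu(2) \<open>0 < l\<close> by (intro powr_mono2) auto
        then have "C * norm u powr l \<le> C * \<bar>W t\<bar> powr l" using \<open>C > 0\<close> by simp
        moreover have "norm (g x u t) \<le> C * norm u powr l + \<omega> t" using elim xu(1) \<open>0 < l\<close> by auto
        ultimately show "norm (g x u t) * 1 \<le> C * \<bar>W t\<bar> powr l + \<omega> t" by linarith
      qed
    qed
  qed
qed

text \<open>Both \<open>a\<close> and \<open>v\<close> are at most w + v; this coarse bound merges
  the product into one power of a function from L^q.\<close>

lemma powr_mult_le_of_sum: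
  fixes a b w v :: real
  assumes "0 \<le> a" "a \<le> w" "0 \<le> v" "0 \<le> l"
  shows "a powr l * v \<le> (w + v) powr (l + 1)"
proof -
  have "a powr l * v \<le> (w + v) powr l * (w + v)"
    using assms by (intro mult_mono powr_mono2) auto
  also have "\<dots> = (w + v) powr (l + 1)"
    using assms by (cases "w + v = 0") (auto simp: powr_add)
  finally show ?thesis .
qed

text \<open>The order l = q/s satisfies l + 1 = q/r, so |u|^l V is at most the power q/r of W + V,
  which lies in L^r. The product \<omega> V is split by Young's inequality with the exponents s/r
  and q/r, conjugate because 1/r = 1/s + 1/q. For r = 1 the exponent s is conjugate to q, which is
  the case of the cost.\<close>

lemma majorized_of_growth_mult:
  fixes q r :: ennreal and g :: "real^'d \<Rightarrow> real^'m \<Rightarrow> real \<Rightarrow> 'c::euclidean_space"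
  assumes g: "growth_condition T (enn2real q / enn2real s) s g" and s: "s = q * r / (q - r)"
    and "q \<noteq> \<infinity>" "1 \<le> r" "r < q"
    and W: "W \<in> Lp q T" and V: "V \<in> Lp q T" "\<And>t. 0 \<le> V t" and "0 < R"
  shows "majorized r T R W V g"
proof -
  define a where "a = enn2real q"
  define b where "b = enn2real r"
  have q: "q = ennreal a" using \<open>q \<noteq> \<infinity>\<close> by (simp add: a_def less_top)
  have "r \<noteq> \<infinity>" using \<open>r < q\<close> by auto
  then have r: "r = ennreal b" by (simp add: b_def less_top)
  have b: "1 \<le> b" unfolding b_def by (rule exponent_ge_1[OF \<open>1 \<le> r\<close> \<open>r \<noteq> \<infinity>\<close>])
  have ab: "b < a" using \<open>r < q\<close> b unfolding q r by (simp add: ennreal_less_iff)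
  have s': "s = ennreal (a * b / (a - b))"
    using b ab unfolding s q r by (simp add: ennreal_minus divide_ennreal flip: ennreal_mult)
  then have sr: "enn2real s = a * b / (a - b)" and "s \<noteq> \<infinity>" using b ab by auto
  define l where "l = (a - b) / b"
  have l: "l = enn2real q / enn2real s" "0 < l" using b ab by (auto simp: l_def sr field_simps simp flip: a_def)
  obtain C \<omega> where "C > 0" and \<omega>: "\<omega> \<in> Lp s T"
    "AE t in leb T. \<forall>x u. norm x \<le> R \<longrightarrow> norm (g x u t) \<le> C * (if l = 0 then 1 else norm u powr l) + \<omega> t"
    using g[folded l(1), unfolded growth_condition_def, THEN spec, THEN mp, OF \<open>0 < R\<close>] by blast
  define P where "P = a / (a - b)"
  define Q where "Q = a / b"
  have PQ: "1 < P" "1 < Q" "1 / P + 1 / Q = 1" using b ab by (auto simp: P_def Q_def field_simps)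
  have lQ: "l + 1 = Q" using b by (simp add: l_def Q_def field_simps)
  have "(\<lambda>t. \<bar>\<omega> t\<bar> powr P) \<in> Lp r T"
    by (rule Lp_powr[OF \<omega>(1) \<open>s \<noteq> \<infinity>\<close> \<open>r \<noteq> \<infinity>\<close>]) (simp add: sr P_def flip: b_def)
  moreover have VQ: "(\<lambda>t. \<bar>V t\<bar> powr Q) \<in> Lp r T"
    by (rule Lp_powr[OF V(1) \<open>q \<noteq> \<infinity>\<close> \<open>r \<noteq> \<infinity>\<close>]) (use b in \<open>simp add: Q_def flip: b_def a_def\<close>)
  moreover have "(\<lambda>t. \<bar>W t + V t\<bar> powr Q) \<in> Lp r T"
    by (rule Lp_powr[OF Lp_add[OF W V(1)] \<open>q \<noteq> \<infinity>\<close> \<open>r \<noteq> \<infinity>\<close>]) (use b in \<open>simp add: Q_def flip: b_def a_def\<close>)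
  ultimately have "(\<lambda>t. C * \<bar>W t + V t\<bar> powr Q + (\<bar>\<omega> t\<bar> powr P + \<bar>V t\<bar> powr Q)) \<in> Lp r T"
    by (intro Lp_add Lp_scale)
  moreover have "AE t in leb T. \<forall>x u. norm x \<le> R \<longrightarrow> norm u \<le> W t \<longrightarrow>
      norm (g x u t) * V t \<le> C * \<bar>W t + V t\<bar> powr Q + (\<bar>\<omega> t\<bar> powr P + \<bar>V t\<bar> powr Q)"
    using \<omega>(2)
  proof eventually_elim
    case (elim t)
    show ?case
    proof (intro allI impI)
      fix x :: "real^'d" and u :: "real^'m" assume xu: "norm x \<le> R" "norm u \<le> W t"
      have "norm (g x u t) \<le> C * norm u powr l + \<omega> t" using elim xu(1) l(2) by auto
      then have "norm (g x u t) \<le> C * norm u powr l + \<bar>\<omega> t\<bar>" by linarith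
      then have "norm (g x u t) * V t \<le> (C * norm u powr l + \<bar>\<omega> t\<bar>) * V t" by (intro mult_right_mono V(2))
      also have "\<dots> = C * (norm u powr l * V t) + \<bar>\<omega> t\<bar> * V t" by (simp add: algebra_simps)
      also have "norm u powr l * V t \<le> (W t + V t) powr (l + 1)"
        using xu(2) V(2) l(2) by (intro powr_mult_le_of_sum) auto
      also have "(W t + V t) powr (l + 1) \<le> \<bar>W t + V t\<bar> powr Q" unfolding lQ
        using order_trans[OF norm_ge_zero xu(2)] V(2)[of t] by (simp add: abs_of_nonneg)
      also have "\<bar>\<omega> t\<bar> * V t \<le> \<bar>\<omega> t\<bar> powr P + \<bar>V t\<bar> powr Q"
      proof -
        have "\<bar>\<omega> t\<bar> * V t \<le> \<bar>\<omega> t\<bar> powr P / P + V t powr Q / Q"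
          using PQ V(2) by (intro Youngs_inequality) auto
        also have "\<dots> \<le> \<bar>\<omega> t\<bar> powr P + V t powr Q"
          using PQ mult_right_mono[of 1 P "\<bar>\<omega> t\<bar> powr P"] mult_right_mono[of 1 Q "V t powr Q"]
          by (intro add_mono) (simp_all add: divide_le_eq mult.commute)
        finally show ?thesis using V(2) by simp
      qed
      finally show "norm (g x u t) * V t \<le> C * \<bar>W t + V t\<bar> powr Q + (\<bar>\<omega> t\<bar> powr P + \<bar>V t\<bar> powr Q)"
        using \<open>C > 0\<close> by simp
    qed
  qed
  ultimately show ?thesis unfolding majorized_def by (intro bexI)
qed

text \<open>Completeness of Lebesgue measure. It makes the time derivative of a trajectory
  measurable, which is identified only almost everywhere, through the differential equation.\<close>

lemma borel_measurable_lebesgue_on_AE: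
  fixes f g :: "'a::euclidean_space \<Rightarrow> 'b::euclidean_space"
  assumes f: "f \<in> borel_measurable (lebesgue_on S)" and S: "S \<in> sets lebesgue"
    and eq: "AE t in lebesgue_on S. g t = f t"
  shows "g \<in> borel_measurable (lebesgue_on S)"
proof -
  have "AE t in lebesgue. t \<in> S \<longrightarrow> g t = f t" using eq S by (simp add: AE_restrict_space_iff)
  then have ae: "AE t in lebesgue. (if t \<in> S then f t else 0) = (if t \<in> S then g t else 0)"
  proof eventually_elim
    case (elim t)
    then show ?case by simp
  qed
  show ?thesis
    by (rule borel_measurable_if[OF S, THEN iffD1, OF borel_measurable_AE[OF borel_measurable_if[OF S, THEN iffD2, OF f] ae]])
qed

lemma Lp_cong_AE:
  assumes u: "u \<in> Lp q T" and eq: "AE t in leb T. v t = u t"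
  shows "v \<in> Lp q T"
proof (rule Lp_dominated[OF Lp_norm_fun[OF u]])
  show "v \<in> borel_measurable (leb T)"
    by (rule borel_measurable_lebesgue_on_AE[OF Lp_measurable[OF u] _ eq]) simp
  show "AE t in leb T. norm (v t) \<le> norm (u t)"
    using eq by eventually_elim simp
qed

lemma Lp_norm_cong_AE:
  assumes u: "u \<in> borel_measurable (leb T)" and eq: "AE t in leb T. v t = u t"
  shows "Lp_norm q T v = Lp_norm q T u"
proof -
  have v: "v \<in> borel_measurable (leb T)"
    by (rule borel_measurable_lebesgue_on_AE[OF u _ eq]) simp
  have n: "AE t in leb T. ennreal (norm (v t)) = ennreal (norm (u t))"
    using eq by eventually_elim simp
  have r: "AE t in leb T. norm (v t) powr enn2real q = norm (u t) powr enn2real q"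
    using eq by eventually_elim simp
  have "esssup (leb T) (\<lambda>t. ennreal (norm (v t))) = esssup (leb T) (\<lambda>t. ennreal (norm (u t)))"
    using u v by (intro esssup_AE_cong n) auto
  moreover have "(LINT t|leb T. norm (v t) powr enn2real q) = (LINT t|leb T. norm (u t) powr enn2real q)"
    using u v by (intro integral_cong_AE r) auto
  ultimately show ?thesis by (simp add: Lp_norm_def)
qed

lemma Lp_diff:
  fixes u v :: "real \<Rightarrow> 'a::euclidean_space"
  assumes "u \<in> Lp q T" "v \<in> Lp q T"
  shows "(\<lambda>t. u t - v t) \<in> Lp q T"
proof (rule Lp_dominated[OF Lp_add[OF Lp_norm_fun[OF assms(1)] Lp_norm_fun[OF assms(2)]]])
  show "(\<lambda>t. u t - v t) \<in> borel_measurable (leb T)"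
    using Lp_measurable[OF assms(1)] Lp_measurable[OF assms(2)] by measurable
  show "AE t in leb T. norm (u t - v t) \<le> norm (u t) + norm (v t)"
    by (intro AE_I2 norm_triangle_ineq4)
qed

lemma continuous_on_Icc_measurable:
  fixes x :: "real \<Rightarrow> 'a::euclidean_space"
  shows "continuous_on {0..T} x \<Longrightarrow> x \<in> borel_measurable (leb T)"
  by (rule continuous_imp_measurable_on_sets_lebesgue) auto

lemma continuous_on_Icc_bounded:
  fixes x :: "real \<Rightarrow> 'a::euclidean_space"
  assumes "continuous_on {0..T} x"
  obtains R where "0 < R" "\<And>t. t \<in> {0..T} \<Longrightarrow> norm (x t) \<le> R"
proof -
  have "bounded (x ` {0..T})"
    by (rule compact_imp_bounded[OF compact_continuous_image[OF assms compact_Icc]])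
  then obtain R where "0 < R" "\<forall>z\<in>x ` {0..T}. norm z \<le> R" unfolding bounded_pos by (elim exE conjE)
  then show thesis by (intro that) auto
qed

lemma satisfies_ode_diff:
  assumes "satisfies_ode T x g" "satisfies_ode T y h"
  shows "satisfies_ode T (\<lambda>t. x t - y t) (\<lambda>t. g t - h t)"
  using assms unfolding satisfies_ode_def
proof eventually_elim
  case (elim t)
  then show ?case by (rule has_vector_derivative_diff)
qed

lemma borel_measurable_matrix_vector_mult:
  fixes M :: "'z \<Rightarrow> real^'n^'k"
  assumes "M \<in> borel_measurable N" "v \<in> borel_measurable N"
  shows "(\<lambda>t. M t *v v t) \<in> borel_measurable N"
proof (rule borel_measurable_continuous_Pair[OF assms])
  show "continuous_on UNIV (\<lambda>z :: (real^'n^'k) \<times> (real^'n). fst z *v snd z)"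
    unfolding matrix_vector_mult_def by (intro continuous_intros)
qed

section \<open>Trajectories of the control system\<close>

locale control_problem =
  fixes p q :: ennreal and T :: real
    and \<theta> :: "real^'d \<Rightarrow> real^'m \<Rightarrow> real \<Rightarrow> real"
    and f :: "real^'d \<Rightarrow> real^'m \<Rightarrow> real \<Rightarrow> real^'d"
  assumes p1: "1 \<le> p" and pq: "p \<le> q" and T: "0 < T"
    and cont: "jointly_continuous T \<theta>" "jointly_continuous T f"
    and diff: "differentiable_in_x_u T \<theta>" "differentiable_in_x_u T f"
    and cont_deriv: "jointly_continuous T (grad_x \<theta>)" "jointly_continuous T (grad_u \<theta>)"
      "jointly_continuous T (jac_x f)" "jointly_continuous T (jac_u f)"
    and growth: "q = \<infinity> \<or>
      (growth_condition T (enn2real q) 1 \<theta> \<and>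
       growth_condition T (enn2real q) 1 (grad_x \<theta>) \<and>
       growth_condition T (enn2real q - 1) (conj_exponent q) (grad_u \<theta>) \<and>
       growth_condition T (enn2real q / enn2real p) p f \<and>
       growth_condition T (enn2real q / enn2real p) p (jac_x f) \<and>
       (q > p \<longrightarrow> (\<forall>s. s = q * p / (q - p) \<longrightarrow>
          growth_condition T (enn2real q / enn2real s) s (jac_u f))) \<and>
       (q = p \<longrightarrow> (\<forall>x u v. \<forall>t\<in>{0..T}. jac_u f x u t = jac_u f x v t)))"
begin

lemma q1: "1 \<le> q"
  using p1 pq by (rule order_trans)

text \<open>The growth conditions are exploited here once and for all; later arguments see only the
  dominating functions, and no longer distinguish the cases of the assumption.\<close>

lemma majorized:
  assumes "0 < R" and W: "W \<in> Lp q T" and V: "V \<in> Lp q T" "\<And>t. 0 \<le> V t"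
  shows "majorized p T R W (\<lambda>t. 1) f" "majorized p T R W (\<lambda>t. 1) (jac_x f)" "majorized p T R W V (jac_u f)"
    "majorized 1 T R W (\<lambda>t. 1) \<theta>" "majorized 1 T R W (\<lambda>t. 1) (grad_x \<theta>)" "majorized 1 T R W V (grad_u \<theta>)"
proof -
  have "majorized p T R W (\<lambda>t. 1) f \<and> majorized p T R W (\<lambda>t. 1) (jac_x f) \<and> majorized p T R W V (jac_u f) \<and>
    majorized 1 T R W (\<lambda>t. 1) \<theta> \<and> majorized 1 T R W (\<lambda>t. 1) (grad_x \<theta>) \<and> majorized 1 T R W V (grad_u \<theta>)"
  proof (cases "q = \<infinity>")
    case True
    have W': "W \<in> Lp \<infinity> T" and V': "V \<in> Lp r T" for r
      using W V(1) Lp_infinity_subset[of V T r] unfolding True by auto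
    show ?thesis
      by (intro conjI majorized_of_essentially_bounded_control cont cont_deriv W' V' V(2) Lp_const) auto
  next
    case False
    then have gr: "growth_condition T (enn2real q) 1 \<theta>" "growth_condition T (enn2real q) 1 (grad_x \<theta>)"
       "growth_condition T (enn2real q - 1) (conj_exponent q) (grad_u \<theta>)"
       "growth_condition T (enn2real q / enn2real p) p f"
       "growth_condition T (enn2real q / enn2real p) p (jac_x f)"
       "q > p \<Longrightarrow> growth_condition T (enn2real q / enn2real (q * p / (q - p))) (q * p / (q - p)) (jac_u f)"
       "\<And>x u v t. \<lbrakk>q = p; t \<in> {0..T}\<rbrakk> \<Longrightarrow> jac_u f x u t = jac_u f x v t"
      using growth by auto
    have p: "p \<noteq> \<infinity>" using False pq by (auto simp: top_unique)
    have q: "1 \<le> enn2real q" and p': "1 \<le> enn2real p"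
      using exponent_ge_1[OF q1 False] exponent_ge_1[OF p1 p] by auto
    have ratio: "0 < enn2real q / enn2real p" "enn2real q = enn2real q / enn2real p * enn2real p" using q p' by auto
    have jac: "majorized p T R W V (jac_u f)"
    proof (cases "q = p")
      case True
      \<comment> \<open>For q = p the Jacobian does not depend on the control, so a bound at control
        0 is valid for all controls.\<close>
      obtain C where C: "\<And>x u t. \<lbrakk>norm x \<le> R; norm (u :: real^'m) \<le> 0; t \<in> {0..T}\<rbrakk> \<Longrightarrow> norm (jac_u f x u t) \<le> C"
        by (rule jointly_continuous_bounded[OF cont_deriv(4), of R 0]) blast
      have "norm (jac_u f x u t) \<le> C" if "norm x \<le> R" "t \<in> {0..T}" for x u t
        using C[of x 0 t] gr(7)[OF True that(2), of x u 0] that by simp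
      then have "AE t in leb T. \<forall>x u. norm x \<le> R \<longrightarrow> norm u \<le> W t \<longrightarrow> norm (jac_u f x u t) \<le> C"
        by (intro AE_lebesgue_on_I) blast
      then show ?thesis using V True by (intro majorized_of_bounded) auto
    next
      case ne: False
      then have "p < q" using pq by simp
      then show ?thesis
        using majorized_of_growth_mult[OF gr(6) refl False p1 _ W V \<open>0 < R\<close>] by simp
    qed
    have grad: "majorized 1 T R W V (grad_u \<theta>)"
    proof (cases "q = 1")
      case True
      \<comment> \<open>For q = 1 the quotient 1 / (1 - 1) of extended reals is \<infinity>. The
        growth order is then 0, and by the convention for this order an essentially bounded function
        dominates the gradient.\<close>
      have "conj_exponent q = \<infinity>" unfolding True conj_exponent_def by simp
      then have "growth_condition T 0 \<infinity> (grad_u \<theta>)" using gr(3) True by simp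
      then obtain C \<omega> where \<omega>: "\<omega> \<in> Lp \<infinity> T"
          "AE t in leb T. \<forall>x u. norm x \<le> R \<longrightarrow> norm (grad_u \<theta> x u t) \<le> C * (if 0 = (0::real) then 1 else norm u powr 0) + \<omega> t"
        unfolding growth_condition_def using \<open>0 < R\<close> by blast
      obtain D where "AE t in leb T. norm (\<omega> t) \<le> D" by (rule Lp_infinityE[OF refl \<omega>(1)])
      with \<omega>(2) have "AE t in leb T. \<forall>x u. norm x \<le> R \<longrightarrow> norm u \<le> W t \<longrightarrow> norm (grad_u \<theta> x u t) \<le> C + D"
      proof eventually_elim
        case (elim t)
        show ?case
        proof (intro allI impI)
          fix x :: "real^'d" and u :: "real^'m" assume "norm x \<le> R" "norm u \<le> W t"
          then have "norm (grad_u \<theta> x u t) \<le> C + \<omega> t" using elim(1) by simp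
          then show "norm (grad_u \<theta> x u t) \<le> C + D" using elim(2) by simp
        qed
      qed
      then show ?thesis using V True by (intro majorized_of_bounded) auto
    next
      case ne: False
      then have "1 < q" using q1 by simp
      \<comment> \<open>The conjugate exponent is written as q r / (q - r) with r = 1, the form that
        \<open>majorized_of_growth_mult\<close> expects.\<close>
      have "conj_exponent q = q * 1 / (q - 1)" using False by (simp add: conj_exponent_def)
      moreover have "enn2real (conj_exponent q) = enn2real q / (enn2real q - 1)" "1 < enn2real q"
      proof -
        have qa: "q = ennreal (enn2real q)" using False by (simp add: less_top)
        then show a: "1 < enn2real q" using \<open>1 < q\<close> q by (metis ennreal_1 ennreal_less_iff zero_le_one)
        have "q / (q - 1) = ennreal (enn2real q / (enn2real q - 1))"
          using a by (subst (1 2) qa) (simp add: divide_ennreal ennreal_minus flip: ennreal_1)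
        then show "enn2real (conj_exponent q) = enn2real q / (enn2real q - 1)"
          using False a by (simp add: conj_exponent_def)
      qed
      then have "enn2real q - 1 = enn2real q / enn2real (conj_exponent q)" by (simp add: field_simps)
      ultimately show ?thesis
        using majorized_of_growth_mult[of T q "conj_exponent q" "grad_u \<theta>" 1, OF _ _ False _ \<open>1 < q\<close> W V \<open>0 < R\<close>] gr(3) by simp
    qed
    show ?thesis
      using q False p
      by (intro conjI jac grad majorized_of_growth[OF gr(1) _ _ _ _ W \<open>0 < R\<close>] majorized_of_growth[OF gr(2) _ _ _ _ W \<open>0 < R\<close>]
        majorized_of_growth[OF gr(4) _ _ ratio W \<open>0 < R\<close>] majorized_of_growth[OF gr(5) _ _ ratio W \<open>0 < R\<close>]) auto
  qed
  then show "majorized p T R W (\<lambda>t. 1) f" "majorized p T R W (\<lambda>t. 1) (jac_x f)" "majorized p T R W V (jac_u f)"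
    "majorized 1 T R W (\<lambda>t. 1) \<theta>" "majorized 1 T R W (\<lambda>t. 1) (grad_x \<theta>)" "majorized 1 T R W V (grad_u \<theta>)"
    by auto
qed

section \<open>Integrability along trajectories and admissible pairs\<close>

lemma AE_in_Icc: "AE t in leb T. t \<in> {0..T}"
  by (rule AE_lebesgue_on_I)

lemma majorized_composition_Lp:
  fixes g :: "real^'d \<Rightarrow> real^'m \<Rightarrow> real \<Rightarrow> 'c::euclidean_space"
  assumes g: "jointly_continuous T g" and M: "\<And>R W. \<lbrakk>0 < R; W \<in> Lp q T\<rbrakk> \<Longrightarrow> majorized r T R W (\<lambda>t. 1) g"
    and x: "continuous_on {0..T} x" and u: "u \<in> Lp q T"
  shows "(\<lambda>t. g (x t) (u t) t) \<in> Lp r T"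
proof -
  obtain R where R: "0 < R" "\<And>t. t \<in> {0..T} \<Longrightarrow> norm (x t) \<le> R" by (rule continuous_on_Icc_bounded[OF x]) blast
  from M[OF R(1) Lp_norm_fun[OF u]] obtain \<Phi> where \<Phi>: "\<Phi> \<in> Lp r T"
    "AE t in leb T. \<forall>x v. norm x \<le> R \<longrightarrow> norm v \<le> norm (u t) \<longrightarrow> norm (g x v t) * 1 \<le> \<Phi> t"
    unfolding majorized_def by blast
  show ?thesis
  proof (rule Lp_dominated[OF \<Phi>(1)])
    show "(\<lambda>t. g (x t) (u t) t) \<in> borel_measurable (leb T)"
      by (rule jointly_continuous_measurable[OF g T continuous_on_Icc_measurable[OF x] Lp_measurable[OF u]])
    show "AE t in leb T. norm (g (x t) (u t) t) \<le> \<Phi> t"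
      using \<Phi>(2) AE_in_Icc
    proof eventually_elim
      case (elim t)
      then show ?case using R(2)[of t] by simp
    qed
  qed
qed

lemma one_Lp: "(\<lambda>t. 1 :: real) \<in> Lp r T"
  by (rule Lp_const)

lemma dynamics_Lp:
  "continuous_on {0..T} x \<Longrightarrow> u \<in> Lp q T \<Longrightarrow> (\<lambda>t. f (x t) (u t) t) \<in> Lp p T"
  by (rule majorized_composition_Lp[OF cont(2) majorized(1)[OF _ _ one_Lp]]) auto

lemma jac_x_Lp:
  "continuous_on {0..T} x \<Longrightarrow> u \<in> Lp q T \<Longrightarrow> (\<lambda>t. jac_x f (x t) (u t) t) \<in> Lp p T"
  by (rule majorized_composition_Lp[OF cont_deriv(3) majorized(2)[OF _ _ one_Lp]]) auto

lemma cost_integrable: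
  assumes "continuous_on {0..T} x" "u \<in> Lp q T"
  shows "integrable (leb T) (\<lambda>t. \<theta> (x t) (u t) t)"
  by (rule Lp_imp_integrable[OF order_refl], rule majorized_composition_Lp[OF cont(1) majorized(4)[OF _ _ one_Lp] assms]) auto

lemma dynamics_integrable:
  "continuous_on {0..T} x \<Longrightarrow> u \<in> Lp q T \<Longrightarrow> integrable (leb T) (\<lambda>t. f (x t) (u t) t)"
  by (rule Lp_imp_integrable[OF p1 dynamics_Lp])

text \<open>The weight in \<open>majorized\<close> is taken to be the size of the direction
  \<open>v\<close> itself, so the product is estimated directly.\<close>

lemma jac_u_mult_Lp:
  assumes x: "continuous_on {0..T} x" and u: "u \<in> Lp q T" and v: "v \<in> Lp q T"
  shows "(\<lambda>t. jac_u f (x t) (u t) t *v v t) \<in> Lp p T"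
proof -
  obtain R where R: "0 < R" "\<And>t. t \<in> {0..T} \<Longrightarrow> norm (x t) \<le> R" by (rule continuous_on_Icc_bounded[OF x]) blast
  from majorized(3)[OF R(1) Lp_norm_fun[OF u] Lp_norm_fun[OF v]] obtain \<Phi> where \<Phi>: "\<Phi> \<in> Lp p T"
    "AE t in leb T. \<forall>x w. norm x \<le> R \<longrightarrow> norm w \<le> norm (u t) \<longrightarrow> norm (jac_u f x w t) * norm (v t) \<le> \<Phi> t"
    unfolding majorized_def by auto
  show ?thesis
  proof (rule Lp_dominated[OF \<Phi>(1)])
    have "(\<lambda>t. jac_u f (x t) (u t) t) \<in> borel_measurable (leb T)"
      by (rule jointly_continuous_measurable[OF cont_deriv(4) T continuous_on_Icc_measurable[OF x] Lp_measurable[OF u]])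
    then show "(\<lambda>t. jac_u f (x t) (u t) t *v v t) \<in> borel_measurable (leb T)"
      by (rule borel_measurable_matrix_vector_mult[OF _ Lp_measurable[OF v]])
    show "AE t in leb T. norm (jac_u f (x t) (u t) t *v v t) \<le> \<Phi> t"
      using \<Phi>(2) AE_in_Icc
    proof eventually_elim
      case (elim t)
      have "norm (jac_u f (x t) (u t) t *v v t) \<le> norm (jac_u f (x t) (u t) t) * norm (v t)"
        by (rule norm_matrix_vector_mult_le)
      also have "\<dots> \<le> \<Phi> t" using elim R(2)[of t] by simp
      finally show ?case .
    qed
  qed
qed

lemma jac_x_mult_integrable:
  assumes x: "continuous_on {0..T} x" and u: "u \<in> Lp q T" and y: "continuous_on {0..T} y"
  shows "integrable (leb T) (\<lambda>t. jac_x f (x t) (u t) t *v y t)"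
proof (rule Bochner_Integration.integrable_bound)
  show "integrable (leb T) (\<lambda>t. norm (jac_x f (x t) (u t) t) * norm (y t))"
    by (rule integrable_mult_continuous[OF integrable_norm[OF Lp_imp_integrable[OF p1 jac_x_Lp[OF x u]]]])
      (intro continuous_intros y)
  show "(\<lambda>t. jac_x f (x t) (u t) t *v y t) \<in> borel_measurable (leb T)"
    by (rule borel_measurable_matrix_vector_mult[OF Lp_measurable[OF jac_x_Lp[OF x u]] continuous_on_Icc_measurable[OF y]])
  show "AE t in leb T. norm (jac_x f (x t) (u t) t *v y t) \<le> norm (norm (jac_x f (x t) (u t) t) * norm (y t))"
    by (rule AE_I2) (simp add: norm_matrix_vector_mult_le)
qed

text \<open>The time derivative agrees almost everywhere with the dynamics, which growth places in
  L^p. A continuous solution of the integral equation therefore belongs to the state space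
  automatically.\<close>

lemma admissibleI:
  assumes x: "continuous_on {0..T} x" and u: "u \<in> Lp q T"
    and eq: "\<And>t. t \<in> {0..T} \<Longrightarrow> x t = x0 + integral {0..t} (\<lambda>s. f (x s) (u s) s)"
  shows "(x, u) \<in> admissible p q T f (Lp q T) x0"
proof -
  note ode = satisfies_ode_of_indefinite_integral[OF dynamics_integrable[OF x u] eq]
  have "time_deriv T x \<in> Lp p T"
    by (rule Lp_cong_AE[OF dynamics_Lp[OF x u] satisfies_ode_AE_time_deriv[OF ode(2) T]])
  moreover have "x 0 = x0" using eq[of 0] T by simp
  ultimately show ?thesis using ode u by (simp add: admissible_def X_space_def W1p_def)
qed

lemma admissibleD:
  assumes "(x, u) \<in> admissible p q T f (Lp q T) x0"
  shows "continuous_on {0..T} x" "u \<in> Lp q T" "x 0 = x0" "abs_continuous_on_interval 0 T x"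
    "satisfies_ode T x (\<lambda>t. f (x t) (u t) t)" "time_deriv T x \<in> Lp p T"
    "\<And>t. t \<in> {0..T} \<Longrightarrow> x t = x0 + integral {0..t} (\<lambda>s. f (x s) (u s) s)"
proof -
  have *: "x 0 = x0" "abs_continuous_on_interval 0 T x" "satisfies_ode T x (\<lambda>t. f (x t) (u t) t)"
    using assms by (auto simp: admissible_def X_space_def W1p_def)
  show "x t = x0 + integral {0..t} (\<lambda>s. f (x s) (u s) s)" if "t \<in> {0..T}" for t
    using satisfies_ode_imp_has_integral[OF *(2,3) that] *(1) by (simp add: has_integral_iff)
qed (use assms in \<open>auto simp: admissible_def X_space_def W1p_def intro: abs_continuous_on_interval_imp_continuous_on\<close>)

text \<open>For \<open>q = \<infinity>\<close> almost everywhere convergence is replaced by uniform convergence.\<close>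

lemma dynamics_Lp_norm_tendsto:
  assumes x: "\<And>n. continuous_on {0..T} (x n)" "continuous_on {0..T} xs"
    and u: "\<And>n. u n \<in> Lp q T" "us \<in> Lp q T"
    and e: "e \<longlonglongrightarrow> 0" "\<And>n t. t \<in> {0..T} \<Longrightarrow> norm (x n t - xs t) \<le> e n"
    and \<Phi>: "\<Phi> \<in> Lp q T" "\<And>n. AE t in leb T. norm (u n t - us t) \<le> \<Phi> t"
    and lim: "AE t in leb T. (\<lambda>n. u n t) \<longlonglongrightarrow> us t"
    and unif: "\<And>r. \<lbrakk>q = \<infinity>; 0 < r\<rbrakk> \<Longrightarrow> \<exists>N. \<forall>n\<ge>N. AE t in leb T. norm (u n t - us t) \<le> r"
  shows "(\<lambda>n. Lp_norm p T (\<lambda>t. f (x n t) (u n t) t - f (xs t) (us t) t)) \<longlonglongrightarrow> 0"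
proof -
  \<comment> \<open>A convergent sequence is bounded, so a single radius contains all the
    states.\<close>
  obtain b where b: "\<And>n. \<bar>e n\<bar> \<le> b" using convergent_imp_Bseq[OF convergentI[OF e(1)]] by (auto simp: Bseq_def)
  obtain R0 where R0: "0 < R0" "\<And>t. t \<in> {0..T} \<Longrightarrow> norm (xs t) \<le> R0" by (rule continuous_on_Icc_bounded[OF x(2)]) blast
  define R where "R = R0 + b"
  have b0: "0 \<le> b" using b[of 0] by linarith
  have R: "0 < R" "\<And>t. t \<in> {0..T} \<Longrightarrow> norm (xs t) \<le> R" "\<And>n t. t \<in> {0..T} \<Longrightarrow> norm (x n t) \<le> R"
  proof -
    show "0 < R" using R0(1) b0 by (simp add: R_def)
    show "norm (xs t) \<le> R" if "t \<in> {0..T}" for t using R0(2)[OF that] b0 by (simp add: R_def)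
    fix n t assume t: "t \<in> {0..T}"
    have "norm (x n t) \<le> norm (xs t) + norm (x n t - xs t)" by (rule norm_triangle_sub)
    then show "norm (x n t) \<le> R" using R0(2)[OF t] e(2)[OF t, of n] b[of n] by (simp add: R_def)
  qed
  define W where "W t = norm (us t) + \<Phi> t" for t
  have W: "W \<in> Lp q T" unfolding W_def by (intro Lp_add Lp_norm_fun u \<Phi>)
  have un: "AE t in leb T. norm (u n t) \<le> W t \<and> norm (us t) \<le> W t" for n
    using \<Phi>(2)[of n]
  proof eventually_elim
    case (elim t)
    then show ?case using norm_triangle_sub[of "u n t" "us t"] norm_ge_zero[of "u n t - us t"] unfolding W_def by linarith
  qed
  from majorized(1)[OF R(1) W one_Lp] obtain \<Psi> where \<Psi>: "\<Psi> \<in> Lp p T"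
    "AE t in leb T. \<forall>x u. norm x \<le> R \<longrightarrow> norm u \<le> W t \<longrightarrow> norm (f x u t) * 1 \<le> \<Psi> t"
    unfolding majorized_def by auto
  show ?thesis
  proof (rule Lp_norm_tendsto_zero[OF p1 T])
    show "(\<lambda>t. f (x n t) (u n t) t - f (xs t) (us t) t) \<in> borel_measurable (leb T)" for n
      by (rule Lp_measurable[OF Lp_diff[OF dynamics_Lp[OF x(1) u(1)] dynamics_Lp[OF x(2) u(2)]]])
    show "(\<lambda>t. \<Psi> t + \<Psi> t) \<in> Lp p T" by (rule Lp_add[OF \<Psi>(1) \<Psi>(1)])
    show "AE t in leb T. norm (f (x n t) (u n t) t - f (xs t) (us t) t) \<le> \<Psi> t + \<Psi> t" for n
      using \<Psi>(2) un[of n] AE_in_Icc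
    proof eventually_elim
      case (elim t)
      then have "norm (f (x n t) (u n t) t) \<le> \<Psi> t" "norm (f (xs t) (us t) t) \<le> \<Psi> t"
        using R(2)[of t] R(3)[of t n] by auto
      then show ?case using norm_triangle_ineq4[of "f (x n t) (u n t) t" "f (xs t) (us t) t"] by linarith
    qed
    show "AE t in leb T. (\<lambda>n. f (x n t) (u n t) t - f (xs t) (us t) t) \<longlonglongrightarrow> 0"
      using lim AE_in_Icc
    proof eventually_elim
      case (elim t)
      have "(\<lambda>n. x n t - xs t) \<longlonglongrightarrow> 0"
        by (rule Lim_null_comparison[OF always_eventually e(1)]) (use e(2)[OF elim(2)] in auto)
      then have "(\<lambda>n. x n t) \<longlonglongrightarrow> xs t" by (simp add: LIM_zero_iff)
      then have "(\<lambda>n. f (x n t) (u n t) t) \<longlonglongrightarrow> f (xs t) (us t) t"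
        by (rule jointly_continuous_tendsto[OF cont(2) elim(2) _ elim(1)])
      then show ?case by (simp add: LIM_zero_iff)
    qed
    \<comment> \<open>Here p = \<infinity> forces q = \<infinity>; the arguments then lie in a fixed
      compact set for almost every time, and uniform continuity of \<open>f\<close> transfers
      uniform closeness.\<close>
    fix r :: real assume "p = \<infinity>" "0 < r"
    then have q: "q = \<infinity>" using pq by (simp add: top_unique)
    obtain D where D: "AE t in leb T. norm (W t) \<le> D" by (rule Lp_infinityE[OF q W])
    obtain \<delta> where \<delta>: "0 < \<delta>"
      "\<And>x x' u u' t. \<lbrakk>norm x \<le> R; norm x' \<le> R; norm u \<le> D; norm u' \<le> D; norm (x - x') < \<delta>; norm (u - u') < \<delta>; t \<in> {0..T}\<rbrakk>
        \<Longrightarrow> norm (f x u t - f x' u' t) < r"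
      by (rule jointly_continuous_uniform[OF cont(2) \<open>0 < r\<close>, of R D]) blast
    have "0 < \<delta> / 2" using \<delta>(1) by simp
    from unif[OF q this] obtain N1 where N1: "\<And>n. N1 \<le> n \<Longrightarrow> AE t in leb T. norm (u n t - us t) \<le> \<delta> / 2" by blast
    from order_tendstoD(2)[OF e(1) \<delta>(1)] obtain N2 where N2: "\<And>n. N2 \<le> n \<Longrightarrow> e n < \<delta>"
      unfolding eventually_sequentially by blast
    have "AE t in leb T. norm (f (x n t) (u n t) t - f (xs t) (us t) t) \<le> r" if n: "max N1 N2 \<le> n" for n
    proof -
      have n12: "N1 \<le> n" "N2 \<le> n" using n by auto
      show ?thesis
        using un[of n] D N1[OF n12(1)] AE_in_Icc
      proof eventually_elim
        case (elim t)
        have "norm (u n t) \<le> D" "norm (us t) \<le> D" "norm (u n t - us t) < \<delta>" using elim(1,2,3) \<delta>(1) by auto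
        moreover have "norm (x n t - xs t) < \<delta>" using e(2)[OF elim(4), of n] N2[OF n12(2)] by linarith
        ultimately show ?case using \<delta>(2) R(2,3) elim(4) by (intro less_imp_le) blast
      qed
    qed
    then show "\<exists>N. \<forall>n\<ge>N. AE t in leb T. norm (f (x n t) (u n t) t - f (xs t) (us t) t) \<le> r" by blast
  qed
qed

text \<open>For admissible pairs the difference of the derivatives equals the difference of the
  dynamics almost everywhere, so the derivative part of the norm is controlled by the states and
  controls.\<close>

lemma X_norm_tendsto:
  assumes x: "\<And>n. (x n, u n) \<in> admissible p q T f (Lp q T) x0" "(xs, us) \<in> admissible p q T f (Lp q T) x0"
    and e: "e \<longlonglongrightarrow> 0" "\<And>n t. t \<in> {0..T} \<Longrightarrow> norm (x n t - xs t) \<le> e n"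
    and \<Phi>: "\<Phi> \<in> Lp q T" "\<And>n. AE t in leb T. norm (u n t - us t) \<le> \<Phi> t"
    and lim: "AE t in leb T. (\<lambda>n. u n t) \<longlonglongrightarrow> us t"
    and unif: "\<And>r. \<lbrakk>q = \<infinity>; 0 < r\<rbrakk> \<Longrightarrow> \<exists>N. \<forall>n\<ge>N. AE t in leb T. norm (u n t - us t) \<le> r"
  shows "(\<lambda>n. X_norm p q T (\<lambda>t. x n t - xs t) (\<lambda>t. u n t - us t)) \<longlonglongrightarrow> 0"
proof -
  note xn = admissibleD[OF x(1)] and xs = admissibleD[OF x(2)]
  have 1: "(\<lambda>n. Lp_norm p T (\<lambda>t. x n t - xs t)) \<longlonglongrightarrow> 0"
  proof (rule Lim_null_comparison[OF always_eventually])
    show "\<forall>n. norm (Lp_norm p T (\<lambda>t. x n t - xs t)) \<le> (1 + T) * e n"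
    proof
      fix n
      have "norm (x n 0 - xs 0) \<le> e n" using T by (intro e(2)) simp
      then have "0 \<le> e n" using norm_ge_zero order_trans by blast
      then have "Lp_norm p T (\<lambda>t. x n t - xs t) \<le> (1 + T) * e n"
        by (intro Lp_norm_le_of_bound p1 T continuous_on_Icc_measurable continuous_on_diff xn(1) xs(1) AE_lebesgue_on_I e(2))
      then show "norm (Lp_norm p T (\<lambda>t. x n t - xs t)) \<le> (1 + T) * e n" by (simp add: Lp_norm_def)
    qed
    show "(\<lambda>n. (1 + T) * e n) \<longlonglongrightarrow> 0" by (rule tendsto_mult_right_zero[OF e(1)])
  qed
  have "Lp_norm p T (time_deriv T (\<lambda>t. x n t - xs t)) = Lp_norm p T (\<lambda>t. f (x n t) (u n t) t - f (xs t) (us t) t)" for n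
    by (rule Lp_norm_cong_AE[OF Lp_measurable[OF Lp_diff[OF dynamics_Lp[OF xn(1,2)] dynamics_Lp[OF xs(1,2)]]]
          satisfies_ode_AE_time_deriv[OF satisfies_ode_diff[OF xn(5) xs(5)] T]])
  then have 2: "(\<lambda>n. Lp_norm p T (time_deriv T (\<lambda>t. x n t - xs t))) \<longlonglongrightarrow> 0"
    using dynamics_Lp_norm_tendsto[OF xn(1) xs(1) xn(2) xs(2) e \<Phi> lim unif] by simp
  have 3: "(\<lambda>n. Lp_norm q T (\<lambda>t. u n t - us t)) \<longlonglongrightarrow> 0"
  proof (rule Lp_norm_tendsto_zero[OF q1 T _ \<Phi> _ unif])
    show "(\<lambda>t. u n t - us t) \<in> borel_measurable (leb T)" for n
      by (rule Lp_measurable[OF Lp_diff[OF xn(2) xs(2)]])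
    show "AE t in leb T. (\<lambda>n. u n t - us t) \<longlonglongrightarrow> 0"
      using lim by eventually_elim (simp add: LIM_zero)
  qed
  have "(\<lambda>n. Lp_norm p T (\<lambda>t. x n t - xs t) + Lp_norm p T (time_deriv T (\<lambda>t. x n t - xs t)) +
     Lp_norm q T (\<lambda>t. u n t - us t)) \<longlonglongrightarrow> 0 + 0 + 0"
    by (intro tendsto_add 1 2 3)
  then show ?thesis by (simp add: X_norm_def W1p_norm_def)
qed

end



section \<open>Control directions for steering the linearised system\<close>

lemma Lp_add_vector:
  fixes u v :: "real \<Rightarrow> 'a::euclidean_space"
  assumes "u \<in> Lp q T" "v \<in> Lp q T"
  shows "(\<lambda>t. u t + v t) \<in> Lp q T"
proof (rule Lp_dominated[OF Lp_add[OF Lp_norm_fun[OF assms(1)] Lp_norm_fun[OF assms(2)]]])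
  show "(\<lambda>t. u t + v t) \<in> borel_measurable (leb T)"
    using Lp_measurable[OF assms(1)] Lp_measurable[OF assms(2)] by measurable
  show "AE t in leb T. norm (u t + v t) \<le> norm (u t) + norm (v t)"
    by (intro AE_I2 norm_triangle_ineq)
qed

lemma Lp_sum:
  fixes \<Phi> :: "'i \<Rightarrow> real \<Rightarrow> real"
  assumes "finite I" "\<And>i. i \<in> I \<Longrightarrow> \<Phi> i \<in> Lp q T"
  shows "(\<lambda>t. \<Sum>i\<in>I. \<Phi> i t) \<in> Lp q T"
  using assms
proof (induction I rule: finite_induct)
  case empty
  then show ?case by (simp add: Lp_const)
next
  case (insert i I)
  then have "(\<lambda>t. \<Phi> i t + (\<Sum>i\<in>I. \<Phi> i t)) \<in> Lp q T" by (intro Lp_add) auto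
  with insert show ?case by simp
qed

lemma norm_sum_scaleR_component_le:
  fixes c :: "real^'d" and w :: "'d \<Rightarrow> 'a::real_normed_vector"
  shows "norm (\<Sum>i\<in>UNIV. c $ i *\<^sub>R w i) \<le> (\<Sum>i\<in>UNIV. norm (w i)) * norm c"
proof -
  have "norm (\<Sum>i\<in>UNIV. c $ i *\<^sub>R w i) \<le> (\<Sum>i\<in>UNIV. norm c * norm (w i))"
    by (intro sum_norm_le) (auto intro!: mult_right_mono component_le_norm_cart)
  then show ?thesis by (simp add: sum_distrib_left mult.commute)
qed

context control_problem
begin

text \<open>Controllability is invoked only to steer 0 to each standard basis vector. Linear
  combinations of these finitely many responses depend linearly on the target, and one function
  \<open>V\<close> bounds all the directions.\<close>

lemma control_directions:
  assumes xs: "continuous_on {0..T} xs" and us: "us \<in> Lp q T"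
    and control: "completely_controllable q T (\<lambda>t. jac_x f (xs t) (us t) t) (\<lambda>t. jac_u f (xs t) (us t) t)"
  obtains H :: "real \<Rightarrow> real^'d \<Rightarrow> real^'d" and v :: "real \<Rightarrow> real^'d \<Rightarrow> real^'m" and V :: "real \<Rightarrow> real" and h
  where "\<And>t. linear (H t)" "\<And>t. linear (v t)" "\<And>t c. norm (v t c) \<le> V t * norm c"
    "V \<in> Lp q T" "\<And>t. 1 \<le> V t" "\<And>c. (\<lambda>t. v t c) \<in> Lp q T"
    "\<And>c. continuous_on {0..T} (\<lambda>t. H t c)" "0 \<le> h" "\<And>t c. t \<in> {0..T} \<Longrightarrow> norm (H t c) \<le> h * norm c"
    "\<And>c. H T c = c"
    "\<And>t c. t \<in> {0..T} \<Longrightarrow> H t c = integral {0..t} (\<lambda>s. jac_x f (xs s) (us s) s *v H s c + jac_u f (xs s) (us s) s *v v s c)"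
proof -
  let ?A = "\<lambda>t. jac_x f (xs t) (us t) t" and ?B = "\<lambda>t. jac_u f (xs t) (us t) t"
  let ?P = "\<lambda>i w y. w \<in> Lp q T \<and> abs_continuous_on_interval 0 T y \<and>
      satisfies_ode T y (\<lambda>t. ?A t *v y t + ?B t *v w t) \<and> y 0 = 0 \<and> y T = axis i 1"
  have "\<forall>i. \<exists>w y. ?P i w y"
    using control unfolding completely_controllable_def by blast
  from choice[OF this] obtain w where "\<forall>i. \<exists>y. ?P i (w i) y" by (elim exE)
  from choice[OF this] obtain y where wy: "\<forall>i. ?P i (w i) (y i)" by (elim exE)
  have w: "w i \<in> Lp q T" and y: "abs_continuous_on_interval 0 T (y i)"
      "satisfies_ode T (y i) (\<lambda>t. ?A t *v y i t + ?B t *v w i t)" "y i 0 = 0" "y i T = axis i 1" for i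
    using wy[THEN spec, of i] by auto
  define H where "H t c = (\<Sum>i\<in>UNIV. c $ i *\<^sub>R y i t)" for t and c :: "real^'d"
  define v where "v t c = (\<Sum>i\<in>UNIV. c $ i *\<^sub>R w i t)" for t and c :: "real^'d"
  define V where "V t = 1 + (\<Sum>i\<in>UNIV. norm (w i t))" for t
  have lin: "linear (\<lambda>c :: real^'d. \<Sum>i\<in>UNIV. c $ i *\<^sub>R z i)" for z :: "'d \<Rightarrow> 'a::real_vector"
    by (intro linearI) (simp_all add: scaleR_add_left sum.distrib scaleR_right.sum)
  have y_cont: "continuous_on {0..T} (y i)" for i
    by (rule abs_continuous_on_interval_imp_continuous_on[OF y(1)])
  have "\<exists>b. \<forall>t\<in>{0..T}. norm (y i t) \<le> b" for i
    by (rule continuous_on_Icc_bounded[OF y_cont[of i]]) blast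
  then have "\<forall>i. \<exists>b. \<forall>t\<in>{0..T}. norm (y i t) \<le> b" by (rule allI)
  from choice[OF this] obtain b where "\<forall>i. \<forall>t\<in>{0..T}. norm (y i t) \<le> b i" by (elim exE)
  then have b: "norm (y i t) \<le> b i" if "t \<in> {0..T}" for i t using that by blast
  have v_le: "norm (v t c) \<le> V t * norm c" for t c
  proof -
    have "norm (v t c) \<le> (\<Sum>i\<in>UNIV. norm (w i t)) * norm c" unfolding v_def by (rule norm_sum_scaleR_component_le)
    also have "\<dots> \<le> V t * norm c" unfolding V_def by (intro mult_right_mono) auto
    finally show ?thesis .
  qed
  have V: "V \<in> Lp q T" unfolding V_def by (intro Lp_add Lp_const Lp_sum Lp_norm_fun w) auto
  show thesis
  proof (rule that[of H v V "\<Sum>i\<in>UNIV. b i"])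
    show "linear (H t)" "linear (v t)" for t unfolding H_def v_def by (rule lin)+
    show "1 \<le> V t" for t unfolding V_def by (simp add: sum_nonneg)
    show "(\<lambda>t. v t c) \<in> Lp q T" for c
    proof (rule Lp_dominated[OF Lp_scale[OF V]])
      have "w i \<in> borel_measurable (leb T)" for i by (rule Lp_measurable[OF w])
      then show "(\<lambda>t. v t c) \<in> borel_measurable (leb T)" unfolding v_def by measurable
      show "AE t in leb T. norm (v t c) \<le> norm c * V t" using v_le[of _ c] by (simp add: mult.commute)
    qed
    show "continuous_on {0..T} (\<lambda>t. H t c)" for c unfolding H_def by (intro continuous_intros y_cont)
    have "0 \<le> b i" for i using order_trans[OF norm_ge_zero b[of 0 i]] T by simp
    then show "0 \<le> (\<Sum>i\<in>UNIV. b i)" by (simp add: sum_nonneg)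
    show "norm (H t c) \<le> (\<Sum>i\<in>UNIV. b i) * norm c" if t: "t \<in> {0..T}" for t c
    proof -
      have "norm (H t c) \<le> (\<Sum>i\<in>UNIV. norm (y i t)) * norm c" unfolding H_def by (rule norm_sum_scaleR_component_le)
      also have "\<dots> \<le> (\<Sum>i\<in>UNIV. b i) * norm c" by (intro mult_right_mono sum_mono b t) auto
      finally show ?thesis .
    qed
    show "H T c = c" for c
      by (simp add: H_def y(4) basis_expansion scalar_mult_eq_scaleR[symmetric])
    show "H t c = integral {0..t} (\<lambda>s. ?A s *v H s c + ?B s *v v s c)" if t: "t \<in> {0..T}" for t c
    proof -
      have "((\<lambda>s. ?A s *v y i s + ?B s *v w i s) has_integral y i t) {0..t}" for i
        using satisfies_ode_imp_has_integral[OF y(1,2) t, of i] y(3) by simp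
      then have "((\<lambda>s. \<Sum>i\<in>UNIV. c $ i *\<^sub>R (?A s *v y i s + ?B s *v w i s)) has_integral (\<Sum>i\<in>UNIV. c $ i *\<^sub>R y i t)) {0..t}"
        by (intro has_integral_sum has_integral_cmul) auto
      moreover have "(\<Sum>i\<in>UNIV. c $ i *\<^sub>R (?A s *v y i s + ?B s *v w i s)) = ?A s *v H s c + ?B s *v v s c" for s
        by (simp add: H_def v_def vec.sum matrix_vector_mult_scaleR scaleR_add_right sum.distrib linear_sum[OF matrix_vector_mul_linear])
      ultimately show ?thesis by (simp add: H_def integral_unique)
    qed
  qed (use v_le V in auto)
qed

end

section \<open>Perturbations along a convergent sequence of pairs\<close>

text \<open>All perturbations of size at most \<open>1\<close> of the sequence stay in the ball of radius \<open>R\<close> and below \<open>W\<close>. The bound \<open>1 \<le> V\<close>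
  makes it possible to divide by \<open>V\<close>.\<close>

locale control_sequence = control_problem p q T \<theta> f
  for p q :: ennreal and T :: real
    and \<theta> :: "real^'d \<Rightarrow> real^'m \<Rightarrow> real \<Rightarrow> real"
    and f :: "real^'d \<Rightarrow> real^'m \<Rightarrow> real \<Rightarrow> real^'d" +
  fixes xs :: "real \<Rightarrow> real^'d" and us :: "real \<Rightarrow> real^'m"
    and x :: "nat \<Rightarrow> real \<Rightarrow> real^'d" and u :: "nat \<Rightarrow> real \<Rightarrow> real^'m"
    and v :: "real \<Rightarrow> real^'d \<Rightarrow> real^'m" and V W :: "real \<Rightarrow> real" and R :: real
  assumes xs: "continuous_on {0..T} xs" and us: "us \<in> Lp q T"
    and x: "\<And>n. continuous_on {0..T} (x n)" and u: "\<And>n. u n \<in> Lp q T"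
    and x_lim: "\<And>t. t \<in> {0..T} \<Longrightarrow> (\<lambda>n. x n t) \<longlonglongrightarrow> xs t"
    and R: "0 < R" "\<And>t. t \<in> {0..T} \<Longrightarrow> norm (xs t) \<le> R" "\<And>n t. t \<in> {0..T} \<Longrightarrow> norm (x n t) + 1 \<le> R"
    and u_lim: "AE t in leb T. (\<lambda>n. u n t) \<longlonglongrightarrow> us t"
    and W: "W \<in> Lp q T" "AE t in leb T. (\<forall>n. norm (u n t) + V t \<le> W t) \<and> norm (us t) \<le> W t"
    and v: "\<And>t. linear (v t)" "\<And>t c. norm (v t c) \<le> V t * norm c" "\<And>c. (\<lambda>t. v t c) \<in> Lp q T"
    and V: "V \<in> Lp q T" "\<And>t. 1 \<le> V t"
begin

lemma V_pos: "0 < V t" "0 \<le> V t"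
  using V(2)[of t] by auto

lemma perturbed_control_Lp: "(\<lambda>t. u n t + v t c) \<in> Lp q T"
  by (rule Lp_add_vector[OF u v(3)])

lemma perturbed_state_bound:
  assumes "t \<in> {0..T}" "norm y \<le> 1"
  shows "norm (x n t + y) \<le> R"
  using norm_triangle_ineq[of "x n t" y] R(3)[OF assms(1), of n] assms(2) by linarith

lemma perturbed_control_bound:
  assumes "norm (u n t) + V t \<le> W t" "norm c \<le> 1"
  shows "norm (u n t + v t c) \<le> W t"
proof -
  have "V t * norm c \<le> V t * 1" using assms(2) V_pos(2) by (intro mult_left_mono) auto
  then show ?thesis using norm_triangle_ineq[of "u n t" "v t c"] v(2)[of t c] assms(1) by linarith
qed

text \<open>The constant is the integral of functions dominating the gradients on the common ball of
  radius \<open>R\<close> and below \<open>W\<close>, hence it is independent of the index.\<close>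

lemma cost_increment:
  obtains L where "0 \<le> L"
    "\<And>n y c m. \<lbrakk>continuous_on {0..T} y; \<And>t. t \<in> {0..T} \<Longrightarrow> norm (y t) \<le> m; norm c \<le> m; m \<le> 1\<rbrakk> \<Longrightarrow>
       \<bar>objective T \<theta> (\<lambda>t. x n t + y t) (\<lambda>t. u n t + v t c) - objective T \<theta> (x n) (u n)\<bar> \<le> L * m"
proof -
  from majorized(5)[OF R(1) W(1) one_Lp] obtain \<Phi> where \<Phi>: "\<Phi> \<in> Lp 1 T"
    "AE t in leb T. \<forall>x u. norm x \<le> R \<longrightarrow> norm u \<le> W t \<longrightarrow> norm (grad_x \<theta> x u t) * 1 \<le> \<Phi> t"
    unfolding majorized_def by auto
  from majorized(6)[OF R(1) W(1) V(1) V_pos(2)] obtain \<Psi> where \<Psi>: "\<Psi> \<in> Lp 1 T"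
    "AE t in leb T. \<forall>x u. norm x \<le> R \<longrightarrow> norm u \<le> W t \<longrightarrow> norm (grad_u \<theta> x u t) * V t \<le> \<Psi> t"
    unfolding majorized_def by auto
  have int: "integrable (leb T) (\<lambda>t. \<bar>\<Phi> t + \<Psi> t\<bar>)"
    using Lp_imp_integrable[OF order_refl Lp_add[OF \<Phi>(1) \<Psi>(1)]] by simp
  define L where "L = (LINT t|leb T. \<bar>\<Phi> t + \<Psi> t\<bar>)"
  show thesis
  proof (rule that[of L])
    show "0 \<le> L" by (simp add: L_def)
    fix n and y :: "real \<Rightarrow> real^'d" and c :: "real^'d" and m :: real
    assume y: "continuous_on {0..T} y" "\<And>t. t \<in> {0..T} \<Longrightarrow> norm (y t) \<le> m" and c: "norm c \<le> m" and m: "m \<le> 1"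
    have m0: "0 \<le> m" using c norm_ge_zero order_trans by blast
    have i1: "integrable (leb T) (\<lambda>t. \<theta> (x n t + y t) (u n t + v t c) t)"
      by (rule cost_integrable[OF continuous_on_add[OF x y(1)] perturbed_control_Lp])
    have i2: "integrable (leb T) (\<lambda>t. \<theta> (x n t) (u n t) t)" by (rule cost_integrable[OF x u])
    have "AE t in leb T. norm (\<theta> (x n t + y t) (u n t + v t c) t - \<theta> (x n t) (u n t) t) \<le> \<bar>\<Phi> t + \<Psi> t\<bar> * m"
      using \<Phi>(2) \<Psi>(2) W(2) AE_in_Icc
    proof eventually_elim
      case (elim t)
      have W0: "norm (u n t) + V t \<le> W t" using elim(3) by blast
      \<comment> \<open>The Lipschitz constant in the control is \<Psi>/V and the control changes by
        at most V m, so the two factors V cancel.\<close>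
      have "\<bar>\<theta> (x n t + y t) (u n t + v t c) t - \<theta> (x n t) (u n t) t\<bar> \<le>
          \<Phi> t * norm (x n t + y t - x n t) + (\<Psi> t / V t) * norm (u n t + v t c - u n t)"
      proof (rule mean_value_grad[OF diff(1) elim(4), of "cball 0 R" "cball 0 (W t)"])
        fix a w assume a: "a \<in> cball (0::real^'d) R" "w \<in> cball (0::real^'m) (W t)"
        then show "norm (grad_x \<theta> a w t) \<le> \<Phi> t" using elim(1) by simp
        show "norm (grad_u \<theta> a w t) \<le> \<Psi> t / V t" using elim(2) a V_pos(1)[of t] by (simp add: pos_le_divide_eq)
      next
        show "x n t + y t \<in> cball 0 R" "x n t \<in> cball 0 R"
          using perturbed_state_bound[OF elim(4), of "y t" n] perturbed_state_bound[OF elim(4), of 0 n] y(2)[OF elim(4)] m by auto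
        show "u n t + v t c \<in> cball 0 (W t)" "u n t \<in> cball 0 (W t)"
          using perturbed_control_bound[OF W0, of c] c m W0 V_pos(2)[of t] by auto
      qed auto
      also have "\<dots> \<le> \<Phi> t * m + (\<Psi> t / V t) * (V t * m)"
      proof -
        \<comment> \<open>Evaluating the bounds at state 0 and control \<open>us t\<close> shows
          that the dominating functions are nonnegative at this time.\<close>
        have z: "norm (0::real^'d) \<le> R" "norm (us t) \<le> W t" using R(1) elim(3) by auto
        have "norm (grad_x \<theta> 0 (us t) t) * 1 \<le> \<Phi> t"
          by (rule elim(1)[THEN spec, THEN spec, THEN mp, THEN mp, OF z])
        then have "0 \<le> \<Phi> t" using norm_ge_zero[of "grad_x \<theta> 0 (us t) t"] by linarith
        moreover have "norm (grad_u \<theta> 0 (us t) t) * V t \<le> \<Psi> t"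
          by (rule elim(2)[THEN spec, THEN spec, THEN mp, THEN mp, OF z])
        then have "0 \<le> \<Psi> t" using mult_nonneg_nonneg[OF norm_ge_zero[of "grad_u \<theta> 0 (us t) t"] V_pos(2)[of t]] by linarith
        moreover have "norm (v t c) \<le> V t * m" using v(2)[of t c] mult_left_mono[OF c V_pos(2)[of t]] by linarith
        ultimately show ?thesis using y(2)[OF elim(4)] V_pos(2)[of t] by (intro add_mono mult_left_mono) auto
      qed
      also have "\<dots> = (\<Phi> t + \<Psi> t) * m" using V_pos(1)[of t] by (simp add: field_simps)
      also have "\<dots> \<le> \<bar>\<Phi> t + \<Psi> t\<bar> * m" using m0 by (intro mult_right_mono) auto
      finally show ?case by simp
    qed
    then have "(LINT t|leb T. norm (\<theta> (x n t + y t) (u n t + v t c) t - \<theta> (x n t) (u n t) t))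
        \<le> (LINT t|leb T. \<bar>\<Phi> t + \<Psi> t\<bar> * m)"
      using int i1 i2 by (intro integral_mono_AE) auto
    then have "norm (LINT t|leb T. \<theta> (x n t + y t) (u n t + v t c) t - \<theta> (x n t) (u n t) t)
        \<le> (LINT t|leb T. \<bar>\<Phi> t + \<Psi> t\<bar> * m)"
      by (rule order_trans[OF integral_norm_bound])
    also have "\<dots> = L * m" using int by (simp add: L_def)
    finally show "\<bar>objective T \<theta> (\<lambda>t. x n t + y t) (\<lambda>t. u n t + v t c) - objective T \<theta> (x n) (u n)\<bar> \<le> L * m"
      using i1 i2 by (simp add: objective_def)
  qed
qed

abbreviation "A t \<equiv> jac_x f (xs t) (us t) t"
abbreviation "B t \<equiv> jac_u f (xs t) (us t) t"

text \<open>This is the defect in strict differentiability: two perturbations are compared, with the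
  base point moving along the sequence and the linear part fixed at the limit.\<close>

definition remainder where
  "remainder n y y' c c' t = f (x n t + y) (u n t + v t c) t - f (x n t + y') (u n t + v t c') t
     - A t *v (y - y') - B t *v v t (c - c')"

text \<open>The convex sets are left free: large balls around 0 give domination, small balls around
  the limit give convergence.\<close>

lemma remainder_bound:
  assumes "t \<in> {0..T}" "convex P" "convex Q"
    and "\<And>a w. \<lbrakk>a \<in> P; w \<in> Q\<rbrakk> \<Longrightarrow> norm (jac_x f a w t - A t) \<le> \<alpha>"
    and "\<And>a w. \<lbrakk>a \<in> P; w \<in> Q\<rbrakk> \<Longrightarrow> norm (jac_u f a w t - B t) \<le> \<beta>"
    and "0 \<le> \<alpha>" "0 \<le> \<beta>" "x n t + y \<in> P" "x n t + y' \<in> P" "u n t + v t c \<in> Q" "u n t + v t c' \<in> Q"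
    and "norm (y - y') \<le> m" "norm (c - c') \<le> m"
  shows "norm (remainder n y y' c c' t) \<le> (\<alpha> + \<beta> * V t) * m"
proof -
  have "norm (remainder n y y' c c' t) \<le> \<alpha> * norm (y - y') + \<beta> * norm (v t (c - c'))"
    using mean_value_jac[OF diff(2) assms(1-5) assms(8-11)] by (simp add: remainder_def linear_diff[OF v(1)])
  also have "\<dots> \<le> \<alpha> * m + \<beta> * (V t * m)"
  proof -
    have "norm (v t (c - c')) \<le> V t * m"
      using v(2)[of t "c - c'"] mult_left_mono[OF assms(13) V_pos(2)[of t]] by linarith
    then show ?thesis using assms(6,7,12) by (intro add_mono mult_left_mono)
  qed
  finally show ?thesis by (simp add: algebra_simps)
qed

lemma remainder_measurable:
  assumes "continuous_on {0..T} y" "continuous_on {0..T} y'"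
  shows "(\<lambda>t. remainder n (y t) (y' t) c c' t) \<in> borel_measurable (leb T)"
proof -
  have "(\<lambda>t. f (x n t + y t) (u n t + v t c) t) \<in> borel_measurable (leb T)"
    "(\<lambda>t. f (x n t + y' t) (u n t + v t c') t) \<in> borel_measurable (leb T)"
    by (rule Lp_measurable[OF dynamics_Lp[OF continuous_on_add[OF x assms(1)] perturbed_control_Lp]]
        Lp_measurable[OF dynamics_Lp[OF continuous_on_add[OF x assms(2)] perturbed_control_Lp]])+
  moreover have "(\<lambda>t. A t *v (y t - y' t)) \<in> borel_measurable (leb T)"
    by (rule borel_measurable_integrable[OF jac_x_mult_integrable[OF xs us continuous_on_diff[OF assms]]])
  moreover have "(\<lambda>t. B t *v v t (c - c')) \<in> borel_measurable (leb T)"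
    by (rule Lp_measurable[OF jac_u_mult_Lp[OF xs us v(3)]])
  ultimately show ?thesis unfolding remainder_def by (intro borel_measurable_diff)
qed

text \<open>The perturbations are quantified inside the almost everywhere statement, so one null set
  serves all of them. The factor 2 accounts for the Jacobian at the moving point and the one at the
  limit.\<close>

lemma remainder_dominated:
  obtains \<Phi> where "integrable (leb T) \<Phi>"
    "AE t in leb T. \<forall>n y y' c c' m. norm y \<le> 1 \<longrightarrow> norm y' \<le> 1 \<longrightarrow> norm c \<le> 1 \<longrightarrow> norm c' \<le> 1 \<longrightarrow>
        norm (y - y') \<le> m \<longrightarrow> norm (c - c') \<le> m \<longrightarrow> norm (remainder n y y' c c' t) \<le> \<Phi> t * m"
proof -
  from majorized(2)[OF R(1) W(1) one_Lp] obtain \<Phi> where \<Phi>: "\<Phi> \<in> Lp p T"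
    "AE t in leb T. \<forall>x u. norm x \<le> R \<longrightarrow> norm u \<le> W t \<longrightarrow> norm (jac_x f x u t) * 1 \<le> \<Phi> t"
    unfolding majorized_def by auto
  from majorized(3)[OF R(1) W(1) V(1) V_pos(2)] obtain \<Psi> where \<Psi>: "\<Psi> \<in> Lp p T"
    "AE t in leb T. \<forall>x u. norm x \<le> R \<longrightarrow> norm u \<le> W t \<longrightarrow> norm (jac_u f x u t) * V t \<le> \<Psi> t"
    unfolding majorized_def by auto
  show thesis
  proof (rule that[of "\<lambda>t. 2 * (\<Phi> t + \<Psi> t)"])
    show "integrable (leb T) (\<lambda>t. 2 * (\<Phi> t + \<Psi> t))"
      by (rule Lp_imp_integrable[OF p1 Lp_scale[OF Lp_add[OF \<Phi>(1) \<Psi>(1)]]])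
    show "AE t in leb T. \<forall>n y y' c c' m. norm y \<le> 1 \<longrightarrow> norm y' \<le> 1 \<longrightarrow> norm c \<le> 1 \<longrightarrow> norm c' \<le> 1 \<longrightarrow>
        norm (y - y') \<le> m \<longrightarrow> norm (c - c') \<le> m \<longrightarrow> norm (remainder n y y' c c' t) \<le> 2 * (\<Phi> t + \<Psi> t) * m"
      using \<Phi>(2) \<Psi>(2) W(2) AE_in_Icc
    proof eventually_elim
      case (elim t)
      have z: "norm (xs t) \<le> R" "norm (us t) \<le> W t" using R(2)[OF elim(4)] elim(3) by auto
      have A: "norm (A t) \<le> \<Phi> t" using elim(1)[THEN spec, THEN spec, THEN mp, THEN mp, OF z] by simp
      have B: "norm (B t) \<le> \<Psi> t / V t"
        using elim(2)[THEN spec, THEN spec, THEN mp, THEN mp, OF z] V_pos(1)[of t] by (simp add: pos_le_divide_eq)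
      show ?case
      proof (intro allI impI)
        fix n and y y' c c' :: "real^'d" and m :: real
        assume a: "norm y \<le> 1" "norm y' \<le> 1" "norm c \<le> 1" "norm c' \<le> 1" "norm (y - y') \<le> m" "norm (c - c') \<le> m"
        have W0: "norm (u n t) + V t \<le> W t" using elim(3) by blast
        have "norm (remainder n y y' c c' t) \<le> (2 * \<Phi> t + 2 * (\<Psi> t / V t) * V t) * m"
        proof (rule remainder_bound[OF elim(4), of "cball 0 R" "cball 0 (W t)"])
          fix b w assume bw: "b \<in> cball (0::real^'d) R" "w \<in> cball (0::real^'m) (W t)"
          then have "norm (jac_x f b w t) \<le> \<Phi> t" using elim(1) by simp
          then show "norm (jac_x f b w t - A t) \<le> 2 * \<Phi> t"
            using A norm_triangle_ineq4[of "jac_x f b w t" "A t"] by linarith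
          have "norm (jac_u f b w t) \<le> \<Psi> t / V t" using elim(2) bw V_pos(1)[of t] by (simp add: pos_le_divide_eq)
          then show "norm (jac_u f b w t - B t) \<le> 2 * (\<Psi> t / V t)"
            using B norm_triangle_ineq4[of "jac_u f b w t" "B t"] by linarith
        next
          show "0 \<le> 2 * \<Phi> t" using order_trans[OF norm_ge_zero A] by simp
          show "0 \<le> 2 * (\<Psi> t / V t)" using order_trans[OF norm_ge_zero B] by simp
          show "x n t + y \<in> cball 0 R" "x n t + y' \<in> cball 0 R"
            using perturbed_state_bound[OF elim(4) a(1), of n] perturbed_state_bound[OF elim(4) a(2), of n] by auto
          show "u n t + v t c \<in> cball 0 (W t)" "u n t + v t c' \<in> cball 0 (W t)"
            using perturbed_control_bound[OF W0 a(3)] perturbed_control_bound[OF W0 a(4)] by auto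
        qed (use a in auto)
        then show "norm (remainder n y y' c c' t) \<le> 2 * (\<Phi> t + \<Psi> t) * m" using V_pos(1)[of t] by (simp add: algebra_simps)
      qed
    qed
  qed
qed

text \<open>For almost every time all the perturbed arguments converge to the limit pair. Eventually
  they lie in a small ball in which both Jacobians are close to their values at the limit, and the
  mean value estimate is proportional to \<open>m k\<close>.\<close>

lemma remainder_quotient_tendsto:
  assumes N: "\<And>k. k \<le> N k"
    and y: "\<And>k t. t \<in> {0..T} \<Longrightarrow> norm (y k t) \<le> inverse (real (Suc k))" "\<And>k t. t \<in> {0..T} \<Longrightarrow> norm (y' k t) \<le> inverse (real (Suc k))"
    and c: "\<And>k. norm (c k) \<le> inverse (real (Suc k))" "\<And>k. norm (c' k) \<le> inverse (real (Suc k))"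
    and m: "\<And>k. 0 < m k" "\<And>k t. t \<in> {0..T} \<Longrightarrow> norm (y k t - y' k t) \<le> m k" "\<And>k. norm (c k - c' k) \<le> m k"
  shows "AE t in leb T. (\<lambda>k. norm (remainder (N k) (y k t) (y' k t) (c k) (c' k) t) / m k) \<longlonglongrightarrow> 0"
  using u_lim W(2) AE_in_Icc
proof eventually_elim
  case (elim t)
  have Nlim: "filterlim N sequentially sequentially" by (rule filterlim_at_top_mono[OF filterlim_ident]) (simp add: N)
  have xN: "(\<lambda>k. x (N k) t) \<longlonglongrightarrow> xs t" by (rule filterlim_compose[OF x_lim[OF elim(3)] Nlim])
  have uN: "(\<lambda>k. u (N k) t) \<longlonglongrightarrow> us t" by (rule filterlim_compose[OF elim(1) Nlim])
  have inv: "(\<lambda>k. inverse (real (Suc k))) \<longlonglongrightarrow> 0" by (rule LIMSEQ_inverse_real_of_nat)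
  have state: "(\<lambda>k. x (N k) t + z k) \<longlonglongrightarrow> xs t" if "\<And>k. norm (z k) \<le> inverse (real (Suc k))" for z
  proof -
    have "z \<longlonglongrightarrow> 0" by (rule Lim_null_comparison[OF always_eventually inv]) (use that in blast)
    from tendsto_add[OF xN this] show ?thesis by simp
  qed
  have ctrl: "(\<lambda>k. u (N k) t + v t (z k)) \<longlonglongrightarrow> us t" if z: "\<And>k. norm (z k) \<le> inverse (real (Suc k))" for z
  proof -
    have "(\<lambda>k. v t (z k)) \<longlonglongrightarrow> 0"
    proof (rule Lim_null_comparison[OF always_eventually])
      show "\<forall>k. norm (v t (z k)) \<le> V t * inverse (real (Suc k))"
        using v(2)[of t] mult_left_mono[OF z V_pos(2)[of t]] by (blast intro: order_trans)
      show "(\<lambda>k. V t * inverse (real (Suc k))) \<longlonglongrightarrow> 0" by (rule tendsto_mult_right_zero[OF inv])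
    qed
    from tendsto_add[OF uN this] show ?thesis by simp
  qed
  note lims = state[OF y(1)[OF elim(3)]] state[OF y(2)[OF elim(3)]] ctrl[OF c(1)] ctrl[OF c(2)]
  show ?case
  proof (rule LIMSEQ_I)
    fix r :: real assume "0 < r"
    \<comment> \<open>Chosen so that \<epsilon> (1 + V t) equals r/2. It may depend on
      \<open>t\<close>, since only pointwise convergence is claimed.\<close>
    define \<epsilon> where "\<epsilon> = r / (2 * (1 + V t))"
    have \<epsilon>: "0 < \<epsilon>" using \<open>0 < r\<close> V_pos(2)[of t] by (simp add: \<epsilon>_def)
    \<comment> \<open>The bounds on the arguments are enlarged by 1 to contain the balls of radius d
      <= 1 around the limit point.\<close>
    obtain d1 where d1: "0 < d1"
      "\<And>a a' w w' s. \<lbrakk>norm a \<le> R + 1; norm a' \<le> R + 1; norm w \<le> W t + 1; norm w' \<le> W t + 1; norm (a - a') < d1; norm (w - w') < d1; s \<in> {0..T}\<rbrakk>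
        \<Longrightarrow> norm (jac_x f a w s - jac_x f a' w' s) < \<epsilon>"
      by (rule jointly_continuous_uniform[OF cont_deriv(3) \<epsilon>, of "R + 1" "W t + 1"]) blast
    obtain d2 where d2: "0 < d2"
      "\<And>a a' w w' s. \<lbrakk>norm a \<le> R + 1; norm a' \<le> R + 1; norm w \<le> W t + 1; norm w' \<le> W t + 1; norm (a - a') < d2; norm (w - w') < d2; s \<in> {0..T}\<rbrakk>
        \<Longrightarrow> norm (jac_u f a w s - jac_u f a' w' s) < \<epsilon>"
      by (rule jointly_continuous_uniform[OF cont_deriv(4) \<epsilon>, of "R + 1" "W t + 1"]) blast
    define d where "d = min 1 (min d1 d2)"
    have d: "0 < d" "d \<le> 1" "d \<le> d1" "d \<le> d2" using d1(1) d2(1) by (auto simp: d_def)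
    have z: "norm (xs t) \<le> R" "norm (us t) \<le> W t" using R(2)[OF elim(3)] elim(2) by auto
    have near: "norm (jac_x f a w t - A t) \<le> \<epsilon>" "norm (jac_u f a w t - B t) \<le> \<epsilon>"
      if aw: "a \<in> ball (xs t) d" "w \<in> ball (us t) d" for a w
    proof -
      have 1: "norm (a - xs t) < d" "norm (w - us t) < d" using aw by (auto simp: dist_norm norm_minus_commute)
      have 2: "norm a \<le> R + 1" "norm w \<le> W t + 1"
        using 1 z d(2) norm_triangle_sub[of a "xs t"] norm_triangle_sub[of w "us t"] by linarith+
      have 3: "norm (xs t) \<le> R + 1" "norm (us t) \<le> W t + 1" using z by auto
      show "norm (jac_x f a w t - A t) \<le> \<epsilon>"
        by (rule less_imp_le[OF d1(2)[OF 2(1) 3(1) 2(2) 3(2) _ _ elim(3)]]) (use 1 d in auto)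
      show "norm (jac_u f a w t - B t) \<le> \<epsilon>"
        by (rule less_imp_le[OF d2(2)[OF 2(1) 3(1) 2(2) 3(2) _ _ elim(3)]]) (use 1 d in auto)
    qed
    have ev: "eventually (\<lambda>k. X k \<in> ball l d) sequentially" if "X \<longlonglongrightarrow> l" for X :: "nat \<Rightarrow> 'z::metric_space" and l
      using tendstoD[OF that d(1)] by (simp add: dist_commute)
    have "eventually (\<lambda>k. x (N k) t + y k t \<in> ball (xs t) d \<and> x (N k) t + y' k t \<in> ball (xs t) d \<and>
        u (N k) t + v t (c k) \<in> ball (us t) d \<and> u (N k) t + v t (c' k) \<in> ball (us t) d) sequentially"
      by (intro eventually_conj ev lims)
    then obtain K where K: "\<And>k. K \<le> k \<Longrightarrow> x (N k) t + y k t \<in> ball (xs t) d \<and> x (N k) t + y' k t \<in> ball (xs t) d \<and>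
        u (N k) t + v t (c k) \<in> ball (us t) d \<and> u (N k) t + v t (c' k) \<in> ball (us t) d"
      unfolding eventually_sequentially by blast
    show "\<exists>K. \<forall>k\<ge>K. norm (norm (remainder (N k) (y k t) (y' k t) (c k) (c' k) t) / m k - 0) < r"
    proof (intro exI[of _ K] allI impI)
      fix k assume "K \<le> k"
      note Kk = K[OF this]
      have "norm (remainder (N k) (y k t) (y' k t) (c k) (c' k) t) \<le> (\<epsilon> + \<epsilon> * V t) * m k"
        by (rule remainder_bound[OF elim(3) convex_ball convex_ball near]) (use Kk \<epsilon> m elim(3) in auto)
      then have "norm (remainder (N k) (y k t) (y' k t) (c k) (c' k) t) / m k \<le> \<epsilon> + \<epsilon> * V t"
        using m(1)[of k] by (simp add: pos_divide_le_eq)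
      also have "\<epsilon> + \<epsilon> * V t = \<epsilon> * (1 + V t)" by (simp add: algebra_simps)
      also have "\<dots> = r / 2"
      proof -
        have "1 + V t \<noteq> 0" using V_pos(1)[of t] by linarith
        then show ?thesis unfolding \<epsilon>_def times_divide_eq_left by (rule mult_divide_mult_cancel_right)
      qed
      also have "\<dots> < r" using \<open>0 < r\<close> by simp
      finally show "norm (norm (remainder (N k) (y k t) (y' k t) (c k) (c' k) t) / m k - 0) < r"
        using m(1)[of k] by simp
    qed
  qed
qed

text \<open>Uniformity in the perturbations is obtained by contradiction along sequences, which avoids measurability
  questions for suprema over the perturbations.\<close>

lemma small_remainder:
  assumes \<eta>: "0 < \<eta>"
  obtains N \<rho> where "0 < \<rho>" "\<rho> \<le> 1"
    "\<And>n y y' c c' m. \<lbrakk>N \<le> n; continuous_on {0..T} y; continuous_on {0..T} y';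
        \<And>t. t \<in> {0..T} \<Longrightarrow> norm (y t) \<le> \<rho>; \<And>t. t \<in> {0..T} \<Longrightarrow> norm (y' t) \<le> \<rho>; norm c \<le> \<rho>; norm c' \<le> \<rho>;
        \<And>t. t \<in> {0..T} \<Longrightarrow> norm (y t - y' t) \<le> m; norm (c - c') \<le> m\<rbrakk> \<Longrightarrow>
        (LINT t|leb T. norm (remainder n (y t) (y' t) c c' t)) \<le> \<eta> * m"
proof -
  \<comment> \<open>A violation with index at least k and perturbations of size at most 1/(k+1): the
    single parameter k stands for both N and \<rho>.\<close>
  define Bad where "Bad k z \<longleftrightarrow> (case z of (n, y, y', c, c', m) \<Rightarrow>
      k \<le> n \<and> continuous_on {0..T} y \<and> continuous_on {0..T} y' \<and>
      (\<forall>t\<in>{0..T}. norm (y t) \<le> inverse (real (Suc k))) \<and> (\<forall>t\<in>{0..T}. norm (y' t) \<le> inverse (real (Suc k))) \<and>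
      norm c \<le> inverse (real (Suc k)) \<and> norm c' \<le> inverse (real (Suc k)) \<and>
      (\<forall>t\<in>{0..T}. norm (y t - y' t) \<le> m) \<and> norm (c - c') \<le> m \<and>
      \<eta> * m < (LINT t|leb T. norm (remainder n (y t) (y' t) c c' t)))" for k z
  have "\<not> (\<forall>k. \<exists>z. Bad k z)"
  proof
    assume "\<forall>k. \<exists>z. Bad k z"
    from choice[OF this] obtain z where z: "\<forall>k. Bad k (z k)" by (elim exE)
    define n where "n k = fst (z k)" for k
    define y where "y k = fst (snd (z k))" for k
    define y' where "y' k = fst (snd (snd (z k)))" for k
    define c where "c k = fst (snd (snd (snd (z k))))" for k
    define c' where "c' k = fst (snd (snd (snd (snd (z k)))))" for k
    define m where "m k = snd (snd (snd (snd (snd (z k)))))" for k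
    have n: "k \<le> n k" and y_cont: "continuous_on {0..T} (y k)" "continuous_on {0..T} (y' k)"
      and y: "t \<in> {0..T} \<Longrightarrow> norm (y k t) \<le> inverse (real (Suc k))" "t \<in> {0..T} \<Longrightarrow> norm (y' k t) \<le> inverse (real (Suc k))"
      and c: "norm (c k) \<le> inverse (real (Suc k))" "norm (c' k) \<le> inverse (real (Suc k))"
      and m: "t \<in> {0..T} \<Longrightarrow> norm (y k t - y' k t) \<le> m k" "norm (c k - c' k) \<le> m k"
      and large: "\<eta> * m k < (LINT t|leb T. norm (remainder (n k) (y k t) (y' k t) (c k) (c' k) t))" for k t
      using z[THEN spec, of k] by (simp_all add: Bad_def n_def y_def y'_def c_def c'_def m_def case_prod_unfold)
    \<comment> \<open>Allows division by \<open>m k\<close>: if it were 0, the two perturbations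
      would coincide on [0,T], the remainder would vanish and the strict inequality would
      fail.\<close>
    have m_pos: "0 < m k" for k
    proof (rule ccontr)
      assume "\<not> 0 < m k"
      with m(2)[of k] norm_ge_zero[of "c k - c' k"] have m0: "m k = 0" by linarith
      then have c0: "c k = c' k" using m(2)[of k] by simp
      have y0: "y k t = y' k t" if "t \<in> {0..T}" for t using m(1)[OF that, of k] m0 by simp
      have "(LINT t|leb T. norm (remainder (n k) (y k t) (y' k t) (c k) (c' k) t)) = (LINT t|leb T. 0)"
        by (rule Bochner_Integration.integral_cong[OF refl]) (simp add: remainder_def c0 y0 linear_0[OF v(1)])
      then show False using large[of k] m0 by simp
    qed
    obtain \<Phi> where \<Phi>: "integrable (leb T) \<Phi>"
      "AE t in leb T. \<forall>n y y' c c' m. norm y \<le> 1 \<longrightarrow> norm y' \<le> 1 \<longrightarrow> norm c \<le> 1 \<longrightarrow> norm c' \<le> 1 \<longrightarrow>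
        norm (y - y') \<le> m \<longrightarrow> norm (c - c') \<le> m \<longrightarrow> norm (remainder n y y' c c' t) \<le> \<Phi> t * m"
      by (rule remainder_dominated)
    have inv1: "inverse (real (Suc k)) \<le> 1" for k by (simp add: inverse_le_1_iff)
    have "(\<lambda>k. LINT t|leb T. norm (remainder (n k) (y k t) (y' k t) (c k) (c' k) t) / m k)
        \<longlonglongrightarrow> (LINT t|leb T. 0)"
    proof (rule integral_dominated_convergence[OF _ _ \<Phi>(1)])
      show "(\<lambda>t. norm (remainder (n k) (y k t) (y' k t) (c k) (c' k) t) / m k) \<in> borel_measurable (leb T)" for k
        using remainder_measurable[OF y_cont(1)[of k] y_cont(2)[of k], of "n k" "c k" "c' k"] by measurable
      show "AE t in leb T. (\<lambda>k. norm (remainder (n k) (y k t) (y' k t) (c k) (c' k) t) / m k) \<longlonglongrightarrow> 0"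
        by (rule remainder_quotient_tendsto[OF n y c m_pos m])
      show "AE t in leb T. norm (norm (remainder (n k) (y k t) (y' k t) (c k) (c' k) t) / m k) \<le> \<Phi> t" for k
        using \<Phi>(2) AE_in_Icc
      proof eventually_elim
        case (elim t)
        have "norm (y k t) \<le> 1" "norm (y' k t) \<le> 1" "norm (c k) \<le> 1" "norm (c' k) \<le> 1"
          using y[OF elim(2), of k] c[of k] inv1[of k] by linarith+
        then have "norm (remainder (n k) (y k t) (y' k t) (c k) (c' k) t) \<le> \<Phi> t * m k"
          using elim(1) m(1)[OF elim(2), of k] m(2)[of k] by blast
        then show ?case using m_pos[of k] by (simp add: pos_divide_le_eq)
      qed
    qed simp
    then have "(\<lambda>k. LINT t|leb T. norm (remainder (n k) (y k t) (y' k t) (c k) (c' k) t) / m k) \<longlonglongrightarrow> 0"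
      by simp
    \<comment> \<open>The integrals of the quotients tend to 0, whereas each violation keeps its
      integral above \<eta>; a single k yields the contradiction.\<close>
    from order_tendstoD(2)[OF this \<eta>] obtain k where
      "(LINT t|leb T. norm (remainder (n k) (y k t) (y' k t) (c k) (c' k) t) / m k) < \<eta>"
      unfolding eventually_sequentially by blast
    then have "(LINT t|leb T. norm (remainder (n k) (y k t) (y' k t) (c k) (c' k) t)) < \<eta> * m k"
      using m_pos[of k] by (simp add: pos_divide_less_eq)
    then show False using large[of k] by simp
  qed
  then obtain k where k: "\<And>z. \<not> Bad k z" by blast
  show thesis
  proof (rule that[of "inverse (real (Suc k))" k])
    show "inverse (real (Suc k)) \<le> 1" by (simp add: inverse_le_1_iff)
    fix n and y y' :: "real \<Rightarrow> real^'d" and c c' :: "real^'d" and m :: real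
    assume "k \<le> n" "continuous_on {0..T} y" "continuous_on {0..T} y'"
      "\<And>t. t \<in> {0..T} \<Longrightarrow> norm (y t) \<le> inverse (real (Suc k))" "\<And>t. t \<in> {0..T} \<Longrightarrow> norm (y' t) \<le> inverse (real (Suc k))"
      "norm c \<le> inverse (real (Suc k))" "norm c' \<le> inverse (real (Suc k))"
      "\<And>t. t \<in> {0..T} \<Longrightarrow> norm (y t - y' t) \<le> m" "norm (c - c') \<le> m"
    then show "(LINT t|leb T. norm (remainder n (y t) (y' t) c c' t)) \<le> \<eta> * m"
      using k[of "(n, y, y', c, c', m)"] by (simp add: Bad_def not_less)
  qed simp
qed

end

section \<open>Exactness of the penalty\<close>

definition (in control_sequence) corrects where
  "corrects n \<xi> b y c \<longleftrightarrow> continuous_on {0..T} y \<and> y T = \<xi> \<and> norm c \<le> b \<and> (\<forall>t\<in>{0..T}. norm (y t) \<le> b) \<and>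
     (\<forall>t\<in>{0..T}. y t = integral {0..t} (\<lambda>s. f (x n s + y s) (u n s + v s c) s - f (x n s) (u n s) s))"

text \<open>K is built from the linearised system alone, while N and \<rho> come from
  \<open>small_remainder\<close>; all of them are uniform in the index and in the target
  increment.\<close>

lemma (in control_sequence) trajectory_correction:
  assumes H: "\<And>t. linear (H t)" "\<And>c. continuous_on {0..T} (\<lambda>t. H t c)" "0 \<le> h"
      "\<And>t c. t \<in> {0..T} \<Longrightarrow> norm (H t c) \<le> h * norm c" "\<And>c. H T c = c"
      "\<And>t c. t \<in> {0..T} \<Longrightarrow> H t c = integral {0..t} (\<lambda>s. A s *v H s c + B s *v v s c)"
  obtains N K \<rho> where "0 \<le> K" "0 < \<rho>" "\<forall>n\<ge>N. \<forall>\<xi>. K * norm \<xi> \<le> \<rho> \<longrightarrow> (\<exists>y c. corrects n \<xi> (K * norm \<xi>) y c)"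
proof -
  define E where "E = exp (2 * integral {0..T} (\<lambda>t. norm (A t)))"
  \<comment> \<open>E and h are known before \<eta> is chosen, and \<eta> before N and \<rho>. This
    value lets the remainder contribute at most 1/4 to the contraction constant.\<close>
  define \<eta> where "\<eta> = 1 / (4 * (E * (1 + h)))"
  have Eh: "0 < E * (1 + h)" using H(3) by (simp add: E_def)
  have quarter: "1 / (4 * z) * z \<le> 1 / 4" if "0 < z" for z :: real using that by simp
  have \<eta>: "0 < \<eta>" "\<eta> * (E * (1 + h)) \<le> 1 / 4"
    unfolding \<eta>_def by (simp add: Eh) (rule quarter[OF Eh])
  obtain N \<rho> where \<rho>: "0 < \<rho>" and small: "\<And>n y y' c c' m. \<lbrakk>N \<le> n; continuous_on {0..T} y; continuous_on {0..T} y';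
        \<And>t. t \<in> {0..T} \<Longrightarrow> norm (y t) \<le> \<rho>; \<And>t. t \<in> {0..T} \<Longrightarrow> norm (y' t) \<le> \<rho>; norm c \<le> \<rho>; norm c' \<le> \<rho>;
        \<And>t. t \<in> {0..T} \<Longrightarrow> norm (y t - y' t) \<le> m; norm (c - c') \<le> m\<rbrakk> \<Longrightarrow>
        (LINT t|leb T. norm (remainder n (y t) (y' t) c c' t)) \<le> \<eta> * m"
    by (rule small_remainder[OF \<eta>(1)]) blast
  show thesis
  proof (rule that[of "(1 + h) * (1 + E)" \<rho> N])
    show "0 \<le> (1 + h) * (1 + E)" using H(3) by (simp add: E_def)
    show "0 < \<rho>" by (rule \<rho>)
    show "\<forall>n\<ge>N. \<forall>\<xi>. (1 + h) * (1 + E) * norm \<xi> \<le> \<rho> \<longrightarrow> (\<exists>y c. corrects n \<xi> ((1 + h) * (1 + E) * norm \<xi>) y c)"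
    proof (intro allI impI)
    fix n \<xi> assume n: "N \<le> n" and \<xi>: "(1 + h) * (1 + E) * norm (\<xi> :: real^'d) \<le> \<rho>"
    define F where "F y c t = f (x n t + y) (u n t + v t c) t - f (x n t) (u n t) t" for y c t
    obtain y c where yc: "continuous_on {0..T} y" "y T = \<xi>"
      "norm c \<le> (1 + h) * (1 + exp (2 * integral {0..T} (\<lambda>t. norm (A t)))) * norm \<xi>"
      "\<And>t. t \<in> {0..T} \<Longrightarrow> norm (y t) \<le> (1 + h) * (1 + exp (2 * integral {0..T} (\<lambda>t. norm (A t)))) * norm \<xi>"
      "\<And>t. t \<in> {0..T} \<Longrightarrow> y t = integral {0..t} (\<lambda>s. F (y s) c s)"
    proof (rule endpoint_correction[of T "\<lambda>t. norm (A t)" "\<lambda>t. (*v) (A t)" "\<lambda>t c. B t *v v t c" H h \<rho> F \<eta> \<xi>])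
      show "0 < T" by (rule T)
      show "integrable (leb T) (\<lambda>t. norm (A t))"
        by (rule integrable_norm[OF Lp_imp_integrable[OF p1 jac_x_Lp[OF xs us]]])
      show "norm (A t *v y) \<le> norm (A t) * norm y" for t y by (rule norm_matrix_vector_mult_le)
      show "linear ((*v) (A t))" for t by (rule matrix_vector_mul_linear)
      show "integrable (leb T) (\<lambda>t. A t *v y t)" if "continuous_on {0..T} y" for y
        by (rule jac_x_mult_integrable[OF xs us that])
      show "linear (\<lambda>c. B t *v v t c)" for t
        using linear_compose[OF v(1) matrix_vector_mul_linear] by (simp add: o_def)
      show "integrable (leb T) (\<lambda>t. B t *v v t c)" for c
        by (rule Lp_imp_integrable[OF p1 jac_u_mult_Lp[OF xs us v(3)]])
      show "integrable (leb T) (\<lambda>t. F (y t) c t)" if "continuous_on {0..T} y" for y c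
        unfolding F_def
        by (rule Bochner_Integration.integrable_diff[OF dynamics_integrable[OF continuous_on_add[OF x that] perturbed_control_Lp] dynamics_integrable[OF x u]])
      show "F 0 0 t = 0" for t by (simp add: F_def linear_0[OF v(1)])
      show "(LINT t|leb T. norm (F (y t) c t - F (y' t) c' t - A t *v (y t - y' t) - B t *v v t (c - c'))) \<le> \<eta> * m"
        if "continuous_on {0..T} y" "continuous_on {0..T} y'"
          "\<And>t. t \<in> {0..T} \<Longrightarrow> norm (y t) \<le> \<rho>" "\<And>t. t \<in> {0..T} \<Longrightarrow> norm (y' t) \<le> \<rho>"
          "norm c \<le> \<rho>" "norm c' \<le> \<rho>" "\<And>t. t \<in> {0..T} \<Longrightarrow> norm (y t - y' t) \<le> m" "norm (c - c') \<le> m"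
        for y y' c c' m
        using small[OF n that] by (simp add: F_def remainder_def)
    qed (use H \<eta> \<xi> in \<open>simp_all add: E_def\<close>)
    then show "\<exists>y c. corrects n \<xi> ((1 + h) * (1 + E) * norm \<xi>) y c"
      unfolding corrects_def F_def E_def by blast
    qed
  qed
qed

text \<open>Both states start at \<open>x0\<close>, so their difference is the integral of the
  difference of the dynamics. An L^1 bound on the latter, obtained from the L^p norm, is a uniform
  bound on the former.\<close>

lemma (in control_problem) admissible_uniform_bound:
  assumes x: "(x, u) \<in> admissible p q T f (Lp q T) x0" and xs: "(xs, us) \<in> admissible p q T f (Lp q T) x0"
    and less: "X_norm p q T (\<lambda>t. x t - xs t) (\<lambda>t. u t - us t) < \<epsilon>"
  shows "Lp_norm q T (\<lambda>t. u t - us t) < \<epsilon>" "t \<in> {0..T} \<Longrightarrow> norm (x t - xs t) \<le> (1 + T) * \<epsilon>"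
proof -
  note X = admissibleD[OF x] and Xs = admissibleD[OF xs]
  let ?g = "\<lambda>t. f (x t) (u t) t - f (xs t) (us t) t"
  have pos: "0 \<le> Lp_norm r T w" for r and w :: "real \<Rightarrow> 'z::euclidean_space" by (simp add: Lp_norm_def)
  have g: "?g \<in> Lp p T" by (rule Lp_diff[OF dynamics_Lp[OF X(1,2)] dynamics_Lp[OF Xs(1,2)]])
  have eq: "Lp_norm p T (time_deriv T (\<lambda>t. x t - xs t)) = Lp_norm p T ?g"
    by (rule Lp_norm_cong_AE[OF Lp_measurable[OF g] satisfies_ode_AE_time_deriv[OF satisfies_ode_diff[OF X(5) Xs(5)] T]])
  show "Lp_norm q T (\<lambda>t. u t - us t) < \<epsilon>"
    using less pos[of p "\<lambda>t. x t - xs t"] pos[of p "time_deriv T (\<lambda>t. x t - xs t)"]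
    unfolding X_norm_def W1p_norm_def by linarith
  have gless: "Lp_norm p T ?g < \<epsilon>"
    using less pos[of p "\<lambda>t. x t - xs t"] pos[of q "\<lambda>t. u t - us t"]
    unfolding X_norm_def W1p_norm_def eq by linarith
  have \<epsilon>: "0 < \<epsilon>" using pos[of p ?g] gless by linarith
  assume t: "t \<in> {0..T}"
  have gi: "integrable (leb T) ?g" by (rule Lp_imp_integrable[OF p1 g])
  have tT: "t \<le> T" using t by simp
  have "x t - xs t = integral {0..t} (\<lambda>s. f (x s) (u s) s) - integral {0..t} (\<lambda>s. f (xs s) (us s) s)"
    using X(7)[OF t] Xs(7)[OF t] by simp
  also have "\<dots> = integral {0..t} ?g"
    by (rule Henstock_Kurzweil_Integration.integral_diff[symmetric, OF integrable_initial_interval(2)[OF dynamics_integrable[OF X(1,2)] tT]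
          integrable_initial_interval(2)[OF dynamics_integrable[OF Xs(1,2)] tT]])
  also have "norm \<dots> \<le> integral {0..t} (\<lambda>s. norm (?g s))"
    by (rule norm_integral_initial_le[OF gi integrable_norm[OF gi] tT]) simp
  also have "\<dots> \<le> (LINT s|leb T. norm (?g s))"
    by (rule integral_initial_le_LINT[OF integrable_norm[OF gi] tT]) simp
  also have "\<dots> \<le> (1 + T) * \<epsilon>"
    by (rule integral_norm_le_of_Lp_norm[OF p1 T g gless \<epsilon>])
  finally show "norm (x t - xs t) \<le> (1 + T) * \<epsilon>" .
qed

theorem theorem11:
  fixes p q :: ennreal and T :: real and x0 xT :: "real^'d"
    and U :: "(real \<Rightarrow> real^'m) set"
    and \<theta> :: "real^'d \<Rightarrow> real^'m \<Rightarrow> real \<Rightarrow> real"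
    and f :: "real^'d \<Rightarrow> real^'m \<Rightarrow> real \<Rightarrow> real^'d"
    and xs :: "real \<Rightarrow> real^'d" and us :: "real \<Rightarrow> real^'m"
  assumes "1 \<le> p" and "p \<le> q" and "T > 0"
    and U: "U = Lp q T"
    and opt: "locally_optimal p q T (feasible p q T f U x0 xT) (objective T \<theta>) xs us"
    and cont: "jointly_continuous T \<theta>" "jointly_continuous T f"
    and diff: "differentiable_in_x_u T \<theta>" "differentiable_in_x_u T f"
    and cont_deriv: "jointly_continuous T (grad_x \<theta>)" "jointly_continuous T (grad_u \<theta>)"
      "jointly_continuous T (jac_x f)" "jointly_continuous T (jac_u f)"
    and growth: "q = \<infinity> \<or>
      (growth_condition T (enn2real q) 1 \<theta> \<and>
       growth_condition T (enn2real q) 1 (grad_x \<theta>) \<and>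
       growth_condition T (enn2real q - 1) (conj_exponent q) (grad_u \<theta>) \<and>
       growth_condition T (enn2real q / enn2real p) p f \<and>
       growth_condition T (enn2real q / enn2real p) p (jac_x f) \<and>
       (q > p \<longrightarrow> (\<forall>s. s = q * p / (q - p) \<longrightarrow>
          growth_condition T (enn2real q / enn2real s) s (jac_u f))) \<and>
       (q = p \<longrightarrow> (\<forall>x u v. \<forall>t\<in>{0..T}. jac_u f x u t = jac_u f x v t)))"
    and control: "completely_controllable q T
      (\<lambda>t. jac_x f (xs t) (us t) t) (\<lambda>t. jac_u f (xs t) (us t) t)"
  shows "\<exists>c0\<ge>0. \<forall>c\<ge>c0.
    locally_optimal p q T (admissible p q T f U x0) (penalty T \<theta> xT c) xs us"
proof (rule ccontr)
  assume neg: "\<not> (\<exists>c0\<ge>0. \<forall>c\<ge>c0. locally_optimal p q T (admissible p q T f U x0) (penalty T \<theta> xT c) xs us)"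
  interpret control_problem p q T \<theta> f
    using assms(1-3) cont diff cont_deriv growth by unfold_locales auto
  let ?adm = "admissible p q T f (Lp q T) x0"
  obtain r where feas: "(xs, us) \<in> feasible p q T f U x0 xT" and r: "0 < r"
    and best: "\<And>x u. \<lbrakk>(x, u) \<in> feasible p q T f U x0 xT; X_norm p q T (\<lambda>t. x t - xs t) (\<lambda>t. u t - us t) < r\<rbrakk>
        \<Longrightarrow> objective T \<theta> xs us \<le> objective T \<theta> x u"
    using opt unfolding locally_optimal_def by blast
  have adm: "(xs, us) \<in> ?adm" and xsT: "xs T = xT" using feas U by (auto simp: feasible_def)
  note Xs = admissibleD[OF adm]
  let ?P = "\<lambda>n (x, u, c). real n \<le> c \<and> (x, u) \<in> ?adm \<and>
      X_norm p q T (\<lambda>t. x t - xs t) (\<lambda>t. u t - us t) < (1 / 2) ^ n \<and>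
      objective T \<theta> x u + c * norm (x T - xT) < objective T \<theta> xs us"
  have "\<exists>z. ?P n z" for n
  proof -
    obtain c where c: "real n \<le> c" "\<not> locally_optimal p q T ?adm (penalty T \<theta> xT c) xs us"
      using neg U of_nat_0_le_iff[of n] by blast
    have "0 < (1 / 2 :: real) ^ n" by simp
    with c(2) adm obtain x u where "(x, u) \<in> ?adm" "X_norm p q T (\<lambda>t. x t - xs t) (\<lambda>t. u t - us t) < (1 / 2) ^ n"
      "\<not> penalty T \<theta> xT c xs us \<le> penalty T \<theta> xT c x u"
      unfolding locally_optimal_def by blast
    \<comment> \<open>The endpoint term vanishes at the optimal pair, so the comparison is with its
      bare objective.\<close>
    with c(1) xsT show ?thesis by (intro exI[of _ "(x, u, c)"]) (simp add: penalty_def)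
  qed
  then have "\<forall>n. \<exists>z. ?P n z" by (rule allI)
  from choice[OF this] obtain z where z: "\<forall>n. ?P n (z n)" by (elim exE)
  define x where "x n = fst (z n)" for n
  define u where "u n = fst (snd (z n))" for n
  define pc where "pc n = snd (snd (z n))" for n
  have pc: "real n \<le> pc n" and xu: "(x n, u n) \<in> ?adm"
    and close: "X_norm p q T (\<lambda>t. x n t - xs t) (\<lambda>t. u n t - us t) < (1 / 2) ^ n"
    and better: "objective T \<theta> (x n) (u n) + pc n * norm (x n T - xT) < objective T \<theta> xs us" for n
    using z[THEN spec, of n] by (simp_all add: x_def u_def pc_def case_prod_unfold)
  note X = admissibleD[OF xu]
  define e where "e n = (1 + T) * (1 / 2) ^ n" for n :: nat
  have e: "norm (x n t - xs t) \<le> e n" if "t \<in> {0..T}" for n t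
    unfolding e_def by (rule admissible_uniform_bound(2)[OF xu adm close that])
  have e_lim: "e \<longlonglongrightarrow> 0" unfolding e_def by (intro tendsto_mult_right_zero LIMSEQ_power_zero) simp
  have e_le: "0 \<le> e n" "e n \<le> 1 + T" for n
  proof -
    have "(1 / 2 :: real) ^ n \<le> 1" by (rule power_le_one) auto
    then show "0 \<le> e n" "e n \<le> 1 + T" using T by (auto simp: e_def mult_left_le)
  qed
  have d: "(\<lambda>t. u n t - us t) \<in> Lp q T" for n by (rule Lp_diff[OF X(2) Xs(2)])
  have d_less: "Lp_norm q T (\<lambda>t. u n t - us t) < (1 / 2) ^ n" for n
    by (rule admissible_uniform_bound(1)[OF xu adm close])
  obtain W0 where W0: "W0 \<in> Lp q T" and dW0: "AE t in leb T.
      (\<forall>n. norm (u n t - us t) \<le> W0 t) \<and> (\<lambda>n. u n t - us t) \<longlonglongrightarrow> 0"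
    by (rule Lp_rapid_convergence_dominated[OF q1 d d_less])
  obtain H v V h where H: "\<And>t. linear (H t)" and v: "\<And>t. linear (v t)" "\<And>t c. norm (v t c) \<le> V t * norm c"
      and V: "V \<in> Lp q T" "\<And>t. 1 \<le> V t" and v_Lp: "\<And>c. (\<lambda>t. v t c) \<in> Lp q T"
      and H': "\<And>c. continuous_on {0..T} (\<lambda>t. H t c)" "0 \<le> h" "\<And>t c. t \<in> {0..T} \<Longrightarrow> norm (H t c) \<le> h * norm c"
      "\<And>c. H T c = c"
      "\<And>t c. t \<in> {0..T} \<Longrightarrow> H t c = integral {0..t} (\<lambda>s. jac_x f (xs s) (us s) s *v H s c + jac_u f (xs s) (us s) s *v v s c)"
    by (rule control_directions[OF Xs(1,2) control]) blast
  obtain R0 where R0: "0 < R0" "\<And>t. t \<in> {0..T} \<Longrightarrow> norm (xs t) \<le> R0"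
    by (rule continuous_on_Icc_bounded[OF Xs(1)]) blast
  \<comment> \<open>R0 bounds the optimal state, 1 + T the distance of every \<open>x n\<close> from
    it, and the last 1 leaves room for perturbations of norm at most 1.\<close>
  define R where "R = R0 + (1 + T) + 1"
  define W where "W t = norm (us t) + W0 t + V t" for t
  interpret seq: control_sequence p q T \<theta> f xs us x u v V W R
  proof unfold_locales
    show "(\<lambda>n. x n t) \<longlonglongrightarrow> xs t" if "t \<in> {0..T}" for t
    proof -
      have "(\<lambda>n. x n t - xs t) \<longlonglongrightarrow> 0" by (rule Lim_null_comparison[OF always_eventually e_lim]) (use e[OF that] in blast)
      then show ?thesis by (simp add: LIM_zero_iff)
    qed
    show "0 < R" using R0(1) T by (simp add: R_def)
    show "norm (xs t) \<le> R" if "t \<in> {0..T}" for t using R0(2)[OF that] T by (simp add: R_def)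
    show "norm (x n t) + 1 \<le> R" if t: "t \<in> {0..T}" for n t
      using norm_triangle_sub[of "x n t" "xs t"] R0(2)[OF t] e[OF t, of n] e_le(2)[of n] unfolding R_def by linarith
    show "AE t in leb T. (\<lambda>n. u n t) \<longlonglongrightarrow> us t"
      using dW0 by eventually_elim (simp add: LIM_zero_iff)
    show "W \<in> Lp q T" unfolding W_def by (intro Lp_add Lp_norm_fun Xs(2) W0 V(1))
    show "AE t in leb T. (\<forall>n. norm (u n t) + V t \<le> W t) \<and> norm (us t) \<le> W t"
      using dW0
    proof eventually_elim
      case (elim t)
      have W0t: "norm (u n t - us t) \<le> W0 t" for n using elim by blast
      have "norm (u n t) + V t \<le> W t" for n
        using norm_triangle_sub[of "u n t" "us t"] W0t[of n] unfolding W_def by linarith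
      moreover have "norm (us t) \<le> W t"
        using order_trans[OF norm_ge_zero W0t[of 0]] V(2)[of t] unfolding W_def by linarith
      ultimately show ?case by blast
    qed
  qed (rule Xs(1) Xs(2) X(1) X(2) linear_add[OF v(1)] linear_scale[OF v(1)] v(2) V v_Lp)+
  obtain N K \<rho> where K: "0 \<le> K" and \<rho>: "0 < \<rho>" and corr: "\<forall>n\<ge>N. \<forall>\<xi>. K * norm \<xi> \<le> \<rho> \<longrightarrow> (\<exists>y c. seq.corrects n \<xi> (K * norm \<xi>) y c)"
    by (rule seq.trajectory_correction[OF H H'])
  obtain L where L: "0 \<le> L" and incr: "\<And>n y c m. \<lbrakk>continuous_on {0..T} y; \<And>t. t \<in> {0..T} \<Longrightarrow> norm (y t) \<le> m; norm c \<le> m; m \<le> 1\<rbrakk> \<Longrightarrow>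
       \<bar>objective T \<theta> (\<lambda>t. x n t + y t) (\<lambda>t. u n t + v t c) - objective T \<theta> (x n) (u n)\<bar> \<le> L * m"
    by (rule seq.cost_increment) blast
  define \<xi> where "\<xi> n = xT - x n T" for n
  have \<xi>: "norm (\<xi> n) \<le> e n" for n
    using e[of T n] T by (simp add: \<xi>_def xsT norm_minus_commute)
  have Ke_lim: "(\<lambda>n. K * e n) \<longlonglongrightarrow> 0" by (rule tendsto_mult_right_zero[OF e_lim])
  \<comment> \<open>Size \<rho> guarantees that a correction exists, size 1 that the cost estimate
    applies to it.\<close>
  have "0 < min \<rho> 1" using \<rho> by simp
  from order_tendstoD(2)[OF Ke_lim this] obtain N1 where N1: "\<And>n. N1 \<le> n \<Longrightarrow> K * e n < min \<rho> 1"
    unfolding eventually_sequentially by blast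
  \<comment> \<open>L K is the price of one unit of endpoint error; from N2 on the penalty parameter
    is at least this large.\<close>
  obtain N2 where N2: "L * K \<le> real N2" using real_arch_simple by blast
  define M where "M = max N (max N1 N2)"
  define n where "n k = M + k" for k
  have nk: "N \<le> n k" "N1 \<le> n k" "N2 \<le> n k" for k by (auto simp: n_def M_def)
  have K\<xi>: "K * norm (\<xi> (n k)) \<le> K * e (n k)" for k by (rule mult_left_mono[OF \<xi> K])
  have Ke: "K * e (n k) < \<rho>" "K * e (n k) \<le> 1" for k using N1[OF nk(2)[of k]] by auto
  have "\<exists>yc. seq.corrects (n k) (\<xi> (n k)) (K * norm (\<xi> (n k))) (fst yc) (snd yc)" for k
  proof -
    have "K * norm (\<xi> (n k)) \<le> \<rho>" using K\<xi>[of k] Ke(1)[of k] by linarith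
    with corr nk(1)[of k] show ?thesis by auto
  qed
  then have "\<forall>k. \<exists>yc. seq.corrects (n k) (\<xi> (n k)) (K * norm (\<xi> (n k))) (fst yc) (snd yc)" by (rule allI)
  from choice[OF this] obtain yc where
    yc: "\<forall>k. seq.corrects (n k) (\<xi> (n k)) (K * norm (\<xi> (n k))) (fst (yc k)) (snd (yc k))" by (elim exE)
  define y where "y k = fst (yc k)" for k
  define c where "c k = snd (yc k)" for k
  have y_cont: "continuous_on {0..T} (y k)" and yT: "y k T = \<xi> (n k)" and c: "norm (c k) \<le> K * norm (\<xi> (n k))"
    and y: "t \<in> {0..T} \<Longrightarrow> norm (y k t) \<le> K * norm (\<xi> (n k))"
    and y_eq: "t \<in> {0..T} \<Longrightarrow> y k t = integral {0..t} (\<lambda>s. f (x (n k) s + y k s) (u (n k) s + v s (c k)) s - f (x (n k) s) (u (n k) s) s)" for k t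
    using yc[THEN spec, of k] by (auto simp: y_def c_def seq.corrects_def)
  define x' where "x' k t = x (n k) t + y k t" for k t
  define u' where "u' k t = u (n k) t + v t (c k)" for k t
  have x'_cont: "continuous_on {0..T} (x' k)" for k unfolding x'_def by (rule continuous_on_add[OF X(1) y_cont])
  have u'_Lp: "u' k \<in> Lp q T" for k unfolding u'_def by (rule seq.perturbed_control_Lp)
  \<comment> \<open>The integrand in the equation of the correction is a difference of dynamics, so
    adding the original trajectory leaves exactly the dynamics of the corrected pair.\<close>
  have adm': "(x' k, u' k) \<in> ?adm" for k
  proof (rule admissibleI[OF x'_cont u'_Lp])
    fix t assume t: "t \<in> {0..T}"
    then have tT: "t \<le> T" by simp
    have "integral {0..t} (\<lambda>s. f (x' k s) (u' k s) s) - integral {0..t} (\<lambda>s. f (x (n k) s) (u (n k) s) s) = y k t"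
      unfolding y_eq[OF t] x'_def[symmetric] u'_def[symmetric]
      by (rule Henstock_Kurzweil_Integration.integral_diff[symmetric, OF integrable_initial_interval(2)[OF dynamics_integrable[OF x'_cont u'_Lp] tT]
            integrable_initial_interval(2)[OF dynamics_integrable[OF X(1,2)] tT]])
    then show "x' k t = x0 + integral {0..t} (\<lambda>s. f (x' k s) (u' k s) s)"
      using X(7)[OF t, of "n k"] by (simp add: x'_def algebra_simps)
  qed
  have feas': "(x' k, u' k) \<in> feasible p q T f U x0 xT" for k
    using adm'[of k] U by (simp add: feasible_def x'_def yT \<xi>_def)
  have n_lim: "filterlim n sequentially sequentially"
    by (rule filterlim_at_top_mono[OF filterlim_ident]) (simp add: n_def)
  have en_lim: "(\<lambda>k. e (n k)) \<longlonglongrightarrow> 0" by (rule filterlim_compose[OF e_lim n_lim])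
  have vc: "norm (v t (c k)) \<le> V t * (K * e (n k))" for k t
    using v(2)[of t "c k"] mult_left_mono[OF order_trans[OF c K\<xi>] seq.V_pos(2)[of t]] by (rule order_trans)
  \<comment> \<open>Optimality is available only within distance r in X, so the corrected pairs have
    to approach the optimal one in the full norm, derivatives included.\<close>
  have "(\<lambda>k. X_norm p q T (\<lambda>t. x' k t - xs t) (\<lambda>t. u' k t - us t)) \<longlonglongrightarrow> 0"
  proof (rule X_norm_tendsto[OF adm' adm])
    show "(\<lambda>k. (1 + K) * e (n k)) \<longlonglongrightarrow> 0" by (rule tendsto_mult_right_zero[OF en_lim])
    show "norm (x' k t - xs t) \<le> (1 + K) * e (n k)" if t: "t \<in> {0..T}" for k t
    proof -
      have "x' k t - xs t = (x (n k) t - xs t) + y k t" by (simp add: x'_def)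
      then have "norm (x' k t - xs t) \<le> norm (x (n k) t - xs t) + norm (y k t)" by (simp only: norm_triangle_ineq)
      also have "\<dots> \<le> e (n k) + K * e (n k)" by (rule add_mono[OF e[OF t] order_trans[OF y[OF t] K\<xi>]])
      finally show ?thesis by (simp add: algebra_simps)
    qed
    have u'_diff: "norm (u' k t - us t) \<le> norm (u (n k) t - us t) + V t * (K * e (n k))" for k t
    proof -
      have "u' k t - us t = (u (n k) t - us t) + v t (c k)" by (simp add: u'_def)
      then have "norm (u' k t - us t) \<le> norm (u (n k) t - us t) + norm (v t (c k))" by (simp only: norm_triangle_ineq)
      with vc[of t k] show ?thesis by linarith
    qed
    show "(\<lambda>t. W0 t + V t) \<in> Lp q T" by (rule Lp_add[OF W0 V(1)])
    show "AE t in leb T. norm (u' k t - us t) \<le> W0 t + V t" for k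
      using dW0
    proof eventually_elim
      case (elim t)
      have "norm (u (n k) t - us t) \<le> W0 t" using elim by blast
      moreover have "V t * (K * e (n k)) \<le> V t" using mult_left_mono[OF Ke(2)[of k] seq.V_pos(2)[of t]] by simp
      ultimately show ?case using u'_diff[of k t] by linarith
    qed
    show "AE t in leb T. (\<lambda>k. u' k t) \<longlonglongrightarrow> us t"
      using dW0
    proof eventually_elim
      case (elim t)
      then have "(\<lambda>n. u n t - us t) \<longlonglongrightarrow> 0" by blast
      then have "(\<lambda>k. u (n k) t - us t) \<longlonglongrightarrow> 0" by (rule filterlim_compose[OF _ n_lim])
      then have "(\<lambda>k. norm (u (n k) t - us t) + V t * (K * e (n k))) \<longlonglongrightarrow> 0"
        using tendsto_add[OF tendsto_norm_zero tendsto_mult_right_zero[OF tendsto_mult_right_zero[OF en_lim]]] by fastforce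
      then have "(\<lambda>k. u' k t - us t) \<longlonglongrightarrow> 0"
        by (rule Lim_null_comparison[rotated]) (use u'_diff in \<open>simp add: always_eventually\<close>)
      then show ?case by (simp add: LIM_zero_iff)
    qed
    \<comment> \<open>For q = \<infinity> the original controls are within 2^-n of the optimal one
      almost everywhere and \<open>V\<close> is essentially bounded, so both contributions are
      uniformly small.\<close>
    fix r' :: real assume q: "q = \<infinity>" and r': "0 < r'"
    obtain D where D: "AE t in leb T. norm (V t) \<le> D" by (rule Lp_infinityE[OF q V(1)])
    have "(\<lambda>n. (1 / 2 :: real) ^ n) \<longlonglongrightarrow> 0" by (rule LIMSEQ_power_zero) simp
    from tendsto_add[OF filterlim_compose[OF this n_lim] tendsto_mult_right_zero[OF tendsto_mult_right_zero[OF en_lim]], of D K]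
    have "(\<lambda>k. (1 / 2) ^ n k + D * (K * e (n k))) \<longlonglongrightarrow> 0" by simp
    from order_tendstoD(2)[OF this r'] obtain N' where N': "\<And>k. N' \<le> k \<Longrightarrow> (1 / 2) ^ n k + D * (K * e (n k)) < r'"
      unfolding eventually_sequentially by blast
    have "AE t in leb T. norm (u' k t - us t) \<le> r'" if k: "N' \<le> k" for k
    proof -
      have "AE t in leb T. norm (u (n k) t - us t) \<le> (1 / 2) ^ n k"
        by (rule Lp_norm_infinity_bound[OF d[of "n k", unfolded q] less_imp_le[OF d_less[of "n k", unfolded q]]])
      then show ?thesis using D
      proof eventually_elim
        case (elim t)
        have "V t * (K * e (n k)) \<le> D * (K * e (n k))"
          using elim(2) K e_le(1)[of "n k"] by (intro mult_right_mono) auto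
        then show ?case using u'_diff[of k t] elim(1) N'[OF k] by linarith
      qed
    qed
    then show "\<exists>N. \<forall>k\<ge>N. AE t in leb T. norm (u' k t - us t) \<le> r'" by blast
  qed
  from order_tendstoD(2)[OF this r] obtain k where k: "X_norm p q T (\<lambda>t. x' k t - xs t) (\<lambda>t. u' k t - us t) < r"
    unfolding eventually_sequentially by blast
  \<comment> \<open>The chain runs from the optimal cost to the corrected cost, then to the
    uncorrected cost plus the price of the correction, then to the penalised cost, which lies
    strictly below the optimal one.\<close>
  have "objective T \<theta> xs us \<le> objective T \<theta> (x' k) (u' k)" by (rule best[OF feas' k])
  also have "\<dots> \<le> objective T \<theta> (x (n k)) (u (n k)) + L * (K * norm (\<xi> (n k)))"
  proof -
    have "K * norm (\<xi> (n k)) \<le> 1" using K\<xi>[of k] Ke(2)[of k] by linarith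
    have "\<bar>objective T \<theta> (x' k) (u' k) - objective T \<theta> (x (n k)) (u (n k))\<bar> \<le> L * (K * norm (\<xi> (n k)))"
      unfolding x'_def u'_def by (rule incr[OF y_cont _ c \<open>K * norm (\<xi> (n k)) \<le> 1\<close>]) (rule y)
    then show ?thesis by linarith
  qed
  also have "L * (K * norm (\<xi> (n k))) \<le> pc (n k) * norm (x (n k) T - xT)"
  proof -
    have "L * K \<le> pc (n k)" using N2 nk(3)[of k] pc[of "n k"] by linarith
    then have "L * K * norm (\<xi> (n k)) \<le> pc (n k) * norm (\<xi> (n k))" by (rule mult_right_mono) simp
    then show ?thesis by (simp add: \<xi>_def norm_minus_commute mult.assoc)
  qed
  finally show False using better[of "n k"] by linarith
qed

end
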